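(* Let $k>0$, let $D\subset\mathbb{R}^2$, $\Gamma$ and $n$ be as described in the context (in particular $\mathrm{Im}(n)\ge c>0$ a.e. in $D$), and let $u^i$ be one of the admissible incident fields (a plane wave with direction $d\in\mathbb{S}^1$ or a point source located at $z\in\Gamma$). Then the direct scattering problem stated in the context has at most one solution $u^s\in H^2_{loc}(\mathbb{R}^2)$.
   Context: Setting. $D\subset\mathbb{R}^2$ is a bounded open set with $C^2$-smooth boundary $\partial D$ with unit outward normal $\nu$. $\Gamma$ is a closed curve (the measurement curve) with $\overline{D}\subset\mathrm{int}(\Gamma)$, where $\mathrm{int}(\Gamma)$ is the region enclosed by $\Gamma$. $k>0$ is the wavenumber. The coefficient $n$ is a complex-valued function with $\mathrm{supp}(n-1)=D$ (so $n=1$ outside $D$), $n\in L^\infty(D)$, and there is a constant $c>0$ with $\mathrm{Im}(n(x))\ge c>0$ for a.e. $x\in D$. Incident fields. $u^i$ is either a plane wave $u^i(x,d)=e^{\mathrm{i}kx\cdot d}$ with $d\in\mathbb{S}^1$, or a point source $u^i(x,z)=\mathbb{G}(x,z;k)$ with $z\in\Gamma$, where $$\mathbb{G}(x,z;k)=\frac{\mathrm{i}}{8k^2}\left[H^{(1)}_0(k|x-z|)-H^{(1)}_0(\mathrm{i}k|x-z|)\right],\quad x\ne z,$$ and $H^{(1)}_0$ is the Hankel function of the first kind of order $0$. Direct scattering problem. Find $u^s\in H^2_{loc}(\mathbb{R}^2)$ such that: (1) $\Delta^2u^s-k^4n(x)u^s=-k^4(1-n(x))u^i$ in $\mathbb{R}^2$;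 (2) the total field $u=u^s+u^i$ satisfies $[\![u]\!]=[\![\partial_\nu u]\!]=[\![\Delta u]\!]=[\![\partial_\nu\Delta u]\!]=0$ on $\partial D$, where $[\![\phi]\!]:=\phi_+|_{\partial D}-\phi_-|_{\partial D}$ is the difference of the traces taken from $\mathbb{R}^2\setminus\overline{D}$ ($+$) and from $D$ ($-$); (3) (radiation condition) with $r=|x|$, $\lim_{r\to\infty}\sqrt r(\partial_ru^s-\mathrm{i}ku^s)=0$ and $\lim_{r\to\infty}\sqrt r(\partial_r\Delta u^s-\mathrm{i}k\Delta u^s)=0$, uniformly in all directions $\hat x=x/|x|\in\mathbb{S}^1$. *)

theory Defs
  imports "HOL-Analysis.Analysis"
begin

definition partial_deriv :: "2 \<Rightarrow> (real^2 \<Rightarrow> 'b::real_normed_vector) \<Rightarrow> real^2 \<Rightarrow> 'b" where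
  "partial_deriv i f x = frechet_derivative f (at x) (axis i 1)"

definition directional_deriv :: "real^2 \<Rightarrow> (real^2 \<Rightarrow> 'b::real_normed_vector) \<Rightarrow> real^2 \<Rightarrow> 'b" where
  "directional_deriv v f x = frechet_derivative f (at x) v"

definition laplacian :: "(real^2 \<Rightarrow> 'b::real_normed_vector) \<Rightarrow> real^2 \<Rightarrow> 'b" where
  "laplacian f x = (\<Sum>i\<in>UNIV. partial_deriv i (partial_deriv i f) x)"

definition gradient :: "(real^2 \<Rightarrow> real) \<Rightarrow> real^2 \<Rightarrow> real^2" where
  "gradient f x = (\<chi> i. partial_deriv i f x)"

text \<open>\<open>Ck_on m S f\<close> is only used for open \<open>S\<close>.\<close>

primrec Ck_on :: "nat \<Rightarrow> (real^2) set \<Rightarrow> (real^2 \<Rightarrow> 'b::real_normed_vector) \<Rightarrow> bool" where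
  "Ck_on 0 S f \<longleftrightarrow> continuous_on S f"
| "Ck_on (Suc m) S f \<longleftrightarrow> f differentiable_on S \<and> (\<forall>i. Ck_on m S (partial_deriv i f))"

definition smooth :: "(real^2 \<Rightarrow> 'b::real_normed_vector) \<Rightarrow> bool" where
  "smooth f \<longleftrightarrow> (\<forall>m. Ck_on m UNIV f)"

definition test_function :: "(real^2) set \<Rightarrow> (real^2 \<Rightarrow> complex) \<Rightarrow> bool" where
  "test_function \<Omega> \<phi> \<longleftrightarrow>
     smooth \<phi> \<and> compact (closure {x. \<phi> x \<noteq> 0}) \<and> closure {x. \<phi> x \<noteq> 0} \<subseteq> \<Omega>"

text \<open>Elements of the Lebesgue and Sobolev spaces are represented by functions, to be understood
  up to equality almost everywhere.\<close>

definition L1_loc :: "(real^2) set \<Rightarrow> (real^2 \<Rightarrow> complex) \<Rightarrow> bool" where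
  "L1_loc \<Omega> f \<longleftrightarrow> (\<forall>K. compact K \<and> K \<subseteq> \<Omega> \<longrightarrow> set_integrable lebesgue K f)"

definition L2_on :: "(real^2) set \<Rightarrow> (real^2 \<Rightarrow> complex) \<Rightarrow> bool" where
  "L2_on \<Omega> f \<longleftrightarrow>
     set_borel_measurable lebesgue \<Omega> f \<and> set_integrable lebesgue \<Omega> (\<lambda>x. (norm (f x))\<^sup>2)"

definition L2_loc :: "(real^2) set \<Rightarrow> (real^2 \<Rightarrow> complex) \<Rightarrow> bool" where
  "L2_loc \<Omega> f \<longleftrightarrow> (\<forall>K. compact K \<and> K \<subseteq> \<Omega> \<longrightarrow> L2_on K f)"

definition weak_partial :: "(real^2) set \<Rightarrow> 2 \<Rightarrow> (real^2 \<Rightarrow> complex) \<Rightarrow> (real^2 \<Rightarrow> complex) \<Rightarrow> bool" where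
  "weak_partial \<Omega> i f g \<longleftrightarrow> L1_loc \<Omega> f \<and> L1_loc \<Omega> g \<and>
     (\<forall>\<phi>. test_function \<Omega> \<phi> \<longrightarrow>
        (LINT x:\<Omega>|lebesgue. f x * partial_deriv i \<phi> x) = - (LINT x:\<Omega>|lebesgue. g x * \<phi> x))"

definition weak_laplacian :: "(real^2) set \<Rightarrow> (real^2 \<Rightarrow> complex) \<Rightarrow> (real^2 \<Rightarrow> complex) \<Rightarrow> bool" where
  "weak_laplacian \<Omega> f g \<longleftrightarrow> L1_loc \<Omega> f \<and> L1_loc \<Omega> g \<and>
     (\<forall>\<phi>. test_function \<Omega> \<phi> \<longrightarrow>
        (LINT x:\<Omega>|lebesgue. f x * laplacian \<phi> x) = (LINT x:\<Omega>|lebesgue. g x * \<phi> x))"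

definition H2_loc :: "(real^2 \<Rightarrow> complex) \<Rightarrow> bool" where
  "H2_loc f \<longleftrightarrow> L2_loc UNIV f \<and>
     (\<exists>g h. (\<forall>i. weak_partial UNIV i f (g i) \<and> L2_loc UNIV (g i)) \<and>
            (\<forall>i j. weak_partial UNIV j (g i) (h i j) \<and> L2_loc UNIV (h i j)))"

definition ess_support :: "(real^2 \<Rightarrow> complex) \<Rightarrow> (real^2) set" where
  "ess_support f =
     {x. \<forall>U. open U \<and> x \<in> U \<longrightarrow> \<not> (AE y in lebesgue. y \<in> U \<longrightarrow> f y = 0)}"

definition C2_defining_function :: "(real^2) set \<Rightarrow> (real^2) set \<Rightarrow> (real^2 \<Rightarrow> real) \<Rightarrow> bool" where
  "C2_defining_function D U \<rho> \<longleftrightarrow> open U \<and> Ck_on 2 U \<rho> \<and> (\<forall>x\<in>U. gradient \<rho> x \<noteq> 0) \<and>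
     D \<inter> U = {x\<in>U. \<rho> x < 0}"

definition C2_boundary :: "(real^2) set \<Rightarrow> bool" where
  "C2_boundary D \<longleftrightarrow> (\<forall>p\<in>frontier D. \<exists>U \<rho>. p \<in> U \<and> C2_defining_function D U \<rho>)"

definition outward_normal :: "(real^2) set \<Rightarrow> real^2 \<Rightarrow> real^2" where
  "outward_normal D p =
     (THE v. \<exists>U \<rho>. p \<in> U \<and> C2_defining_function D U \<rho> \<and> v = sgn (gradient \<rho> p))"

text \<open>Arc length on \<open>frontier D\<close> is the one-dimensional Hausdorff measure. It is a metric outer
  measure, hence countably additive on the Borel sets, so that \<open>measure_of\<close> does not collapse
  to the zero measure.\<close>

definition hausdorff1_pre :: "real \<Rightarrow> (real^2) set \<Rightarrow> ennreal" where
  "hausdorff1_pre \<delta> A =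
     (INF C\<in>{C :: nat \<Rightarrow> (real^2) set. A \<subseteq> (\<Union>j. C j) \<and> (\<forall>j. bounded (C j) \<and> diameter (C j) \<le> \<delta>)}.
        \<Sum>j. ennreal (diameter (C j)))"

definition hausdorff1 :: "(real^2) measure" where
  "hausdorff1 = measure_of UNIV (sets borel) (\<lambda>A. SUP \<delta>\<in>{0<..}. hausdorff1_pre \<delta> A)"

text \<open>For \<open>u\<close> in \<open>H\<^sup>2\<close> the functions \<open>u\<close> and \<open>\<Delta>u\<close> are merely known to be square integrable with
  square integrable Laplacian on either side of \<open>frontier D\<close>, so that the traces of \<open>\<Delta>u\<close> and of
  its normal derivative are distributions on the boundary (in \<open>H\<close> of order \<open>-1/2\<close> and
  \<open>-3/2\<close>). As usual, they are defined by density of the functions smooth up to the boundary, with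
  respect to the norm given by \<open>f\<close> and \<open>\<Delta>f\<close> in \<open>L\<^sup>2\<close>. A trace \<open>T\<close> is represented by its action
  \<open>\<psi> \<mapsto> \<integral> T \<psi>\<close> on restrictions of test functions; the open set \<open>U\<close> makes the notion local to the
  boundary. The normal derivative is always with respect to the normal pointing out of \<open>D\<close>, also
  when \<open>\<Omega>\<close> is the exterior.\<close>

definition has_traces ::
  "(real^2) set \<Rightarrow> (real^2) set \<Rightarrow> (real^2 \<Rightarrow> complex) \<Rightarrow>
   ((real^2 \<Rightarrow> complex) \<Rightarrow> complex) \<Rightarrow> ((real^2 \<Rightarrow> complex) \<Rightarrow> complex) \<Rightarrow> bool" where
  "has_traces D \<Omega> f T\<^sub>0 T\<^sub>1 \<longleftrightarrow>
     (\<exists>U g p. open U \<and> frontier D \<subseteq> U \<and>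
        L2_on (\<Omega> \<inter> U) f \<and> L2_on (\<Omega> \<inter> U) g \<and> weak_laplacian (\<Omega> \<inter> U) f g \<and>
        (\<forall>m::nat. smooth (p m)) \<and>
        (\<lambda>m. \<integral>\<^sup>+x\<in>\<Omega> \<inter> U. ennreal ((norm (p m x - f x))\<^sup>2) \<partial>lebesgue) \<longlonglongrightarrow> 0 \<and>
        (\<lambda>m. \<integral>\<^sup>+x\<in>\<Omega> \<inter> U. ennreal ((norm (laplacian (p m) x - g x))\<^sup>2) \<partial>lebesgue) \<longlonglongrightarrow> 0 \<and>
        (\<forall>\<psi>. test_function UNIV \<psi> \<longrightarrow>
           (\<lambda>m. LINT y:frontier D|hausdorff1. p m y * \<psi> y) \<longlonglongrightarrow> T\<^sub>0 \<psi> \<and>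
           (\<lambda>m. LINT y:frontier D|hausdorff1.
                  directional_deriv (outward_normal D y) (p m) y * \<psi> y) \<longlonglongrightarrow> T\<^sub>1 \<psi>))"

text \<open>\<open>w\<close> is \<open>\<Delta>u\<close> on the two sides of the boundary; the superscripted letters are the traces of
  \<open>u\<close>, \<open>\<partial>\<^sub>\<nu>u\<close>, \<open>\<Delta>u\<close>, \<open>\<partial>\<^sub>\<nu>\<Delta>u\<close> from the exterior (\<open>P\<close>, plus) and from \<open>D\<close> (\<open>M\<close>, minus).\<close>

definition transmission_conditions :: "(real^2) set \<Rightarrow> (real^2 \<Rightarrow> complex) \<Rightarrow> bool" where
  "transmission_conditions D u \<longleftrightarrow>
     (\<exists>w P\<^sub>0 P\<^sub>1 P\<^sub>2 P\<^sub>3 M\<^sub>0 M\<^sub>1 M\<^sub>2 M\<^sub>3.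
        weak_laplacian (- frontier D) u w \<and>
        has_traces D (- closure D) u P\<^sub>0 P\<^sub>1 \<and> has_traces D (- closure D) w P\<^sub>2 P\<^sub>3 \<and>
        has_traces D D u M\<^sub>0 M\<^sub>1 \<and> has_traces D D w M\<^sub>2 M\<^sub>3 \<and>
        (\<forall>\<psi>. test_function UNIV \<psi> \<longrightarrow>
           P\<^sub>0 \<psi> - M\<^sub>0 \<psi> = 0 \<and> P\<^sub>1 \<psi> - M\<^sub>1 \<psi> = 0 \<and> P\<^sub>2 \<psi> - M\<^sub>2 \<psi> = 0 \<and> P\<^sub>3 \<psi> - M\<^sub>3 \<psi> = 0))"

definition bessel_J0 :: "complex \<Rightarrow> complex" where
  "bessel_J0 z = (\<Sum>m. (- 1) ^ m * (z / 2) ^ (2 * m) / (fact m)\<^sup>2)"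

definition bessel_Y0 :: "complex \<Rightarrow> complex" where
  "bessel_Y0 z = 2 / of_real pi *
     ((Ln (z / 2) + euler_mascheroni) * bessel_J0 z -
      (\<Sum>m. (- 1) ^ m * harm m * (z / 2) ^ (2 * m) / (fact m)\<^sup>2))"

definition hankel1_0 :: "complex \<Rightarrow> complex" where
  "hankel1_0 z = bessel_J0 z + \<i> * bessel_Y0 z"

text \<open>The value at \<open>x = z\<close> is immaterial.\<close>

definition green :: "real \<Rightarrow> real^2 \<Rightarrow> real^2 \<Rightarrow> complex" where
  "green k z x = \<i> / (8 * (of_real k)\<^sup>2) *
     (hankel1_0 (of_real (k * norm (x - z))) - hankel1_0 (\<i> * of_real (k * norm (x - z))))"

definition plane_wave :: "real \<Rightarrow> real^2 \<Rightarrow> real^2 \<Rightarrow> complex" where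
  "plane_wave k d x = exp (\<i> * of_real (k * (x \<bullet> d)))"

definition incident_field :: "real \<Rightarrow> (real^2) set \<Rightarrow> (real^2 \<Rightarrow> complex) \<Rightarrow> bool" where
  "incident_field k \<Gamma> ui \<longleftrightarrow>
     (\<exists>d. norm d = 1 \<and> ui = plane_wave k d) \<or> (\<exists>z\<in>\<Gamma>. ui = green k z)"

definition scatterer :: "(real^2) set \<Rightarrow> bool" where
  "scatterer D \<longleftrightarrow> bounded D \<and> open D \<and> C2_boundary D"

text \<open>The set \<open>D\<close> is open while supports are closed, so \<open>supp (n - 1) = D\<close> is
  read up to the boundary of \<open>D\<close>.\<close>

definition admissible_coefficient :: "(real^2) set \<Rightarrow> (real^2 \<Rightarrow> complex) \<Rightarrow> bool" where
  "admissible_coefficient D n \<longleftrightarrow>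
     n \<in> borel_measurable lebesgue \<and>
     ess_support (\<lambda>x. n x - 1) = closure D \<and>
     (AE x in lebesgue. x \<notin> D \<longrightarrow> n x = 1) \<and>
     (\<exists>B. AE x in lebesgue. x \<in> D \<longrightarrow> norm (n x) \<le> B) \<and>
     (\<exists>c>0. AE x in lebesgue. x \<in> D \<longrightarrow> Im (n x) \<ge> c)"

definition biharmonic_equation ::
  "real \<Rightarrow> (real^2 \<Rightarrow> complex) \<Rightarrow> (real^2 \<Rightarrow> complex) \<Rightarrow> (real^2 \<Rightarrow> complex) \<Rightarrow> bool" where
  "biharmonic_equation k n ui us \<longleftrightarrow>
     (\<forall>\<phi>. test_function UNIV \<phi> \<longrightarrow>
        (LINT x|lebesgue. us x * laplacian (laplacian \<phi>) x - of_real k ^ 4 * n x * us x * \<phi> x) =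
        (LINT x|lebesgue. - (of_real k ^ 4) * (1 - n x) * ui x * \<phi> x))"

definition sommerfeld :: "real \<Rightarrow> (real^2 \<Rightarrow> complex) \<Rightarrow> bool" where
  "sommerfeld k v \<longleftrightarrow>
     uniform_limit (sphere 0 1)
       (\<lambda>r \<xi>. of_real (sqrt r) *
          (directional_deriv \<xi> v (r *\<^sub>R \<xi>) - \<i> * of_real k * v (r *\<^sub>R \<xi>)))
       (\<lambda>_. 0) at_top"

text \<open>The scattered field is a class of functions modulo null sets. By interior regularity it has a
  smooth representative outside \<open>closure D\<close>, whose pointwise derivatives enter the radiation
  condition.\<close>

definition radiation_condition :: "real \<Rightarrow> (real^2) set \<Rightarrow> (real^2 \<Rightarrow> complex) \<Rightarrow> bool" where
  "radiation_condition k D us \<longleftrightarrow>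
     (\<exists>v. Ck_on 3 (- closure D) v \<and> (AE x in lebesgue. x \<notin> closure D \<longrightarrow> us x = v x) \<and>
        sommerfeld k v \<and> sommerfeld k (laplacian v))"

definition scattering_solution ::
  "real \<Rightarrow> (real^2) set \<Rightarrow> (real^2 \<Rightarrow> complex) \<Rightarrow> (real^2 \<Rightarrow> complex) \<Rightarrow> (real^2 \<Rightarrow> complex) \<Rightarrow> bool" where
  "scattering_solution k D n ui us \<longleftrightarrow>
     H2_loc us \<and>
     biharmonic_equation k n ui us \<and>
     transmission_conditions D (\<lambda>x. us x + ui x) \<and>
     radiation_condition k D us"

end

theory Submission
  imports Defs
begin

text \<open>
  The difference \<open>w\<close> of two solutions satisfies \<open>\<Delta>\<^sup>2 w = k\<^sup>4 n w\<close> weakly in the whole plane, so the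
  incident field and the transmission conditions drop out. Put \<open>H = (k\<^sup>2 w - \<Delta>w) / (2 k\<^sup>2)\<close> and
  \<open>M = (k\<^sup>2 w + \<Delta>w) / (2 k\<^sup>2)\<close>; then \<open>w = H + M\<close>, \<open>\<Delta>H = - k\<^sup>2 H + \<rho>\<close> and \<open>\<Delta>M = k\<^sup>2 M - \<rho>\<close> with
  \<open>\<rho> = k\<^sup>2 (1 - n) w / 2\<close> supported in \<open>D\<close>.

  For either function the imaginary part of the energy identity expresses the average flux through
  large circles by an integral over \<open>D\<close>, and the radiation condition makes the flux comparable to the mean
  of the squared modulus over large annuli. For \<open>M\<close> the real part of the energy identity (a
  Caccioppoli estimate) then gives square integrability, so its flux vanishes. The flux of \<open>H\<close> is
  therefore \<open>- k\<^sup>2 / 2\<close> times the integral of \<open>Im n \<bar>w\<bar>\<^sup>2\<close>, but it is also nonnegative; hence \<open>w = 0\<close> in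
  \<open>D\<close> and \<open>\<rho> = 0\<close>. Now \<open>M = 0\<close> by the Caccioppoli estimate, while \<open>H\<close> is an entire solution of the
  Helmholtz equation whose mean square over large annuli tends to \<open>0\<close> after division by the radius.
  A Rellich type identity with a bounded multiplier shows that such a solution vanishes.

  All integrations by parts are performed on mollifications, which are smooth and converge in \<open>L\<^sup>2\<close>
  on balls.
\<close>

subsection \<open>Partial derivatives and test functions\<close>

text \<open>The splitting comes from \<open>\<Delta>\<^sup>2 - k\<^sup>4 = (\<Delta> - k\<^sup>2)
  (\<Delta> + k\<^sup>2)\<close>: one fourth-order problem becomes two second-order ones that share
  a source. The radiation condition is natural only for H. For M it serves to show that the square
  integral over balls grows at most linearly, and the coercive sign of \<open>k\<^sup>2\<close>
  improves this to boundedness. Regularity shapes the rest: the gradient of the weak solution is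
  used only far out, through a classical representative. Circles are therefore replaced by the
  gradient of a radial cutoff, and each energy identity is freed of the gradient near D before the
  mollification parameter tends to infinity. Once the source is known to vanish, H is a solution in
  the whole plane, so neither an expansion in Hankel functions nor unique continuation across the
  boundary of D enters. The Rellich multiplier has to be bounded because the square integral of H
  over the ball of radius R is only o(R), while integration by parts against a cutoff of radius R
  gains just a factor 1/R.\<close>

lemma partial_deriv_eq:
  "(f has_derivative f') (at x) \<Longrightarrow> partial_deriv i f x = f' (axis i 1)"
  unfolding partial_deriv_def by (metis frechet_derivative_at)

lemma has_derivative_partial:
  fixes f :: "real^2 \<Rightarrow> 'b::real_normed_vector"
  assumes "f differentiable (at x)"
  shows "(f has_derivative (\<lambda>h. \<Sum>i\<in>UNIV. (h $ i) *\<^sub>R partial_deriv i f x)) (at x)"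
proof -
  let ?D = "frechet_derivative f (at x)"
  have D: "(f has_derivative ?D) (at x)" using assms by (simp add: frechet_derivative_works)
  interpret bounded_linear ?D using D by (rule has_derivative_bounded_linear)
  have "?D h = (\<Sum>i\<in>UNIV. (h $ i) *\<^sub>R partial_deriv i f x)" for h
  proof -
    have "?D h = ?D (\<Sum>i\<in>UNIV. (h $ i) *\<^sub>R axis i 1)"
      using basis_expansion[of h] by (simp add: scalar_mult_eq_scaleR)
    then show ?thesis by (simp add: sum scaleR partial_deriv_def)
  qed
  then have "?D = (\<lambda>h. \<Sum>i\<in>UNIV. (h $ i) *\<^sub>R partial_deriv i f x)" by blast
  with D show ?thesis by simp
qed

lemma directional_deriv_partial:
  fixes f :: "real^2 \<Rightarrow> 'b::real_normed_vector"
  assumes "f differentiable (at x)"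
  shows "directional_deriv v f x = (\<Sum>i\<in>UNIV. (v $ i) *\<^sub>R partial_deriv i f x)"
  by (simp add: directional_deriv_def frechet_derivative_at[OF has_derivative_partial[OF assms], symmetric])

text \<open>\<open>frechet_derivative\<close> is a choice among the derivatives at the point.
  Functions that agree near \<open>x\<close> have the same derivatives there, so the choices
  coincide even where neither function is differentiable.\<close>

lemma partial_deriv_cong_open:
  assumes "open S" "x \<in> S" "\<And>y. y \<in> S \<Longrightarrow> f y = g y"
  shows "partial_deriv i f x = partial_deriv i g x"
proof -
  have "(f has_derivative f') (at x) \<longleftrightarrow> (g has_derivative f') (at x)" for f'
    using assms has_derivative_transform_within_open[of f f' x UNIV S g]
      has_derivative_transform_within_open[of g f' x UNIV S f] by auto
  then show ?thesis unfolding partial_deriv_def frechet_derivative_def by simp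
qed

lemma partial_deriv_add:
  "f differentiable (at x) \<Longrightarrow> g differentiable (at x) \<Longrightarrow>
   partial_deriv i (\<lambda>x. f x + g x) x = partial_deriv i f x + partial_deriv i g x"
  unfolding partial_deriv_def
  by (subst frechet_derivative_at[symmetric, OF has_derivative_add])
     (auto simp: frechet_derivative_works[symmetric])

lemma partial_deriv_mult:
  fixes f g :: "real^2 \<Rightarrow> 'b::real_normed_algebra"
  shows "f differentiable (at x) \<Longrightarrow> g differentiable (at x) \<Longrightarrow>
   partial_deriv i (\<lambda>x. f x * g x) x = f x * partial_deriv i g x + partial_deriv i f x * g x"
  unfolding partial_deriv_def
  by (subst frechet_derivative_at[symmetric, OF has_derivative_mult])
     (auto simp: frechet_derivative_works[symmetric])

lemma partial_deriv_linear:
  assumes "bounded_linear L" "f differentiable (at x)"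
  shows "partial_deriv i (\<lambda>x. L (f x)) x = L (partial_deriv i f x)"
  unfolding partial_deriv_def
  by (subst frechet_derivative_at[symmetric, OF bounded_linear.has_derivative[OF assms(1)]])
     (use assms in \<open>auto simp: frechet_derivative_works[symmetric]\<close>)

lemma partial_deriv_reflect:
  assumes "f differentiable (at (x - y))"
  shows "partial_deriv i (\<lambda>y. f (x - y)) y = - partial_deriv i f (x - y)"
proof -
  let ?D = "frechet_derivative f (at (x - y))"
  have D: "(f has_derivative ?D) (at (x - y))" using assms by (simp add: frechet_derivative_works)
  have "((\<lambda>y. f (x - y)) has_derivative (\<lambda>h. ?D (- h))) (at y)"
    by (rule has_derivative_compose[of "\<lambda>y. x - y" "\<lambda>h. - h" y UNIV f, OF _ D])
       (auto intro!: derivative_eq_intros)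
  then have "partial_deriv i (\<lambda>y. f (x - y)) y = ?D (- axis i 1)" by (rule partial_deriv_eq)
  also have "\<dots> = - ?D (axis i 1)"
    using D by (simp add: has_derivative_bounded_linear linear_simps)
  finally show ?thesis by (simp add: partial_deriv_def)
qed

lemma Ck_on_Suc_imp: "Ck_on (Suc m) S f \<Longrightarrow> Ck_on m S f"
proof (induction m arbitrary: f)
  case 0
  then show ?case by (simp add: differentiable_imp_continuous_on)
next
  case (Suc m)
  then show ?case by auto
qed

lemma Ck_on_mono: "Ck_on m S f \<Longrightarrow> j \<le> m \<Longrightarrow> Ck_on j S f"
  by (induction m) (auto simp: le_Suc_eq simp del: Ck_on.simps(2) dest: Ck_on_Suc_imp)

lemma Ck_on_const [simp]: "Ck_on m UNIV (\<lambda>x. c)"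
proof (induction m arbitrary: c)
  case (Suc m)
  have "partial_deriv i (\<lambda>x. c) = (\<lambda>x. 0)" for i
    by (rule ext, subst partial_deriv_eq[of _ "\<lambda>h. 0"]) auto
  with Suc show ?case by simp
qed simp

lemma Ck_on_add: "Ck_on m UNIV f \<Longrightarrow> Ck_on m UNIV g \<Longrightarrow> Ck_on m UNIV (\<lambda>x. f x + g x)"
proof (induction m arbitrary: f g)
  case 0 then show ?case by (simp add: continuous_on_add)
next
  case (Suc m)
  then have d: "f differentiable (at x)" "g differentiable (at x)" for x
    by (auto simp: differentiable_on_def)
  have "partial_deriv i (\<lambda>x. f x + g x) = (\<lambda>x. partial_deriv i f x + partial_deriv i g x)" for i
    by (rule ext, rule partial_deriv_add[OF d])
  with Suc show ?case by (auto simp: differentiable_on_def)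
qed

lemma Ck_on_mult:
  fixes f g :: "real^2 \<Rightarrow> 'b::real_normed_algebra"
  shows "Ck_on m UNIV f \<Longrightarrow> Ck_on m UNIV g \<Longrightarrow> Ck_on m UNIV (\<lambda>x. f x * g x)"
proof (induction m arbitrary: f g)
  case 0 then show ?case by (simp add: continuous_on_mult)
next
  case (Suc m)
  then have d: "f differentiable (at x)" "g differentiable (at x)" for x
    by (auto simp: differentiable_on_def)
  have "partial_deriv i (\<lambda>x. f x * g x) =
      (\<lambda>x. f x * partial_deriv i g x + partial_deriv i f x * g x)" for i
    by (rule ext, rule partial_deriv_mult[OF d])
  moreover have "Ck_on m UNIV f" "Ck_on m UNIV g" using Suc.prems Ck_on_Suc_imp by blast+
  ultimately show ?case using Suc d
    by (auto simp: differentiable_on_def intro!: Ck_on_add)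
qed

lemma Ck_on_linear:
  assumes "bounded_linear L"
  shows "Ck_on m UNIV f \<Longrightarrow> Ck_on m UNIV (\<lambda>x. L (f x))"
proof (induction m arbitrary: f)
  case 0 then show ?case by (simp add: bounded_linear.continuous_on[OF assms])
next
  case (Suc m)
  then have d: "f differentiable (at x)" for x
    by (auto simp: differentiable_on_def)
  have "partial_deriv i (\<lambda>x. L (f x)) = (\<lambda>x. L (partial_deriv i f x))" for i
    by (rule ext, rule partial_deriv_linear[OF assms d])
  moreover have "(\<lambda>x. L (f x)) differentiable (at x)" for x
    using d[of x] bounded_linear.has_derivative[OF assms] unfolding differentiable_def by blast
  ultimately show ?case using Suc by (auto simp: differentiable_on_def)
qed

lemma Ck_on_reflect: "Ck_on m UNIV f \<Longrightarrow> Ck_on m UNIV (\<lambda>y. f (x - y))"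
proof (induction m arbitrary: f)
  case 0
  then have "continuous_on UNIV f" by simp
  then have "continuous_on UNIV (\<lambda>y. f (x - y))"
    by (rule continuous_on_compose2) (auto intro!: continuous_intros)
  then show ?case by simp
next
  case (Suc m)
  then have d: "f differentiable (at x)" for x
    by (auto simp: differentiable_on_def)
  have "partial_deriv i (\<lambda>y. f (x - y)) = (\<lambda>y. - partial_deriv i f (x - y))" for i
    by (rule ext, rule partial_deriv_reflect[OF d])
  moreover have "(\<lambda>y. f (x - y)) differentiable (at z)" for z
    using d by (intro differentiable_compose[of f "\<lambda>y. x - y"]) (auto intro!: derivative_intros)
  moreover have "Ck_on m UNIV (\<lambda>y. - partial_deriv i f (x - y))" for i
    by (rule Ck_on_linear[OF bounded_linear_minus[OF bounded_linear_ident]], rule Suc.IH)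
       (use Suc.prems in simp)
  ultimately show ?case by (simp add: differentiable_on_def)
qed

lemma Ck_on_coord: "Ck_on m UNIV (\<lambda>x::real^2. x $ i)"
proof (cases m)
  case (Suc m)
  have "((\<lambda>x::real^2. x $ i) has_derivative (\<lambda>h. h $ i)) (at x)" for x
    by (rule bounded_linear_imp_has_derivative[OF bounded_linear_vec_nth])
  then have "partial_deriv j (\<lambda>x::real^2. x $ i) = (\<lambda>x. axis j 1 $ i)"
    "(\<lambda>x::real^2. x $ i) differentiable (at x)" for j x
    using partial_deriv_eq differentiable_def by blast+
  then show ?thesis using Suc by (auto simp: differentiable_on_def)
qed (auto intro!: continuous_intros)

lemma smooth_partial: "smooth f \<Longrightarrow> smooth (partial_deriv i f)"
  unfolding smooth_def by (metis Ck_on.simps(2))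

lemma smooth_differentiable: "smooth f \<Longrightarrow> f differentiable (at x)"
  unfolding smooth_def by (metis Ck_on.simps(2) UNIV_I at_within_open_NO_MATCH differentiable_on_def open_UNIV)

lemma smooth_continuous: "smooth f \<Longrightarrow> continuous_on UNIV f"
  unfolding smooth_def by (metis Ck_on.simps(1))

lemma partial_deriv_zero_outside:
  assumes "closed K" "\<And>x. x \<notin> K \<Longrightarrow> f x = 0" "x \<notin> K"
  shows "partial_deriv i f x = 0"
  using partial_deriv_cong_open[of "-K" x f "\<lambda>x. 0" i] partial_deriv_eq[of "\<lambda>x. 0" "\<lambda>x. 0" x i]
    assms by (auto simp: open_Compl)

lemma smooth_laplacian: "smooth f \<Longrightarrow> smooth (laplacian f)"
proof -
  assume "smooth f"
  then have "smooth (partial_deriv i (partial_deriv i f))" for i by (intro smooth_partial)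
  moreover have "laplacian f = (\<lambda>x. partial_deriv 1 (partial_deriv 1 f) x + partial_deriv 2 (partial_deriv 2 f) x)"
    by (rule ext) (simp add: laplacian_def sum_2)
  ultimately show ?thesis unfolding smooth_def by (metis Ck_on_add)
qed

lemma test_functionI:
  assumes "smooth f" "\<And>x. norm x > r \<Longrightarrow> f x = 0"
  shows "test_function UNIV f"
proof -
  have "{x. f x \<noteq> 0} \<subseteq> cball 0 r" using assms(2) by force
  then have "closure {x. f x \<noteq> 0} \<subseteq> cball 0 r" by (rule closure_minimal) simp
  then show ?thesis unfolding test_function_def using assms(1)
    by (metis bounded_cball bounded_subset closed_closure compact_eq_bounded_closed subset_UNIV)
qed

lemma test_function_support:
  assumes "test_function UNIV f"
  obtains r where "r > 0" "\<And>x. norm x > r \<Longrightarrow> f x = 0"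
proof -
  have "bounded {x. f x \<noteq> 0}" using assms unfolding test_function_def
    by (meson bounded_subset closure_subset compact_imp_bounded)
  then obtain r where "r > 0" "\<forall>x\<in>{x. f x \<noteq> 0}. norm x \<le> r" by (auto simp: bounded_pos)
  then show ?thesis using that[of r] by force
qed

lemma test_function_partial:
  assumes "test_function UNIV f" shows "test_function UNIV (partial_deriv i f)"
proof -
  obtain r where r: "\<And>x. norm x > r \<Longrightarrow> f x = 0" using test_function_support[OF assms] by blast
  show ?thesis
  proof (rule test_functionI[where r=r])
    show "smooth (partial_deriv i f)" using assms by (auto simp: test_function_def smooth_partial)
    show "partial_deriv i f x = 0" if "norm x > r" for x
      by (rule partial_deriv_zero_outside[of "cball 0 r"]) (use that r in auto)
  qed
qed

lemma laplacian_zero_outside: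
  assumes "closed K" "\<And>x. x \<notin> K \<Longrightarrow> f x = 0" "x \<notin> K"
  shows "laplacian f x = 0"
proof -
  have "partial_deriv i (partial_deriv i f) x = 0" for i
    using assms(1) partial_deriv_zero_outside[OF assms(1,2)] assms(3) by (rule partial_deriv_zero_outside)
  then show ?thesis by (simp add: laplacian_def)
qed

lemma test_function_laplacian:
  assumes "test_function UNIV f" shows "test_function UNIV (laplacian f)"
proof -
  obtain r where r: "\<And>x. norm x > r \<Longrightarrow> f x = 0" using test_function_support[OF assms] by blast
  show ?thesis
  proof (rule test_functionI[where r=r])
    show "smooth (laplacian f)" using assms by (auto simp: test_function_def smooth_laplacian)
    show "laplacian f x = 0" if "norm x > r" for x
      by (rule laplacian_zero_outside[of "cball 0 r"]) (use that r in auto)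
  qed
qed

lemma smooth_reflect: "smooth f \<Longrightarrow> smooth (\<lambda>y. f (x - y))"
  unfolding smooth_def using Ck_on_reflect by blast

lemma test_function_reflect:
  assumes "test_function UNIV f" shows "test_function UNIV (\<lambda>y. f (x - y))"
proof -
  obtain r where r: "\<And>x. norm x > r \<Longrightarrow> f x = 0" using test_function_support[OF assms] by blast
  show ?thesis
  proof (rule test_functionI[where r="r + norm x"])
    show "smooth (\<lambda>y. f (x - y))" using assms by (auto simp: test_function_def smooth_reflect)
    show "f (x - y) = 0" if "norm y > r + norm x" for y
      using norm_triangle_ineq2[of y x] that by (intro r) (simp add: norm_minus_commute)
  qed
qed

lemma laplacian_reflect:
  assumes "smooth f" shows "laplacian (\<lambda>y. f (x - y)) y = laplacian f (x - y)"
proof -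
  have "partial_deriv i (partial_deriv i (\<lambda>y. f (x - y))) y = partial_deriv i (partial_deriv i f) (x - y)" for i
  proof -
    have 1: "partial_deriv i (\<lambda>y. f (x - y)) = (\<lambda>y. - partial_deriv i f (x - y))"
      by (rule ext, rule partial_deriv_reflect, rule smooth_differentiable[OF assms])
    have d: "(partial_deriv i f) differentiable (at z)" for z
      by (rule smooth_differentiable[OF smooth_partial[OF assms]])
    have d2: "(\<lambda>y. partial_deriv i f (x - y)) differentiable (at y)"
      using d by (intro differentiable_compose[of "partial_deriv i f" "\<lambda>y. x - y"]) (auto intro!: derivative_intros)
    show ?thesis unfolding 1
      using partial_deriv_linear[OF bounded_linear_minus[OF bounded_linear_ident] d2, of i]
        partial_deriv_reflect[OF d, of i x y] by simp
  qed
  then show ?thesis by (simp add: laplacian_def)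
qed

text \<open>The profile of the mollifier: these functions are closed under differentiation.\<close>

definition bump_profile :: "nat \<Rightarrow> real \<Rightarrow> real" where
  "bump_profile j t = (if t > 0 then exp (- 1 / t) / t ^ j else 0)"

text \<open>The term of order \<open>j + 1\<close> of the exponential series at \<open>1/t\<close>
  is at most \<open>exp (1/t)\<close>. The point is the linear vanishing at 0: dividing
  \<open>bump_profile j\<close> by its argument gives \<open>bump_profile (Suc j)\<close>, so the
  bound for \<open>Suc j\<close> yields the derivative 0 at 0.\<close>

lemma bump_profile_bound: "\<bar>bump_profile j t\<bar> \<le> fact (j + 1) * \<bar>t\<bar>"
proof (cases "t > 0")
  case True
  have "(1/t) ^ (j + 1) / fact (j + 1) \<le> exp (1/t)"
  proof -
    have "(\<Sum>n\<in>{j + 1}. (1/t) ^ n /\<^sub>R fact n) \<le> (\<Sum>n. (1/t) ^ n /\<^sub>R fact n)"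
      by (rule sum_le_suminf) (use True in \<open>auto simp: divide_inverse_commute intro: summable_exp\<close>)
    then show ?thesis by (simp add: exp_def divide_inverse mult.commute)
  qed
  then have "1 \<le> fact (j + 1) * t ^ (j + 1) * exp (1/t)"
    using True by (simp add: power_divide divide_simps mult_ac)
  then have "exp (- 1/t) \<le> fact (j + 1) * t ^ (j + 1)"
    using True by (simp add: exp_minus divide_simps)
  then have "exp (- 1/t) / t ^ j \<le> fact (j + 1) * t"
    using True by (simp add: divide_simps mult_ac)
  then show ?thesis using True by (simp add: bump_profile_def)
next
  case False
  have "0 \<le> fact (j + 1) * \<bar>t\<bar>" by (intro mult_nonneg_nonneg) auto
  with False show ?thesis by (simp only: bump_profile_def if_False abs_zero)
qed

lemma bump_profile_Suc: "bump_profile j t = t * bump_profile (Suc j) t"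
  by (simp add: bump_profile_def)

lemma bump_profile_deriv:
  "(bump_profile j has_real_derivative (bump_profile (j + 2) t - real j * bump_profile (j + 1) t)) (at t)"
proof -
  consider "t > 0" | "t < 0" | "t = 0" by linarith
  then show ?thesis
  proof cases
    case 1
    have "((\<lambda>t. exp (- 1 / t) / t ^ j) has_real_derivative
       (bump_profile (j + 2) t - real j * bump_profile (j + 1) t)) (at t)"
      using 1 apply (auto intro!: derivative_eq_intros simp: bump_profile_def)
      apply (cases j) apply (auto simp: field_simps power2_eq_square)
      done
    then show ?thesis
      by (rule has_field_derivative_transform_within_open[of _ _ _ "{0<..}"])
         (use 1 in \<open>auto simp: bump_profile_def\<close>)
  next
    case 2
    have "((\<lambda>t. 0) has_real_derivative
       (bump_profile (j + 2) t - real j * bump_profile (j + 1) t)) (at t)"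
      using 2 by (auto simp: bump_profile_def)
    then show ?thesis
      by (rule has_field_derivative_transform_within_open[of _ _ _ "{..<0}"])
         (use 2 in \<open>auto simp: bump_profile_def\<close>)
  next
    case 3
    have "((\<lambda>h. (bump_profile j (0 + h) - bump_profile j 0) / h) \<longlongrightarrow> 0) (at 0)"
    proof (rule tendsto_0_le[where K=1 and f = "\<lambda>h::real. fact (j+2) * \<bar>h\<bar>"])
      show "((\<lambda>h::real. fact (j+2) * \<bar>h\<bar>) \<longlongrightarrow> 0) (at 0)" by (auto intro!: tendsto_eq_intros)
      show "\<forall>\<^sub>F h in at 0. norm ((bump_profile j (0 + h) - bump_profile j 0) / h) \<le> norm (fact (j + 2) * \<bar>h\<bar>) * 1"
        using bump_profile_bound[of "Suc j"] bump_profile_Suc[of j]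
        by (intro eventuallyI) (auto simp: bump_profile_def[of _ 0] abs_mult)
    qed
    then show ?thesis using 3 by (simp add: DERIV_def bump_profile_def[of _ 0])
  qed
qed

lemma bump_radial_deriv:
  "((\<lambda>x::real^2. bump_profile j (1 - a * (x \<bullet> x))) has_derivative
    (\<lambda>h. (bump_profile (j + 2) (1 - a * (x \<bullet> x)) - real j * bump_profile (j + 1) (1 - a * (x \<bullet> x))) * (- 2 * a * (x \<bullet> h)))) (at x)"
proof -
  have "((\<lambda>x::real^2. 1 - a * (x \<bullet> x)) has_derivative (\<lambda>h. - 2 * a * (x \<bullet> h))) (at x)"
    by (auto intro!: derivative_eq_intros simp: inner_commute)
  from DERIV_compose_FDERIV[OF bump_profile_deriv this] show ?thesis
    by (simp add: mult_ac)
qed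

text \<open>The right-hand side uses only sums and products, with \<open>(- real j) *\<close> in
  place of a subtraction. The closure rules for \<open>Ck_on\<close> then match syntactically, and
  the induction on the order of differentiability can vary \<open>j\<close>.\<close>

lemma bump_radial_partial:
  "partial_deriv i (\<lambda>x::real^2. bump_profile j (1 - a * (x \<bullet> x))) =
   (\<lambda>x. (bump_profile (j + 2) (1 - a * (x \<bullet> x)) + (- real j) * bump_profile (j + 1) (1 - a * (x \<bullet> x))) * ((- 2 * a) * x $ i))"
  by (rule ext, subst partial_deriv_eq[OF bump_radial_deriv]) (simp add: inner_axis)

lemma bump_radial_smooth: "Ck_on m UNIV (\<lambda>x::real^2. bump_profile j (1 - a * (x \<bullet> x)))"
proof (induction m arbitrary: j)
  case 0
  then show ?case using bump_radial_deriv
    by (auto simp: continuous_on_eq_continuous_at intro: has_derivative_continuous)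
next
  case (Suc m)
  have "(\<lambda>x::real^2. bump_profile j (1 - a * (x \<bullet> x))) differentiable (at x)" for x
    using bump_radial_deriv differentiable_def by blast
  moreover have "Ck_on m UNIV (partial_deriv i (\<lambda>x::real^2. bump_profile j (1 - a * (x \<bullet> x))))" for i
    unfolding bump_radial_partial
    by (intro Ck_on_mult Ck_on_add Suc.IH Ck_on_const Ck_on_coord)
  ultimately show ?case by (auto simp: differentiable_on_def)
qed

text \<open>The mixed derivative is computed explicitly, and the formula is symmetric in the two
  indices. The Rellich identity needs this symmetry; every mollified function inherits it from the
  kernel.\<close>

lemma bump_radial_symmetric:
  fixes f :: "real^2 \<Rightarrow> real" and a :: real
  defines "f \<equiv> (\<lambda>x::real^2. bump_profile 0 (1 - a * (x \<bullet> x)))"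
  shows "partial_deriv i (partial_deriv j f) = partial_deriv j (partial_deriv i f)"
proof (cases "i = j")
  case False
  have 1: "partial_deriv i (partial_deriv j f) x = (2 * a)\<^sup>2 * x $ i * x $ j *
      (bump_profile 4 (1 - a * (x \<bullet> x)) - 2 * bump_profile 3 (1 - a * (x \<bullet> x)))"
    if "i \<noteq> j" for i j x
  proof -
    have "partial_deriv j f = (\<lambda>x. bump_profile 2 (1 - a * (x \<bullet> x)) * ((- 2 * a) * x $ j))"
      unfolding f_def bump_radial_partial by (simp add: numeral_2_eq_2)
    moreover have "((\<lambda>x. bump_profile 2 (1 - a * (x \<bullet> x)) * ((- 2 * a) * x $ j)) has_derivative
       (\<lambda>h. (bump_profile (2 + 2) (1 - a * (x \<bullet> x)) - real 2 * bump_profile (2 + 1) (1 - a * (x \<bullet> x))) * (- 2 * a * (x \<bullet> h)) * ((- 2 * a) * x $ j)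
         + bump_profile 2 (1 - a * (x \<bullet> x)) * ((- 2 * a) * h $ j))) (at x)"
      by (rule has_derivative_eq_rhs[OF has_derivative_mult[OF bump_radial_deriv]])
         (auto intro!: derivative_eq_intros bounded_linear.has_derivative[OF bounded_linear_vec_nth] simp: fun_eq_iff)
    moreover have "axis i (1::real) $ j = 0" using that by (simp add: axis_def)
    moreover have "Suc (Suc (Suc 0)) = 3" "Suc (Suc (Suc (Suc 0))) = 4" by simp_all
    ultimately show ?thesis
      by (simp add: partial_deriv_eq inner_axis power2_eq_square algebra_simps del: eval_nat_numeral)
  qed
  show ?thesis by (rule ext, subst (1 2) 1) (use False in \<open>auto simp: mult_ac\<close>)
qed simp

subsection \<open>Integration by parts and the mollifier\<close>

lemma borel_lebesgue [measurable_dest]: "f \<in> borel_measurable borel \<Longrightarrow> f \<in> borel_measurable lebesgue"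
  by (rule measurable_completion) simp

lemma continuous_borel_lebesgue: "continuous_on UNIV f \<Longrightarrow> f \<in> borel_measurable lebesgue"
  by (intro borel_lebesgue borel_measurable_continuous_onI)

lemma continuous_support_integrable:
  fixes f :: "real^2 \<Rightarrow> 'b::{banach, second_countable_topology}"
  assumes "continuous_on UNIV f" "\<And>x. norm x > r \<Longrightarrow> f x = 0"
  shows "integrable lebesgue f"
proof -
  have "integrable lborel (\<lambda>x. indicator (cball 0 r) x *\<^sub>R f x)"
    by (rule borel_integrable_compact) (use assms(1) in \<open>auto intro: continuous_on_subset\<close>)
  moreover have "(\<lambda>x. indicator (cball 0 r) x *\<^sub>R f x) = f"
    using assms(2) by (auto simp: fun_eq_iff indicator_def)
  ultimately show ?thesis
    using assms(1) by (simp add: integrable_completion borel_measurable_continuous_onI)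
qed

lemma continuous_support_bounded:
  fixes f :: "real^2 \<Rightarrow> 'b::real_normed_vector"
  assumes "continuous_on UNIV f" "\<And>x. norm x > r \<Longrightarrow> f x = 0"
  obtains B where "B > 0" "\<And>x. norm (f x) \<le> B"
proof -
  have "bounded (f ` cball 0 r)"
    using assms(1) by (intro compact_imp_bounded compact_continuous_image)
      (auto intro: continuous_on_subset)
  then obtain B where B: "B > 0" "\<forall>y\<in>f ` cball 0 r. norm y \<le> B" by (auto simp: bounded_pos)
  have "norm (f x) \<le> B" for x
    using B assms(2)[of x] by (cases "norm x \<le> r") auto
  with B(1) show ?thesis by (rule that)
qed

lemma continuous_support_uniform:
  fixes f :: "real^2 \<Rightarrow> 'b::real_normed_vector"
  assumes "continuous_on UNIV f" "\<And>x. norm x > r \<Longrightarrow> f x = 0" "e > 0"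
  obtains d where "d > 0" "\<And>x y. norm (x - y) < d \<Longrightarrow> norm (f x - f y) < e"
proof -
  have "uniformly_continuous_on (cball 0 (r + 1)) f"
    using assms(1) by (intro compact_uniformly_continuous) (auto intro: continuous_on_subset)
  then obtain d where d: "d > 0"
    "\<And>x y. x \<in> cball 0 (r + 1) \<Longrightarrow> y \<in> cball 0 (r + 1) \<Longrightarrow> dist y x < d \<Longrightarrow> dist (f y) (f x) < e"
    using assms(3) unfolding uniformly_continuous_on_def by metis
  have "norm (f x - f y) < e" if "norm (x - y) < min d 1" for x y
  proof (cases "norm x \<le> r + 1 \<and> norm y \<le> r + 1")
    case True
    then show ?thesis using d(2)[of y x] that by (auto simp: dist_norm)
  next
    case False
    have "norm x \<le> norm y + 1" "norm y \<le> norm x + 1"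
      using that norm_triangle_ineq3[of x y] by (auto simp: abs_le_iff)
    with False have "norm x > r" "norm y > r" by auto
    then show ?thesis using assms(2,3) by simp
  qed
  then show ?thesis using that[of "min d 1"] d(1) by auto
qed

lemma integral_lebesgue_reflect:
  fixes f :: "real^2 \<Rightarrow> 'b::euclidean_space"
  assumes "f \<in> borel_measurable borel"
  shows "(LINT y|lebesgue. f (x - y)) = (LINT y|lebesgue. f y)"
proof -
  have 1: "distr lborel borel (\<lambda>y. x - y) = (lborel :: (real^2) measure)"
    using lborel_affine[of "-1" x] by (simp add: density_1)
  have "(LINT y|lborel. f y) = (LINT y|distr lborel borel (\<lambda>y. x - y). f y)" by (simp add: 1)
  also have "\<dots> = (LINT y|lborel. f (x - y))"
    by (rule integral_distr) (use assms in auto)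
  finally show ?thesis using assms by (simp add: integral_completion)
qed

lemma integral_lebesgue_translate:
  fixes f :: "real^2 \<Rightarrow> 'b::euclidean_space"
  assumes [measurable]: "f \<in> borel_measurable borel"
  shows "(LINT y|lebesgue. f (y + x)) = (LINT y|lebesgue. f y)"
  using integral_lebesgue_reflect[of "\<lambda>y. f (x - y)" 0] integral_lebesgue_reflect[of f x]
  by (simp add: add.commute)

text \<open>Compact support makes the partial derivatives uniformly continuous, so the remainder is
  small uniformly in \<open>x\<close>; the shares \<open>e / 2\<close> of the two partial
  derivatives add up to \<open>e\<close>. The uniformity is what permits differentiation under a
  convolution integral.\<close>

lemma C1_linearization:
  fixes f :: "real^2 \<Rightarrow> 'b::real_normed_vector"
  assumes "Ck_on (Suc 0) UNIV f" "\<And>x. norm x > r \<Longrightarrow> f x = 0" "e > 0"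
  obtains d where "d > 0" "\<And>x h. norm h < d \<Longrightarrow>
     norm (f (x + h) - f x - (\<Sum>i\<in>UNIV. (h $ i) *\<^sub>R partial_deriv i f x)) \<le> e * norm h"
proof -
  have df: "f differentiable (at x)" for x using assms(1) by (simp add: differentiable_on_def)
  have c: "continuous_on UNIV (partial_deriv i f)" for i using assms(1) by simp
  have z: "partial_deriv i f x = 0" if "norm x > r" for i x
    by (rule partial_deriv_zero_outside[of "cball 0 r"]) (use that assms in auto)
  have "\<exists>d>0. \<forall>x y. norm (x - y) < d \<longrightarrow> norm (partial_deriv i f x - partial_deriv i f y) < e / 2" for i
    by (rule continuous_support_uniform[OF c[of i] z, where e = "e/2"]) (use assms(3) in auto)
  then obtain D where D: "\<And>i. D i > 0"
    "\<And>i x y. norm (x - y) < D i \<Longrightarrow> norm (partial_deriv i f x - partial_deriv i f y) < e / 2" by metis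
  define d where "d = min (D 1) (D 2)"
  have d: "d > 0" "\<And>i x y. norm (x - y) < d \<Longrightarrow> norm (partial_deriv i f x - partial_deriv i f y) < e / 2"
    using D exhaust_2 by (auto simp: d_def) (metis exhaust_2)
  let ?D = "\<lambda>x h. \<Sum>i\<in>UNIV. (h $ i) *\<^sub>R partial_deriv i f x"
  have "norm (f (x + h) - f x - ?D x h) \<le> e * norm h" if h: "norm h < d" for x h
  proof -
    have "norm (f (x + h) - f x - ?D x ((x + h) - x)) \<le> norm ((x + h) - x) * e"
    proof (rule differentiable_bound_linearization[where S = "ball x d"])
      show "x + t *\<^sub>R (x + h - x) \<in> ball x d" if "t \<in> {0..1}" for t
      proof -
        have "\<bar>t\<bar> * norm h \<le> 1 * norm h" using that by (intro mult_right_mono) auto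
        then show ?thesis using h by (simp add: dist_norm)
      qed
      show "(f has_derivative ?D y) (at y within ball x d)" for y
        by (rule has_derivative_at_withinI[OF has_derivative_partial[OF df]])
      show "onorm (?D y - ?D x) \<le> e" if "y \<in> ball x d" for y
      proof (unfold fun_diff_def, rule onorm_le)
        fix h :: "real^2"
        have "norm (?D y h - ?D x h) = norm (\<Sum>i\<in>UNIV. (h $ i) *\<^sub>R (partial_deriv i f y - partial_deriv i f x))"
          by (simp add: sum_subtractf[symmetric] scaleR_diff_right)
        also have "\<dots> \<le> (\<Sum>i\<in>(UNIV :: 2 set). norm h * (e / 2))"
        proof (rule sum_norm_le)
          fix i
          have "norm (partial_deriv i f y - partial_deriv i f x) \<le> e / 2"
            using d(2)[of y x i] that by (simp add: dist_norm norm_minus_commute)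
          then show "norm ((h $ i) *\<^sub>R (partial_deriv i f y - partial_deriv i f x)) \<le> norm h * (e / 2)"
            using component_le_norm_cart[of h i] assms(3) unfolding norm_scaleR
            by (intro mult_mono) auto
        qed
        finally show "norm (?D y h - ?D x h) \<le> e * norm h" by (simp add: mult.commute)
      qed
    qed (use d in auto)
    then show ?thesis by (simp add: mult.commute)
  qed
  with d(1) show ?thesis by (rule that)
qed

lemma C1_lipschitz:
  fixes f :: "real^2 \<Rightarrow> 'b::real_normed_vector"
  assumes "Ck_on (Suc 0) UNIV f" "\<And>x. norm x > r \<Longrightarrow> f x = 0"
  obtains B where "B > 0" "\<And>x y. norm (f x - f y) \<le> B * norm (x - y)"
proof -
  have df: "f differentiable (at x)" for x using assms(1) by (simp add: differentiable_on_def)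
  have c: "continuous_on UNIV (partial_deriv i f)" for i using assms(1) by simp
  have z: "partial_deriv i f x = 0" if "norm x > r" for i x
    by (rule partial_deriv_zero_outside[of "cball 0 r"]) (use that assms in auto)
  have "\<exists>B>0. \<forall>x. norm (partial_deriv i f x) \<le> B" for i
    by (rule continuous_support_bounded[OF c[of i] z]) auto
  then obtain B where B: "\<And>i. B i > 0" "\<And>i x. norm (partial_deriv i f x) \<le> B i" by metis
  let ?D = "\<lambda>x h. \<Sum>i\<in>UNIV. (h $ i) *\<^sub>R partial_deriv i f x"
  have "norm (f x - f y) \<le> (\<Sum>i\<in>UNIV. B i) * norm (x - y)" for x y
  proof (rule differentiable_bound[where S = UNIV and f' = ?D])
    show "(f has_derivative ?D x) (at x within UNIV)" for x
      by (rule has_derivative_partial[OF df])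
    show "onorm (?D x) \<le> (\<Sum>i\<in>UNIV. B i)" for x
    proof (rule onorm_le)
      fix h :: "real^2"
      have "norm (?D x h) \<le> (\<Sum>i\<in>UNIV. B i * norm h)"
      proof (rule sum_norm_le)
        fix i
        show "norm ((h $ i) *\<^sub>R partial_deriv i f x) \<le> B i * norm h"
          using component_le_norm_cart[of h i] B(2)[of i x]
          by (auto intro!: mult_mono simp: mult.commute[of "B i"])
      qed
      then show "norm (?D x h) \<le> (\<Sum>i\<in>UNIV. B i) * norm h" by (simp add: sum_distrib_right)
    qed
  qed auto
  moreover have "(\<Sum>i\<in>UNIV. B i) > 0" using B(1) by (intro sum_pos) auto
  ultimately show ?thesis by (rule that[rotated])
qed

text \<open>By translation invariance the difference quotients have integral zero.\<close>

lemma integral_partial_deriv_zero: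
  fixes f :: "real^2 \<Rightarrow> 'b::euclidean_space"
  assumes C1: "Ck_on (Suc 0) UNIV f" and supp: "\<And>x. norm x > r \<Longrightarrow> f x = 0"
  shows "(LINT x|lebesgue. partial_deriv i f x) = 0"
proof -
  have df: "f differentiable (at x)" for x using C1 by (simp add: differentiable_on_def)
  have cf: "continuous_on UNIV f" using Ck_on_Suc_imp[OF C1] by simp
  then have fm [measurable]: "f \<in> borel_measurable borel" by (rule borel_measurable_continuous_onI)
  obtain B where B: "B > 0" "\<And>x y. norm (f x - f y) \<le> B * norm (x - y)"
    using C1_lipschitz[OF C1 supp] by blast
  define t where "t m = 1 / (real m + 1)" for m
  have t: "t m > 0" "t m \<le> 1" for m by (auto simp: t_def)
  define s where "s m x = (f (x + t m *\<^sub>R axis i 1) - f x) /\<^sub>R t m" for m x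
  have [measurable]: "s m \<in> borel_measurable borel" for m unfolding s_def by measurable
  have int_s: "(LINT x|lebesgue. s m x) = 0" for m
  proof -
    have i1: "integrable lebesgue f" by (rule continuous_support_integrable[OF cf supp])
    have i2: "integrable lebesgue (\<lambda>x. f (x + t m *\<^sub>R axis i 1))"
    proof (rule continuous_support_integrable[where r = "r + 1"])
      show "continuous_on UNIV (\<lambda>x. f (x + t m *\<^sub>R axis i 1))"
        by (rule continuous_on_compose2[OF cf]) (auto intro!: continuous_intros)
      show "f (x + t m *\<^sub>R axis i 1) = 0" if "norm x > r + 1" for x
      proof (rule supp)
        have "norm x \<le> norm (x + t m *\<^sub>R axis i 1) + norm (t m *\<^sub>R axis i (1::real))"
          by (metis add_diff_cancel_right' norm_triangle_ineq4)
        then show "r < norm (x + t m *\<^sub>R axis i 1)" using that t[of m] by (simp add: norm_axis_1)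
      qed
    qed
    show ?thesis unfolding s_def using i1 i2 integral_lebesgue_translate[OF fm]
      by (simp add: Bochner_Integration.integral_diff)
  qed
  have lim: "(\<lambda>m. s m x) \<longlonglongrightarrow> partial_deriv i f x" for x
  proof (rule LIMSEQ_I)
    fix e :: real assume "e > 0"
    obtain d where d: "d > 0" "\<And>x h. norm h < d \<Longrightarrow>
        norm (f (x + h) - f x - (\<Sum>i\<in>UNIV. (h $ i) *\<^sub>R partial_deriv i f x)) \<le> (e/2) * norm h"
      by (rule C1_linearization[OF C1 supp, where e = "e/2"]) (use \<open>e > 0\<close> in auto)
    have "t \<longlonglongrightarrow> 0"
      unfolding t_def using LIMSEQ_inverse_real_of_nat by (simp add: inverse_eq_divide add.commute)
    then obtain N where N: "\<And>m. m \<ge> N \<Longrightarrow> t m < d"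
      using d(1) t by (fastforce dest!: LIMSEQ_D)
    have "norm (s m x - partial_deriv i f x) < e" if "m \<ge> N" for m
    proof -
      let ?h = "t m *\<^sub>R axis i 1 :: real^2"
      have "(\<Sum>j\<in>UNIV. (?h $ j) *\<^sub>R partial_deriv j f x) = (\<Sum>j\<in>UNIV. if j = i then t m *\<^sub>R partial_deriv i f x else 0)"
        by (intro sum.cong) (auto simp: axis_def)
      then have 1: "(\<Sum>j\<in>UNIV. (?h $ j) *\<^sub>R partial_deriv j f x) = t m *\<^sub>R partial_deriv i f x" by simp
      have "norm (f (x + ?h) - f x - t m *\<^sub>R partial_deriv i f x) \<le> (e/2) * t m"
        using d(2)[of ?h x] N[OF that] t[of m] unfolding 1 by (simp add: norm_axis_1)
      moreover have "t m *\<^sub>R (s m x - partial_deriv i f x) = f (x + ?h) - f x - t m *\<^sub>R partial_deriv i f x"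
        using t[of m] by (simp add: s_def scaleR_diff_right)
      ultimately have "t m * norm (s m x - partial_deriv i f x) \<le> t m * (e/2)"
        using t[of m] by (metis abs_of_pos mult.commute norm_scaleR)
      then have "norm (s m x - partial_deriv i f x) \<le> e/2" using t[of m] by simp
      then show ?thesis using \<open>e > 0\<close> by simp
    qed
    then show "\<exists>N. \<forall>m\<ge>N. norm (s m x - partial_deriv i f x) < e" by blast
  qed
  \<comment> \<open>The Lipschitz bound dominates the difference quotients. The increments are at
    most 1, so all quotients vanish outside radius \<open>r + 1\<close>.\<close>
  have "(\<lambda>m. LINT x|lebesgue. s m x) \<longlonglongrightarrow> (LINT x|lebesgue. partial_deriv i f x)"
  proof (rule integral_dominated_convergence[where w = "\<lambda>x. B * indicator (cball 0 (r + 1)) x"])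
    show "partial_deriv i f \<in> borel_measurable lebesgue"
      using C1 by (intro continuous_borel_lebesgue) simp
    show "integrable lebesgue (\<lambda>x. B * indicator (cball 0 (r + 1)) (x::real^2))"
      using lmeasurable_cball[of "0::real^2" "r + 1"] by (intro integrable_mult_right) (simp add: lmeasurable_iff_integrable)
    show "AE x in lebesgue. norm (s m x) \<le> B * indicator (cball 0 (r + 1)) x" for m
    proof (rule AE_I2)
      fix x
      show "norm (s m x) \<le> B * indicator (cball 0 (r + 1)) x"
      proof (cases "norm x \<le> r + 1")
        case True
        have "norm (f (x + t m *\<^sub>R axis i 1) - f x) \<le> B * t m"
          using B(2)[of "x + t m *\<^sub>R axis i 1" x] t[of m] by (simp add: norm_axis_1)
        then show ?thesis using True t[of m] by (simp add: s_def divide_simps)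
      next
        case False
        have "norm x \<le> norm (x + t m *\<^sub>R axis i 1) + norm (t m *\<^sub>R axis i (1::real))"
          by (metis add_diff_cancel_right' norm_triangle_ineq4)
        then have "norm (x + t m *\<^sub>R axis i 1) > r" using False t[of m] by (simp add: norm_axis_1)
        then show ?thesis using supp False B(1) by (simp add: s_def)
      qed
    qed
  qed (use lim in auto)
  then show ?thesis using int_s LIMSEQ_unique[of "\<lambda>m. 0"] by auto
qed

section \<open>The mollifier\<close>

text \<open>The support radius is \<open>1 / (real m + 1)\<close>, hence at most 1 for every
  \<open>m\<close>, including 0. This is the origin of the margin 1 between radii in the statements
  about mollified functions.\<close>

definition mollifier :: "nat \<Rightarrow> real^2 \<Rightarrow> real" where
  "mollifier m x = bump_profile 0 (1 - (real m + 1)\<^sup>2 * (x \<bullet> x)) /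
     (LINT x::real^2|lebesgue. bump_profile 0 (1 - (real m + 1)\<^sup>2 * (x \<bullet> x)))"

lemma bump_support:
  assumes "norm x > 1 / (real m + 1)"
  shows "bump_profile j (1 - (real m + 1)\<^sup>2 * (x \<bullet> x)) = 0"
proof -
  have "1 < (real m + 1) * norm x" using assms by (simp add: field_simps)
  then have "1 < ((real m + 1) * norm x)\<^sup>2" by (simp add: one_less_power)
  then show ?thesis by (simp add: bump_profile_def power_mult_distrib power2_norm_eq_inner)
qed

text \<open>A nonnegative continuous function with integral 0 vanishes almost everywhere, but the
  set where the bump is nonzero is open and contains 0, hence is not negligible.\<close>

lemma bump_integral_pos: "(LINT x::real^2|lebesgue. bump_profile 0 (1 - (real m + 1)\<^sup>2 * (x \<bullet> x))) > 0"
  (is "?I > 0")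
proof -
  let ?f = "\<lambda>x::real^2. bump_profile 0 (1 - (real m + 1)\<^sup>2 * (x \<bullet> x))"
  have nn: "?f x \<ge> 0" for x by (simp add: bump_profile_def)
  have c: "continuous_on UNIV ?f"
    using bump_radial_smooth[of 0 0] by simp
  have i: "integrable lebesgue ?f"
    by (rule continuous_support_integrable[OF c, of "1 / (real m + 1)"]) (rule bump_support)
  have "?I \<noteq> 0"
  proof
    assume "?I = 0"
    then have "AE x in lebesgue. ?f x = 0"
      using integral_nonneg_eq_0_iff_AE[OF i] nn by auto
    moreover have op: "open {x. ?f x \<noteq> 0}" using c by (intro open_Collect_neq) auto
    moreover have "{x. ?f x \<noteq> 0} \<in> sets lebesgue" using borel_open[OF op] by simp
    ultimately have "negligible {x. ?f x \<noteq> 0}"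
      by (simp add: AE_iff_null negligible_iff_null_sets)
    note op this
    moreover have "0 \<in> {x. ?f x \<noteq> 0}" by (simp add: bump_profile_def)
    ultimately show False using open_not_negligible by blast
  qed
  moreover have "?I \<ge> 0" using nn by (intro integral_nonneg_AE) auto
  ultimately show ?thesis by simp
qed

lemma mollifier_nonneg: "mollifier m x \<ge> 0"
  using bump_integral_pos[of m] by (simp add: mollifier_def bump_profile_def)

lemma mollifier_support: "norm x > 1 / (real m + 1) \<Longrightarrow> mollifier m x = 0"
  unfolding mollifier_def by (simp add: bump_support)

lemma mollifier_support1: "norm x > 1 \<Longrightarrow> mollifier m x = 0"
proof (rule mollifier_support)
  assume "norm x > 1"
  moreover have "1 / (real m + 1) \<le> 1" by simp
  ultimately show "norm x > 1 / (real m + 1)" by linarith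
qed

lemma mollifier_smooth: "smooth (mollifier m)"
  unfolding smooth_def mollifier_def divide_inverse
  by (intro allI Ck_on_mult bump_radial_smooth Ck_on_const)

lemma mollifier_integral: "(LINT x|lebesgue. mollifier m x) = 1"
  using bump_integral_pos[of m] unfolding mollifier_def by simp

lemma mollifier_symmetric:
  "partial_deriv i (partial_deriv j (mollifier m)) = partial_deriv j (partial_deriv i (mollifier m))"
proof -
  let ?f = "\<lambda>x::real^2. bump_profile 0 (1 - (real m + 1)\<^sup>2 * (x \<bullet> x))"
  define c where "c = (LINT x|lebesgue. ?f x)"
  have sm: "smooth ?f" unfolding smooth_def by (intro allI bump_radial_smooth)
  have L: "bounded_linear (\<lambda>y::real. y / c)" by (rule bounded_linear_divide)
  have 1: "partial_deriv i (partial_deriv j (mollifier m)) = (\<lambda>x. partial_deriv i (partial_deriv j ?f) x / c)" for i j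
  proof -
    have a: "partial_deriv j (mollifier m) = (\<lambda>x. partial_deriv j ?f x / c)"
      unfolding mollifier_def c_def[symmetric]
      by (rule ext, rule partial_deriv_linear[OF L smooth_differentiable[OF sm]])
    show ?thesis unfolding a
      by (rule ext, rule partial_deriv_linear[OF L smooth_differentiable[OF smooth_partial[OF sm]]])
  qed
  show ?thesis unfolding 1 by (simp only: bump_radial_symmetric)
qed

lemma smooth_of_real: "smooth f \<Longrightarrow> smooth (\<lambda>x. complex_of_real (f x))"
  unfolding smooth_def using Ck_on_linear[OF bounded_linear_of_real] by blast

lemma test_function_mollifier: "test_function UNIV (\<lambda>x. complex_of_real (mollifier m x))"
  by (rule test_functionI[where r = 1]) (auto intro: smooth_of_real mollifier_smooth simp: mollifier_support1)

subsection \<open>Locally square integrable functions\<close>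

text \<open>Balls around the origin exhaust the compact sets, and one measurability condition on the
  plane replaces one for each compact set.\<close>

definition locL2 :: "(real^2 \<Rightarrow> complex) \<Rightarrow> bool" where
  "locL2 f \<longleftrightarrow> f \<in> borel_measurable lebesgue \<and>
     (\<forall>r. integrable lebesgue (\<lambda>x. indicator (cball 0 r) x * (norm (f x))\<^sup>2))"

definition ball_int :: "real \<Rightarrow> (real^2 \<Rightarrow> real) \<Rightarrow> real" where
  "ball_int r h = (LINT x|lebesgue. indicator (cball 0 r) x * h x)"

lemma cball_lebesgue [simp, measurable]: "cball a r \<in> sets lebesgue"
  using borel_closed[OF closed_cball] by simp

lemma locL2_measurable: "locL2 f \<Longrightarrow> f \<in> borel_measurable lebesgue"
  by (simp add: locL2_def)

lemma indicator_ball_integrable: "integrable lebesgue (\<lambda>x. indicator (cball 0 r) (x::real^2) * (c::real))"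
  using lmeasurable_cball[of "0::real^2" r] by (intro integrable_mult_left) (simp add: lmeasurable_iff_integrable)

lemma ball_integrable_product:
  assumes "locL2 f" "locL2 g"
  shows "integrable lebesgue (\<lambda>x. indicator (cball 0 r) x * (norm (f x) * norm (g x)))"
proof (rule Bochner_Integration.integrable_bound)
  show "integrable lebesgue (\<lambda>x. indicator (cball 0 r) x * (norm (f x))\<^sup>2 + indicator (cball 0 r) x * (norm (g x))\<^sup>2)"
    using assms by (auto simp: locL2_def)
  have [measurable]: "f \<in> borel_measurable lebesgue" "g \<in> borel_measurable lebesgue"
    using assms by (auto simp: locL2_def)
  show "(\<lambda>x. indicator (cball 0 r) x * (norm (f x) * norm (g x))) \<in> borel_measurable lebesgue"
    by measurable
  show "AE x in lebesgue. norm (indicator (cball 0 r) x * (norm (f x) * norm (g x)))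
      \<le> norm (indicator (cball 0 r) x * (norm (f x))\<^sup>2 + indicator (cball 0 r) x * (norm (g x))\<^sup>2)"
  proof (rule AE_I2)
    fix x
    have "norm (f x) * norm (g x) \<le> (norm (f x))\<^sup>2 + (norm (g x))\<^sup>2"
    proof -
      have "0 \<le> norm (f x) * norm (g x)" by simp
      with sum_squares_bound[of "norm (f x)" "norm (g x)"] show ?thesis by linarith
    qed
    then show "norm (indicator (cball 0 r) x * (norm (f x) * norm (g x)))
      \<le> norm (indicator (cball 0 r) x * (norm (f x))\<^sup>2 + indicator (cball 0 r) x * (norm (g x))\<^sup>2)"
      by (auto simp: indicator_def)
  qed
qed

text \<open>The terms of the energy identities have this shape: two locally square integrable
  factors and a bounded one of bounded support.\<close>

lemma locL2_integrable_product:
  assumes "locL2 f" "locL2 g" and b: "b \<in> borel_measurable lebesgue" "\<And>x. norm (b x) \<le> B"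
    "\<And>x. norm x > r \<Longrightarrow> b x = 0"
  shows "integrable lebesgue (\<lambda>x. f x * g x * b x)"
proof (rule Bochner_Integration.integrable_bound)
  have [measurable]: "f \<in> borel_measurable lebesgue" "g \<in> borel_measurable lebesgue"
    using assms by (auto simp: locL2_def)
  show "(\<lambda>x. f x * g x * b x) \<in> borel_measurable lebesgue" using b(1) by measurable
  show "integrable lebesgue (\<lambda>x. B * (indicator (cball 0 r) x * (norm (f x) * norm (g x))))"
    by (intro integrable_mult_right ball_integrable_product assms)
  have "norm (f x) * norm (g x) * norm (b x) \<le> norm (f x) * norm (g x) * B" for x
    by (rule mult_left_mono) (use b in auto)
  moreover have "0 \<le> B" using norm_ge_zero order_trans b(2) by blast
  ultimately show "AE x in lebesgue. norm (f x * g x * b x) \<le> norm (B * (indicator (cball 0 r) x * (norm (f x) * norm (g x))))"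
    using b(3) by (intro AE_I2) (auto simp: norm_mult indicator_def mult_ac abs_mult)
qed

lemma locL2_mult:
  assumes f: "locL2 f" and b: "b \<in> borel_measurable lebesgue"
    and B: "\<And>r. \<exists>B. AE x in lebesgue. norm x \<le> r \<longrightarrow> norm (b x) \<le> B"
  shows "locL2 (\<lambda>x. b x * f x)"
  unfolding locL2_def
proof (intro conjI allI)
  have [measurable]: "f \<in> borel_measurable lebesgue" using f by (auto simp: locL2_def)
  note b[measurable]
  show "(\<lambda>x. b x * f x) \<in> borel_measurable lebesgue" by measurable
  fix r
  obtain B where B: "AE x in lebesgue. norm x \<le> r \<longrightarrow> norm (b x) \<le> B" using B by blast
  show "integrable lebesgue (\<lambda>x. indicator (cball 0 r) x * (norm (b x * f x))\<^sup>2)"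
  proof (rule Bochner_Integration.integrable_bound)
    show "integrable lebesgue (\<lambda>x. B\<^sup>2 * (indicator (cball 0 r) x * (norm (f x))\<^sup>2))"
      using f by (intro integrable_mult_right) (auto simp: locL2_def)
    show "(\<lambda>x. indicator (cball 0 r) x * (norm (b x * f x))\<^sup>2) \<in> borel_measurable lebesgue" by measurable
    show "AE x in lebesgue. norm (indicator (cball 0 r) x * (norm (b x * f x))\<^sup>2)
        \<le> norm (B\<^sup>2 * (indicator (cball 0 r) x * (norm (f x))\<^sup>2))"
      using B
    proof eventually_elim
      case (elim x)
      then show ?case
        by (auto simp: indicator_def norm_mult power_mult_distrib intro!: mult_right_mono power_mono)
    qed
  qed
qed

lemma locL2_continuous:
  assumes "continuous_on UNIV f" shows "locL2 f"
  unfolding locL2_def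
proof (intro conjI allI)
  show "f \<in> borel_measurable lebesgue" using assms by (rule continuous_borel_lebesgue)
  fix r
  have "integrable lborel (\<lambda>x. indicator (cball 0 r) x *\<^sub>R (norm (f x))\<^sup>2)"
    using assms by (intro borel_integrable_compact) (auto intro!: continuous_intros intro: continuous_on_subset)
  then show "integrable lebesgue (\<lambda>x. indicator (cball 0 r) x * (norm (f x))\<^sup>2)"
    using borel_measurable_continuous_onI[OF assms]
    by (subst integrable_completion) auto
qed

lemma locL2_cmult: "locL2 f \<Longrightarrow> locL2 (\<lambda>x. c * f x)"
  by (rule locL2_mult) (auto intro!: exI[of _ "norm c"])

lemma locL2_cnj: "locL2 f \<Longrightarrow> locL2 (\<lambda>x. cnj (f x))"
  unfolding locL2_def using borel_measurable_continuous_on[of cnj f lebesgue]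
  by (auto intro: continuous_on_cnj continuous_on_id)

lemma locL2_add:
  assumes "locL2 f" "locL2 g" shows "locL2 (\<lambda>x. f x + g x)"
  unfolding locL2_def
proof (intro conjI allI)
  have [measurable]: "f \<in> borel_measurable lebesgue" "g \<in> borel_measurable lebesgue"
    using assms by (auto simp: locL2_def)
  show "(\<lambda>x. f x + g x) \<in> borel_measurable lebesgue" by measurable
  fix r
  show "integrable lebesgue (\<lambda>x. indicator (cball 0 r) x * (norm (f x + g x))\<^sup>2)"
  proof (rule Bochner_Integration.integrable_bound)
    show "integrable lebesgue (\<lambda>x. 2 * (indicator (cball 0 r) x * (norm (f x))\<^sup>2) + 2 * (indicator (cball 0 r) x * (norm (g x))\<^sup>2))"
      using assms by (auto simp: locL2_def)
    show "(\<lambda>x. indicator (cball 0 r) x * (norm (f x + g x))\<^sup>2) \<in> borel_measurable lebesgue" by measurable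
    have "(norm (f x + g x))\<^sup>2 \<le> 2 * (norm (f x))\<^sup>2 + 2 * (norm (g x))\<^sup>2" for x
    proof -
      have "(norm (f x + g x))\<^sup>2 \<le> (norm (f x) + norm (g x))\<^sup>2"
        by (intro power_mono norm_triangle_ineq) auto
      then show ?thesis using sum_squares_bound[of "norm (f x)" "norm (g x)"]
        by (simp add: power2_sum)
    qed
    then show "AE x in lebesgue. norm (indicator (cball 0 r) x * (norm (f x + g x))\<^sup>2)
      \<le> norm (2 * (indicator (cball 0 r) x * (norm (f x))\<^sup>2) + 2 * (indicator (cball 0 r) x * (norm (g x))\<^sup>2))"
      by (intro AE_I2) (auto simp: indicator_def)
  qed
qed

lemma locL2_diff: "locL2 f \<Longrightarrow> locL2 g \<Longrightarrow> locL2 (\<lambda>x. f x - g x)"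
  using locL2_add[of f "\<lambda>x. (- 1) * g x"] locL2_cmult[of g "- 1"] by simp

lemma ball_int_norm2_integrable:
  "locL2 f \<Longrightarrow> integrable lebesgue (\<lambda>x. indicator (cball 0 r) x * (norm (f x))\<^sup>2)"
  by (simp add: locL2_def)

lemma ball_int_nonneg: "(\<And>x. 0 \<le> h x) \<Longrightarrow> 0 \<le> ball_int r h"
  unfolding ball_int_def by (intro integral_nonneg_AE) auto

lemma ball_int_mono_radius:
  assumes "locL2 f" "r \<le> s"
  shows "ball_int r (\<lambda>x. (norm (f x))\<^sup>2) \<le> ball_int s (\<lambda>x. (norm (f x))\<^sup>2)"
  unfolding ball_int_def using assms(2)
  by (intro integral_mono ball_int_norm2_integrable assms) (auto simp: indicator_def)

text \<open>The quadratic \<open>t\<^sup>2 * P - 2 * t * C + Q\<close> is an integral of squares,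
  hence nonnegative. For \<open>P\<close> nonzero its value at \<open>C / P\<close> gives the claim.
  For \<open>P = 0\<close> it is affine, and at \<open>(Q + 1) / C\<close> it would be negative
  unless \<open>C = 0\<close>.\<close>

lemma ball_Cauchy_Schwarz:
  assumes "locL2 f" "locL2 g"
  shows "ball_int r (\<lambda>x. norm (f x) * norm (g x))
    \<le> sqrt (ball_int r (\<lambda>x. (norm (f x))\<^sup>2)) * sqrt (ball_int r (\<lambda>x. (norm (g x))\<^sup>2))"
proof -
  define P where "P = ball_int r (\<lambda>x. (norm (f x))\<^sup>2)"
  define Q where "Q = ball_int r (\<lambda>x. (norm (g x))\<^sup>2)"
  define C where "C = ball_int r (\<lambda>x. norm (f x) * norm (g x))"
  have q: "0 \<le> t\<^sup>2 * P - 2 * t * C + Q" for t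
  proof -
    have "t\<^sup>2 * P - 2 * t * C + Q = (LINT x|lebesgue. t\<^sup>2 * (indicator (cball 0 r) x * (norm (f x))\<^sup>2)
       - 2 * t * (indicator (cball 0 r) x * (norm (f x) * norm (g x))) + indicator (cball 0 r) x * (norm (g x))\<^sup>2)"
      unfolding P_def Q_def C_def ball_int_def
      using assms by (simp add: ball_int_norm2_integrable ball_integrable_product)
    also have "\<dots> = (LINT x|lebesgue. indicator (cball 0 r) x * (t * norm (f x) - norm (g x))\<^sup>2)"
      by (intro Bochner_Integration.integral_cong) (auto simp: power2_eq_square algebra_simps)
    also have "\<dots> \<ge> 0" by (intro integral_nonneg_AE) auto
    finally show ?thesis by simp
  qed
  have nn: "P \<ge> 0" "Q \<ge> 0" "C \<ge> 0" unfolding P_def Q_def C_def by (auto intro!: ball_int_nonneg)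
  have "C\<^sup>2 \<le> P * Q"
  proof (cases "P = 0")
    case True
    have "C = 0"
    proof (rule ccontr)
      assume "C \<noteq> 0"
      then have "2 * ((Q + 1) / C) * C = 2 * (Q + 1)" by simp
      then show False using q[of "(Q + 1) / C"] True nn by simp
    qed
    then show ?thesis using True by simp
  next
    case False
    then show ?thesis using q[of "C / P"] nn
      by (simp add: power2_eq_square field_simps)
  qed
  then have "C \<le> sqrt (P * Q)" by (simp add: real_le_rsqrt)
  then show ?thesis by (simp add: real_sqrt_mult P_def Q_def C_def)
qed

section \<open>Convergence in L2 on balls\<close>

definition L2conv :: "(nat \<Rightarrow> real^2 \<Rightarrow> complex) \<Rightarrow> (real^2 \<Rightarrow> complex) \<Rightarrow> bool" where
  "L2conv F f \<longleftrightarrow> (\<forall>m. locL2 (F m)) \<and> locL2 f \<and>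
     (\<forall>r. (\<lambda>m. ball_int r (\<lambda>x. (norm (F m x - f x))\<^sup>2)) \<longlonglongrightarrow> 0)"

text \<open>With p = F - f and q = G - g, the difference F G - f g equals p q + p g + f q. Each
  summand contains a factor that tends to 0, so Cauchy-Schwarz on the ball carrying \<open>b\<close>
  suffices.\<close>

lemma L2conv_integral_product:
  assumes F: "L2conv F f" and G: "L2conv G g"
    and b: "b \<in> borel_measurable lebesgue" "\<And>x. norm (b x) \<le> B" "\<And>x. norm x > r \<Longrightarrow> b x = 0"
  shows "(\<lambda>m. LINT x|lebesgue. F m x * G m x * b x) \<longlonglongrightarrow> (LINT x|lebesgue. f x * g x * b x)"
proof (rule Lim_null[THEN iffD2], rule tendsto_0_le[where K = 1])
  have lF: "locL2 (F m)" "locL2 f" "locL2 (G m)" "locL2 g" for m using F G by (auto simp: L2conv_def)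
  define P where "P m = ball_int r (\<lambda>x. (norm (F m x - f x))\<^sup>2)" for m
  define Q where "Q m = ball_int r (\<lambda>x. (norm (G m x - g x))\<^sup>2)" for m
  define f2 where "f2 = ball_int r (\<lambda>x. (norm (f x))\<^sup>2)"
  define g2 where "g2 = ball_int r (\<lambda>x. (norm (g x))\<^sup>2)"
  have P: "P \<longlonglongrightarrow> 0" and Q: "Q \<longlonglongrightarrow> 0" using F G by (auto simp: L2conv_def P_def[abs_def] Q_def[abs_def])
  let ?S = "\<lambda>m. B * (sqrt (P m) * sqrt (Q m) + sqrt (P m) * sqrt g2 + sqrt f2 * sqrt (Q m))"
  show "?S \<longlonglongrightarrow> 0" using P Q by (auto intro!: tendsto_eq_intros)
  show "\<forall>\<^sub>F m in sequentially. norm ((LINT x|lebesgue. F m x * G m x * b x) - (LINT x|lebesgue. f x * g x * b x)) \<le> norm (?S m) * 1"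
  proof (rule always_eventually, rule allI)
    fix m
    let ?p = "\<lambda>x. F m x - f x" and ?q = "\<lambda>x. G m x - g x" and ?I = "\<lambda>x. indicator (cball 0 r) x :: real"
    have l: "locL2 ?p" "locL2 ?q" using lF by (auto intro: locL2_diff)
    have B: "0 \<le> B" using norm_ge_zero order_trans b(2) by blast
    have i: "integrable lebesgue (\<lambda>x. ?I x * (norm (?p x) * norm (?q x)))"
      "integrable lebesgue (\<lambda>x. ?I x * (norm (?p x) * norm (g x)))"
      "integrable lebesgue (\<lambda>x. ?I x * (norm (f x) * norm (?q x)))"
      by (intro ball_integrable_product l lF)+
    have "norm ((LINT x|lebesgue. F m x * G m x * b x) - (LINT x|lebesgue. f x * g x * b x))
       = norm (LINT x|lebesgue. F m x * G m x * b x - f x * g x * b x)"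
      by (subst Bochner_Integration.integral_diff)
         (auto intro!: locL2_integrable_product lF b)
    also have "\<dots> \<le> (LINT x|lebesgue. B * (?I x * (norm (?p x) * norm (?q x)) + ?I x * (norm (?p x) * norm (g x)) + ?I x * (norm (f x) * norm (?q x))))"
    proof (rule order_trans[OF integral_norm_bound integral_mono])
      show "integrable lebesgue (\<lambda>x. norm (F m x * G m x * b x - f x * g x * b x))"
        by (intro integrable_norm Bochner_Integration.integrable_diff
            locL2_integrable_product[where B = B and r = r] lF b)
      show "integrable lebesgue (\<lambda>x. B * (?I x * (norm (?p x) * norm (?q x)) + ?I x * (norm (?p x) * norm (g x)) + ?I x * (norm (f x) * norm (?q x))))"
        by (intro integrable_mult_right Bochner_Integration.integrable_add i)
      show "norm (F m x * G m x * b x - f x * g x * b x) \<le> B * (?I x * (norm (?p x) * norm (?q x)) + ?I x * (norm (?p x) * norm (g x)) + ?I x * (norm (f x) * norm (?q x)))" for x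
      proof (cases "norm x > r")
        case False
        have "F m x * G m x * b x - f x * g x * b x = (?p x * ?q x + ?p x * g x + f x * ?q x) * b x"
          by (simp add: algebra_simps)
        then have "norm (F m x * G m x * b x - f x * g x * b x) = norm (?p x * ?q x + ?p x * g x + f x * ?q x) * norm (b x)"
          by (simp only: norm_mult)
        also have "\<dots> \<le> (norm (?p x) * norm (?q x) + norm (?p x) * norm (g x) + norm (f x) * norm (?q x)) * B"
          using b(2)[of x]
          by (intro mult_mono order_trans[OF norm_triangle_ineq] add_mono) (auto simp: norm_mult)
        finally show ?thesis using False by (simp add: mult.commute)
      qed (use b B in auto)
    qed
    also have "\<dots> = B * (ball_int r (\<lambda>x. norm (?p x) * norm (?q x)) + ball_int r (\<lambda>x. norm (?p x) * norm (g x)) + ball_int r (\<lambda>x. norm (f x) * norm (?q x)))"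
      unfolding ball_int_def using i by (simp add: Bochner_Integration.integral_add)
    also have "\<dots> \<le> ?S m"
      unfolding P_def Q_def f2_def g2_def using B
      by (intro mult_left_mono add_mono ball_Cauchy_Schwarz l lF)
    finally show "norm ((LINT x|lebesgue. F m x * G m x * b x) - (LINT x|lebesgue. f x * g x * b x)) \<le> norm (?S m) * 1"
      by simp
  qed
qed

lemma ball_int_triangle:
  assumes "locL2 f" "locL2 g" "locL2 h"
  shows "ball_int r (\<lambda>x. (norm (f x - h x))\<^sup>2) \<le>
    2 * ball_int r (\<lambda>x. (norm (f x - g x))\<^sup>2) + 2 * ball_int r (\<lambda>x. (norm (g x - h x))\<^sup>2)"
proof -
  have i: "integrable lebesgue (\<lambda>x. indicator (cball 0 r) x * (norm (f x - h x))\<^sup>2)"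
    "integrable lebesgue (\<lambda>x. indicator (cball 0 r) x * (norm (f x - g x))\<^sup>2)"
    "integrable lebesgue (\<lambda>x. indicator (cball 0 r) x * (norm (g x - h x))\<^sup>2)"
    by (intro ball_int_norm2_integrable locL2_diff assms)+
  have "ball_int r (\<lambda>x. (norm (f x - h x))\<^sup>2) \<le>
    (LINT x|lebesgue. 2 * (indicator (cball 0 r) x * (norm (f x - g x))\<^sup>2) + 2 * (indicator (cball 0 r) x * (norm (g x - h x))\<^sup>2))"
    unfolding ball_int_def
  proof (rule integral_mono)
    fix x
    have "(norm (f x - h x))\<^sup>2 \<le> (norm (f x - g x) + norm (g x - h x))\<^sup>2"
      by (intro power_mono norm_diff_triangle_ineq[of "f x" "g x" "g x" "h x", simplified]) auto
    then have "(norm (f x - h x))\<^sup>2 \<le> 2 * (norm (f x - g x))\<^sup>2 + 2 * (norm (g x - h x))\<^sup>2"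
      using sum_squares_bound[of "norm (f x - g x)" "norm (g x - h x)"] by (simp add: power2_sum)
    then show "indicator (cball 0 r) x * (norm (f x - h x))\<^sup>2 \<le>
      2 * (indicator (cball 0 r) x * (norm (f x - g x))\<^sup>2) + 2 * (indicator (cball 0 r) x * (norm (g x - h x))\<^sup>2)"
      by (auto simp: indicator_def)
  qed (use i in auto)
  also have "\<dots> = 2 * ball_int r (\<lambda>x. (norm (f x - g x))\<^sup>2) + 2 * ball_int r (\<lambda>x. (norm (g x - h x))\<^sup>2)"
    unfolding ball_int_def using i by simp
  finally show ?thesis .
qed

section \<open>Approximation by continuous functions\<close>

text \<open>The radial retraction onto the disc of radius \<open>N\<close>. As a scaling by a
  quotient with \<open>max\<close> in the denominator it is visibly continuous for positive
  \<open>N\<close>.\<close>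

definition truncate :: "nat \<Rightarrow> complex \<Rightarrow> complex" where
  "truncate N z = (real N / max (real N) (norm z)) *\<^sub>R z"

lemma truncate_bound: "norm (truncate N z) \<le> real N"
proof (cases "N = 0")
  case False
  then have "max (real N) (norm z) > 0" by (simp add: less_max_iff_disj)
  then show ?thesis by (auto simp: truncate_def divide_simps intro!: mult_left_mono)
qed (simp add: truncate_def)

lemma truncate_id: "norm z \<le> real N \<Longrightarrow> truncate N z = z"
  by (cases "N = 0") (auto simp: truncate_def max_def)

lemma truncate_diff: "norm (truncate N z - z) \<le> norm z"
proof -
  have "truncate N z - z = (real N / max (real N) (norm z) - 1) *\<^sub>R z"
    by (simp add: truncate_def scaleR_left_diff_distrib)
  moreover have "0 \<le> real N / max (real N) (norm z)" "real N / max (real N) (norm z) \<le> 1"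
    by (auto simp: divide_simps less_max_iff_disj)
  ultimately show ?thesis by (auto intro!: mult_left_le_one_le)
qed

lemma truncate_continuous: "N > 0 \<Longrightarrow> continuous_on S (truncate N)"
  unfolding truncate_def
  by (intro continuous_intros ballI) (auto simp: max_def split: if_splits)

text \<open>Truncation makes \<open>f\<close> bounded at a small cost in L2. A bounded measurable
  function is the almost everywhere limit of continuous functions, and truncating these as well
  provides a constant as dominating function on the ball. The two errors below \<open>e / 4\<close>
  are doubled by the triangle inequality for squares.\<close>

lemma locL2_approx_continuous:
  assumes f: "locL2 f" and "e > 0"
  obtains g where "continuous_on UNIV g" "ball_int r (\<lambda>x. (norm (f x - g x))\<^sup>2) < e"
proof -
  have fm [measurable]: "f \<in> borel_measurable lebesgue" using f by (rule locL2_measurable)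
  let ?I = "\<lambda>x. indicator (cball 0 r) x :: real"
  have "(\<lambda>N. LINT x|lebesgue. ?I x * (norm (f x - truncate N (f x)))\<^sup>2) \<longlonglongrightarrow> (LINT x::real^2|lebesgue. 0)"
  proof (rule integral_dominated_convergence[where w = "\<lambda>x. ?I x * (norm (f x))\<^sup>2"])
    show "(\<lambda>x. ?I x * (norm (f x - truncate N (f x)))\<^sup>2) \<in> borel_measurable lebesgue" for N
      unfolding truncate_def by measurable
    show "AE x in lebesgue. (\<lambda>N. ?I x * (norm (f x - truncate N (f x)))\<^sup>2) \<longlonglongrightarrow> 0"
    proof (rule AE_I2, rule tendsto_eventually)
      fix x
      obtain N0 where "norm (f x) \<le> real N0" using real_arch_simple by blast
      then have "\<forall>N\<ge>N0. truncate N (f x) = f x" by (auto intro!: truncate_id)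
      then show "\<forall>\<^sub>F N in sequentially. ?I x * (norm (f x - truncate N (f x)))\<^sup>2 = 0"
        unfolding eventually_sequentially by (intro exI[of _ N0]) auto
    qed
    show "AE x in lebesgue. norm (?I x * (norm (f x - truncate N (f x)))\<^sup>2) \<le> ?I x * (norm (f x))\<^sup>2" for N
      using truncate_diff by (intro AE_I2) (auto simp: indicator_def norm_minus_commute intro!: power_mono)
  qed (use f in \<open>auto simp: locL2_def\<close>)
  then have "(\<lambda>N. ball_int r (\<lambda>x. (norm (f x - truncate N (f x)))\<^sup>2)) \<longlonglongrightarrow> 0" by (simp add: ball_int_def)
  then have "\<forall>\<^sub>F N in sequentially. ball_int r (\<lambda>x. (norm (f x - truncate N (f x)))\<^sup>2) < e / 4"
    using \<open>e > 0\<close> by (intro order_tendstoD) auto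
  then obtain N0 where "\<forall>N\<ge>N0. ball_int r (\<lambda>x. (norm (f x - truncate N (f x)))\<^sup>2) < e / 4"
    unfolding eventually_sequentially by blast
  then obtain N where N: "N > 0" "ball_int r (\<lambda>x. (norm (f x - truncate N (f x)))\<^sup>2) < e / 4"
    using that[of "Suc N0"] by auto
  \<comment> \<open>\<open>measurable_on\<close> provides continuous functions that converge
    pointwise off a negligible set; this is where the continuous approximants come from.\<close>
  have "f measurable_on UNIV" using lebesgue_measurable_imp_measurable_on[OF fm] by simp
  then obtain Z g where g: "negligible Z" "\<And>n. continuous_on UNIV (g n)"
    "\<And>x. x \<notin> Z \<Longrightarrow> (\<lambda>n. g n x) \<longlonglongrightarrow> f x"
    unfolding measurable_on_def by auto
  have cont: "continuous_on UNIV (\<lambda>x. truncate N (g n x))" for n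
    by (rule continuous_on_compose2[OF truncate_continuous[OF N(1)] g(2)]) auto
  have gm [measurable]: "(\<lambda>x. truncate N (g n x)) \<in> borel_measurable lebesgue" for n
    by (rule continuous_borel_lebesgue[OF cont])
  have tm [measurable]: "(\<lambda>x. truncate N (f x)) \<in> borel_measurable lebesgue"
    unfolding truncate_def by measurable
  have "(\<lambda>n. LINT x|lebesgue. ?I x * (norm (truncate N (f x) - truncate N (g n x)))\<^sup>2) \<longlonglongrightarrow> (LINT x::real^2|lebesgue. 0)"
  proof (rule integral_dominated_convergence[where w = "\<lambda>x. ?I x * (2 * real N)\<^sup>2"])
    have "AE x in lebesgue. x \<notin> Z"
      using g(1) by (intro AE_not_in) (simp add: negligible_iff_null_sets)
    then show "AE x in lebesgue. (\<lambda>n. ?I x * (norm (truncate N (f x) - truncate N (g n x)))\<^sup>2) \<longlonglongrightarrow> 0"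
    proof eventually_elim
      case (elim x)
      have "isCont (truncate N) (f x)"
        using truncate_continuous[OF N(1), of UNIV] by (simp add: continuous_on_eq_continuous_at)
      then have "(\<lambda>n. truncate N (g n x)) \<longlonglongrightarrow> truncate N (f x)"
        using g(3)[OF elim] by (rule isCont_tendsto_compose)
      then show ?case by (auto intro!: tendsto_eq_intros)
    qed
    have "(norm (truncate N (f x) - truncate N (g n x)))\<^sup>2 \<le> (2 * real N)\<^sup>2" for x n
    proof (rule power_mono)
      show "norm (truncate N (f x) - truncate N (g n x)) \<le> 2 * real N"
      using norm_triangle_ineq4[of "truncate N (f x)" "truncate N (g n x)"]
        truncate_bound[of N "f x"] truncate_bound[of N "g n x"] by linarith
    qed simp
    then show "AE x in lebesgue. norm (?I x * (norm (truncate N (f x) - truncate N (g n x)))\<^sup>2) \<le> ?I x * (2 * real N)\<^sup>2" for n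
      by (intro AE_I2) (auto simp: indicator_def simp del: power_mult_distrib)
  qed (use indicator_ball_integrable in auto)
  then have "(\<lambda>n. ball_int r (\<lambda>x. (norm (truncate N (f x) - truncate N (g n x)))\<^sup>2)) \<longlonglongrightarrow> 0" by (simp add: ball_int_def)
  then have "\<forall>\<^sub>F n in sequentially. ball_int r (\<lambda>x. (norm (truncate N (f x) - truncate N (g n x)))\<^sup>2) < e / 4"
    using \<open>e > 0\<close> by (intro order_tendstoD) auto
  then obtain n where n: "ball_int r (\<lambda>x. (norm (truncate N (f x) - truncate N (g n x)))\<^sup>2) < e / 4"
    unfolding eventually_sequentially by blast
  have lt: "locL2 (\<lambda>x. truncate N (f x))"
    unfolding truncate_def scaleR_conv_of_real
  proof (rule locL2_mult[OF f])
    show "(\<lambda>x. complex_of_real (real N / max (real N) (norm (f x)))) \<in> borel_measurable lebesgue" by measurable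
    show "\<exists>B. AE x in lebesgue. norm x \<le> r \<longrightarrow> norm (complex_of_real (real N / max (real N) (norm (f x)))) \<le> B" for r
      by (intro exI[of _ 1] AE_I2 impI, subst norm_of_real) (auto simp: divide_simps less_max_iff_disj)
  qed
  have "ball_int r (\<lambda>x. (norm (f x - truncate N (g n x)))\<^sup>2) < e"
    using ball_int_triangle[OF f lt locL2_continuous[OF cont[of n]], of r] N(2) n by linarith
  with cont show ?thesis by (rule that)
qed

subsection \<open>Convolution and mollification\<close>

definition conv :: "(real^2 \<Rightarrow> complex) \<Rightarrow> (real^2 \<Rightarrow> complex) \<Rightarrow> real^2 \<Rightarrow> complex" where
  "conv f \<eta> x = (LINT y|lebesgue. f y * \<eta> (x - y))"

lemma continuous_reflect:
  assumes "continuous_on UNIV (f :: real^2 \<Rightarrow> 'b::topological_space)" shows "continuous_on S (\<lambda>y. f (x - y))"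
  by (rule continuous_on_compose2[OF assms]) (auto intro!: continuous_intros)

lemma reflect_support:
  fixes x y :: "real^2"
  assumes "norm y > norm x + r" shows "norm (x - y) > r"
  using assms norm_triangle_ineq2[of y x] by (simp add: norm_minus_commute)

lemma locL2_times_continuous_integrable:
  assumes "locL2 f" "continuous_on UNIV b" "\<And>x. norm x > r \<Longrightarrow> b x = 0"
  shows "integrable lebesgue (\<lambda>x. f x * b x)"
proof -
  obtain B where "\<And>x. norm (b x) \<le> B" by (rule continuous_support_bounded[OF assms(2,3)]) auto
  then have "integrable lebesgue (\<lambda>x. f x * 1 * b x)"
    using locL2_continuous[of "\<lambda>_. 1"] assms(3)
    by (intro locL2_integrable_product[where B = B and r = r] assms continuous_borel_lebesgue) auto
  then show ?thesis by simp
qed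

lemma conv_integrable:
  assumes "locL2 f" "continuous_on UNIV \<eta>" "\<And>x. norm x > r \<Longrightarrow> \<eta> x = 0"
  shows "integrable lebesgue (\<lambda>y. f y * \<eta> (x - y))"
  by (rule locL2_times_continuous_integrable[where r = "norm x + r"])
     (use assms reflect_support in \<open>auto intro: continuous_reflect\<close>)

lemma locL2_norm_integrable:
  "locL2 f \<Longrightarrow> integrable lebesgue (\<lambda>x. indicator (cball 0 r) x * norm (f x))"
  using ball_integrable_product[of f "\<lambda>_. 1" r] locL2_continuous[of "\<lambda>_. 1"] by simp

lemma integral_times_bound:
  assumes "locL2 f" "\<And>x. norm (b x) \<le> c" "\<And>x. norm x > r \<Longrightarrow> b x = 0"
  shows "norm (LINT x|lebesgue. f x * b x) \<le> c * ball_int r (\<lambda>x. norm (f x))"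
proof -
  have "0 \<le> c" using assms(2) norm_ge_zero order_trans by blast
  show ?thesis
  proof (cases "integrable lebesgue (\<lambda>x. f x * b x)")
    case True
    have "norm (LINT x|lebesgue. f x * b x) \<le> (LINT x|lebesgue. c * (indicator (cball 0 r) x * norm (f x)))"
    proof (rule order_trans[OF integral_norm_bound integral_mono])
      show "integrable lebesgue (\<lambda>x. norm (f x * b x))" using True by (rule integrable_norm)
      show "integrable lebesgue (\<lambda>x. c * (indicator (cball 0 r) x * norm (f x)))"
        by (intro integrable_mult_right locL2_norm_integrable assms)
      have "norm (f x * b x) \<le> norm (f x) * c" for x
        unfolding norm_mult by (intro mult_left_mono assms) auto
      then show "norm (f x * b x) \<le> c * (indicator (cball 0 r) x * norm (f x))" for x
        using assms(3)[of x] \<open>0 \<le> c\<close> by (cases "norm x \<le> r") (auto simp: mult.commute)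
    qed
    then show ?thesis by (simp add: ball_int_def)
  next
    \<comment> \<open>The integral of a function that is not integrable is 0 by convention, so the
      bound holds in this case as well.\<close>
    case False
    then show ?thesis using \<open>0 \<le> c\<close> by (simp add: not_integrable_integral_eq ball_int_nonneg)
  qed
qed

lemma conv_continuous:
  assumes "locL2 f" "continuous_on UNIV \<eta>" "\<And>x. norm x > r \<Longrightarrow> \<eta> x = 0"
  shows "continuous_on UNIV (conv f \<eta>)"
  unfolding continuous_on_iff
proof (intro ballI allI impI)
  fix x :: "real^2" and e :: real assume "e > 0"
  \<comment> \<open>For every point within distance 1 of \<open>x\<close>, the reflected kernel is
    supported in the ball of radius \<open>norm x + 1 + r\<close>. The quotient
    \<open>e / (K + 1)\<close> avoids a division by 0 when \<open>f\<close> vanishes there.\<close>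
  define K where "K = ball_int (norm x + 1 + r) (\<lambda>x. norm (f x))"
  have K: "K \<ge> 0" unfolding K_def by (intro ball_int_nonneg) auto
  obtain d where d: "d > 0" "\<And>x y. norm (x - y) < d \<Longrightarrow> norm (\<eta> x - \<eta> y) < e / (K + 1)"
    by (rule continuous_support_uniform[OF assms(2,3), where e = "e / (K + 1)"]) (use \<open>e > 0\<close> K in auto)
  have "dist (conv f \<eta> x') (conv f \<eta> x) < e" if "dist x' x < min d 1" for x'
  proof -
    have n: "norm x' < norm x + 1" using that norm_triangle_sub[of x' x] by (simp add: dist_norm)
    have "conv f \<eta> x' - conv f \<eta> x = (LINT y|lebesgue. f y * (\<eta> (x' - y) - \<eta> (x - y)))"
      unfolding conv_def right_diff_distrib
      by (rule Bochner_Integration.integral_diff[symmetric]) (intro conv_integrable assms | simp add: assms)+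
    also have "norm \<dots> \<le> e / (K + 1) * K"
      unfolding K_def
    proof (rule integral_times_bound[OF assms(1)])
      show "norm (\<eta> (x' - y) - \<eta> (x - y)) \<le> e / (ball_int (norm x + 1 + r) (\<lambda>x. norm (f x)) + 1)" for y
        using d(2)[of "x' - y" "x - y"] that unfolding K_def by (simp add: dist_norm)
      show "\<eta> (x' - y) - \<eta> (x - y) = 0" if "norm x + 1 + r < norm y" for y
        using that n by (simp add: assms(3) reflect_support)
    qed
    also have "\<dots> < e" using K \<open>e > 0\<close> by (simp add: field_simps)
    finally show ?thesis by (simp add: dist_norm)
  qed
  then show "\<exists>d>0. \<forall>x'\<in>UNIV. dist x' x < d \<longrightarrow> dist (conv f \<eta> x') (conv f \<eta> x) < e"
    using d(1) by (intro exI[of _ "min d 1"]) auto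
qed

text \<open>The linearization of the kernel is uniform in the base point, so its remainder can be
  integrated against \<open>f\<close>; all derivatives fall on the kernel.\<close>

lemma conv_has_derivative:
  assumes f: "locL2 f" and C1: "Ck_on (Suc 0) UNIV \<eta>" and supp: "\<And>x. norm x > r \<Longrightarrow> \<eta> x = 0"
  shows "(conv f \<eta> has_derivative (\<lambda>h. \<Sum>i\<in>UNIV. (h $ i) *\<^sub>R conv f (partial_deriv i \<eta>) x)) (at x)"
  unfolding has_derivative_at_alt
proof (intro conjI allI impI)
  have c: "continuous_on UNIV \<eta>" using Ck_on_Suc_imp[OF C1] by simp
  have pc: "continuous_on UNIV (partial_deriv i \<eta>)" for i using C1 by simp
  have pz: "partial_deriv i \<eta> x = 0" if "norm x > r" for i x
    by (rule partial_deriv_zero_outside[of "cball 0 r"]) (use that supp in auto)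
  show "bounded_linear (\<lambda>h. \<Sum>i\<in>UNIV. (h $ i) *\<^sub>R conv f (partial_deriv i \<eta>) x)"
    by (intro bounded_linear_sum bounded_linear_compose[OF bounded_linear_scaleR_left bounded_linear_vec_nth])
  fix e :: real assume "e > 0"
  define K where "K = ball_int (norm x + 1 + r) (\<lambda>x. norm (f x))"
  have K: "K \<ge> 0" unfolding K_def by (intro ball_int_nonneg) auto
  obtain d where d: "d > 0" "\<And>x h. norm h < d \<Longrightarrow>
      norm (\<eta> (x + h) - \<eta> x - (\<Sum>i\<in>UNIV. (h $ i) *\<^sub>R partial_deriv i \<eta> x)) \<le> (e / (K + 1)) * norm h"
    by (rule C1_linearization[OF C1 supp, where e = "e / (K + 1)"]) (use \<open>e > 0\<close> K in auto)
  have "norm (conv f \<eta> y - conv f \<eta> x - (\<Sum>i\<in>UNIV. ((y - x) $ i) *\<^sub>R conv f (partial_deriv i \<eta>) x)) \<le> e * norm (y - x)"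
    if y: "norm (y - x) < min d 1" for y
  proof -
    have n: "norm y < norm x + 1" using y norm_triangle_sub[of y x] by simp
    let ?r = "\<lambda>z. \<eta> (y - z) - \<eta> (x - z) - (\<Sum>i\<in>UNIV. ((y - x) $ i) *\<^sub>R partial_deriv i \<eta> (x - z))"
    have i: "integrable lebesgue (\<lambda>z. f z * \<eta> (y - z))" "integrable lebesgue (\<lambda>z. f z * \<eta> (x - z))"
      "integrable lebesgue (\<lambda>z. f z * partial_deriv i \<eta> (x - z))" for i
      using conv_integrable[OF f c supp] conv_integrable[OF f pc[of i] pz] by auto
    have eq: "f z * ?r z = f z * \<eta> (y - z) - f z * \<eta> (x - z) - (\<Sum>i\<in>UNIV. ((y - x) $ i) *\<^sub>R (f z * partial_deriv i \<eta> (x - z)))" for z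
      by (simp add: right_diff_distrib sum_distrib_left mult_scaleR_right)
    have "conv f \<eta> y - conv f \<eta> x - (\<Sum>i\<in>UNIV. ((y - x) $ i) *\<^sub>R conv f (partial_deriv i \<eta>) x)
        = (LINT z|lebesgue. f z * ?r z)"
      unfolding eq using i
      by (simp add: conv_def Bochner_Integration.integral_diff Bochner_Integration.integral_sum)
    also have "norm \<dots> \<le> (e / (K + 1)) * norm (y - x) * K"
      unfolding K_def
    proof (rule integral_times_bound[OF f])
      show "norm (?r z) \<le> e / (ball_int (norm x + 1 + r) (\<lambda>x. norm (f x)) + 1) * norm (y - x)" for z
        using d(2)[of "y - x" "x - z"] y unfolding K_def by (simp add: algebra_simps)
      show "?r z = 0" if "norm x + 1 + r < norm z" for z
        using that n pz[of "x - z"] by (simp add: supp reflect_support)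
    qed
    also have "\<dots> = e * norm (y - x) * (K / (K + 1))" by simp
    also have "\<dots> \<le> e * norm (y - x) * 1" using K \<open>e > 0\<close> by (intro mult_left_mono) auto
    finally show ?thesis by simp
  qed
  then show "\<exists>d>0. \<forall>y. norm (y - x) < d \<longrightarrow>
      norm (conv f \<eta> y - conv f \<eta> x - (\<Sum>i\<in>UNIV. ((y - x) $ i) *\<^sub>R conv f (partial_deriv i \<eta>) x)) \<le> e * norm (y - x)"
    using d(1) by (intro exI[of _ "min d 1"]) auto
qed

lemma test_function_smooth: "test_function UNIV \<eta> \<Longrightarrow> smooth \<eta>"
  by (simp add: test_function_def)

lemma test_function_C1: "test_function UNIV \<eta> \<Longrightarrow> Ck_on (Suc 0) UNIV \<eta>"
  using test_function_smooth smooth_def by blast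

lemma conv_partial:
  assumes "locL2 f" "test_function UNIV \<eta>"
  shows "partial_deriv i (conv f \<eta>) = conv f (partial_deriv i \<eta>)"
proof
  fix x
  obtain r where r: "\<And>x. norm x > r \<Longrightarrow> \<eta> x = 0" using test_function_support[OF assms(2)] by blast
  have "partial_deriv i (conv f \<eta>) x = (\<Sum>j\<in>UNIV. (axis i 1 $ j) *\<^sub>R conv f (partial_deriv j \<eta>) x)"
    by (rule partial_deriv_eq, rule conv_has_derivative[OF assms(1) test_function_C1[OF assms(2)] r])
  also have "\<dots> = (\<Sum>j\<in>UNIV. if j = i then conv f (partial_deriv i \<eta>) x else 0)"
    by (intro sum.cong) (auto simp: axis_def)
  finally show "partial_deriv i (conv f \<eta>) x = conv f (partial_deriv i \<eta>) x" by simp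
qed

text \<open>The induction varies the kernel and keeps \<open>f\<close> fixed, because
  differentiation replaces the kernel by its partial derivative, which is again a test
  function.\<close>

lemma conv_smooth:
  assumes "locL2 f" "test_function UNIV \<eta>" shows "smooth (conv f \<eta>)"
proof -
  have "Ck_on m UNIV (conv f \<eta>)" for m
    using assms(2)
  proof (induction m arbitrary: \<eta>)
    case 0
    then show ?case using test_function_support[of \<eta>] conv_continuous[OF assms(1), of \<eta>]
        smooth_continuous[OF test_function_smooth] by auto
  next
    case (Suc m)
    obtain r where r: "\<And>x. norm x > r \<Longrightarrow> \<eta> x = 0" using test_function_support[OF Suc.prems] by blast
    have "conv f \<eta> differentiable (at x)" for x
      using conv_has_derivative[OF assms(1) test_function_C1[OF Suc.prems] r] differentiable_def by blast
    then show ?case using Suc.IH[OF test_function_partial[OF Suc.prems]]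
      by (simp add: conv_partial[OF assms(1) Suc.prems] differentiable_on_def)
  qed
  then show ?thesis by (simp add: smooth_def)
qed

lemma conv_integrable_test:
  assumes "locL2 f" "test_function UNIV \<eta>"
  shows "integrable lebesgue (\<lambda>y. f y * \<eta> (x - y))"
  using test_function_support[OF assms(2)] conv_integrable[OF assms(1)]
    smooth_continuous[OF test_function_smooth[OF assms(2)]] by metis

lemma conv_laplacian:
  assumes "locL2 f" "test_function UNIV \<eta>"
  shows "laplacian (conv f \<eta>) = conv f (laplacian \<eta>)"
proof
  fix x
  have "laplacian (conv f \<eta>) x = (\<Sum>i\<in>UNIV. conv f (partial_deriv i (partial_deriv i \<eta>)) x)"
    by (simp add: laplacian_def conv_partial assms test_function_partial)
  also have "\<dots> = conv f (laplacian \<eta>) x"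
    unfolding conv_def laplacian_def sum_distrib_left
    by (rule Bochner_Integration.integral_sum[symmetric])
       (intro conv_integrable_test assms test_function_partial)
  finally show "laplacian (conv f \<eta>) x = conv f (laplacian \<eta>) x" .
qed

definition weak_lap :: "(real^2 \<Rightarrow> complex) \<Rightarrow> (real^2 \<Rightarrow> complex) \<Rightarrow> bool" where
  "weak_lap u q \<longleftrightarrow> locL2 u \<and> locL2 q \<and> (\<forall>\<phi>. test_function UNIV \<phi> \<longrightarrow>
     (LINT x|lebesgue. u x * laplacian \<phi> x) = (LINT x|lebesgue. q x * \<phi> x))"

text \<open>The reflected and translated kernel is itself a test function in \<open>y\<close>. The
  Laplacian is of even order, so the reflection introduces no sign.\<close>

lemma weak_lap_conv:
  assumes "weak_lap u q" "test_function UNIV \<eta>"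
  shows "laplacian (conv u \<eta>) = conv q \<eta>"
proof
  fix x
  have "laplacian (\<lambda>y. \<eta> (x - y)) y = laplacian \<eta> (x - y)" for y
    by (rule laplacian_reflect[OF test_function_smooth[OF assms(2)]])
  then have "conv u (laplacian \<eta>) x = (LINT y|lebesgue. u y * laplacian (\<lambda>y. \<eta> (x - y)) y)"
    by (simp add: conv_def)
  also have "\<dots> = conv q \<eta> x"
    using assms(1) test_function_reflect[OF assms(2)] unfolding conv_def weak_lap_def by blast
  finally show "laplacian (conv u \<eta>) x = conv q \<eta> x"
    using assms conv_laplacian by (simp add: weak_lap_def)
qed

lemma conv_diff:
  assumes "locL2 f" "locL2 g" "test_function UNIV \<eta>"
  shows "conv (\<lambda>x. f x - g x) \<eta> x = conv f \<eta> x - conv g \<eta> x"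
  unfolding conv_def left_diff_distrib
  by (rule Bochner_Integration.integral_diff) (intro conv_integrable_test assms)+

lemma conv_cmult: "conv (\<lambda>x. c * f x) \<eta> x = c * conv f \<eta> x"
  unfolding conv_def by (simp add: mult.assoc)

lemma conv_cong_AE:
  assumes "AE y in lebesgue. f y * \<eta> (x - y) = g y * \<eta> (x - y)"
    "f \<in> borel_measurable lebesgue" "g \<in> borel_measurable lebesgue" "continuous_on UNIV \<eta>"
  shows "conv f \<eta> x = conv g \<eta> x"
  unfolding conv_def
  by (rule integral_cong_AE[OF _ _ assms(1)])
     (intro borel_measurable_times assms continuous_borel_lebesgue continuous_reflect)+

section \<open>Mollification in L2\<close>

definition mollify :: "nat \<Rightarrow> (real^2 \<Rightarrow> complex) \<Rightarrow> real^2 \<Rightarrow> complex" where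
  "mollify m f = conv f (\<lambda>x. complex_of_real (mollifier m x))"

text \<open>Required for exchanging the order of integration with respect to the completed measure
  in \<open>mollify_ball_bound\<close>.\<close>

lemma sigma_finite_lebesgue: "sigma_finite_measure (lebesgue :: (real^2) measure)"
proof
  have "emeasure lebesgue (cball (0::real^2) (real n)) \<noteq> \<infinity>" for n
    using lmeasurable_cball[of "0::real^2" "real n"] by (simp add: fmeasurable_def)
  moreover have "(\<Union>n. cball (0::real^2) (real n)) = UNIV"
    by (auto simp: real_arch_simple)
  ultimately show "\<exists>A. countable A \<and> A \<subseteq> sets lebesgue \<and> \<Union> A = space lebesgue \<and>
      (\<forall>a\<in>A. emeasure lebesgue (a :: (real^2) set) \<noteq> \<infinity>)"
    by (intro exI[of _ "range (\<lambda>n. cball (0::real^2) (real n))"]) auto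
qed

lemma cnorm_diff_square: "(norm (a - b))\<^sup>2 = (norm a)\<^sup>2 - 2 * Re (a * cnj b) + (norm b)\<^sup>2"
  unfolding cmod_power2 by (simp add: power2_eq_square algebra_simps)

lemma mollifier_borel [measurable]: "mollifier m \<in> borel_measurable borel"
  by (rule borel_measurable_continuous_onI[OF smooth_continuous[OF mollifier_smooth]])

lemma mollifier_integrable: "integrable lebesgue (\<lambda>y. mollifier m (x - y))"
proof (rule continuous_support_integrable[where r = "norm x + 1"])
  show "continuous_on UNIV (\<lambda>y. mollifier m (x - y))"
    by (rule continuous_reflect[OF smooth_continuous[OF mollifier_smooth]])
qed (auto intro: mollifier_support1 reflect_support)

lemma mollifier_reflect_integral: "(LINT y|lebesgue. mollifier m (x - y)) = 1"
  using integral_lebesgue_reflect[of "mollifier m" x] mollifier_integral by simp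

text \<open>This is Jensen's inequality in the form of a nonnegative variance: the kernel is a
  probability density, \<open>c\<close> is the mean of \<open>f\<close>, and the integral of the
  squared distance of \<open>f\<close> to \<open>c\<close> is nonnegative.\<close>

lemma mollify_square_bound:
  assumes f: "locL2 f"
  shows "integrable lebesgue (\<lambda>y. (norm (f y))\<^sup>2 * mollifier m (x - y))"
    and "(norm (mollify m f x))\<^sup>2 \<le> (LINT y|lebesgue. (norm (f y))\<^sup>2 * mollifier m (x - y))"
proof -
  let ?\<eta> = "\<lambda>y. mollifier m (x - y)"
  have [measurable]: "f \<in> borel_measurable lebesgue" using f by (rule locL2_measurable)
  have c\<eta>: "continuous_on UNIV ?\<eta>" by (rule continuous_reflect[OF smooth_continuous[OF mollifier_smooth]])
  have z\<eta>: "?\<eta> y = 0" if "norm y > norm x + 1" for y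
    using that by (intro mollifier_support1 reflect_support)
  obtain B where B: "B > 0" "\<And>y. norm (?\<eta> y) \<le> B" by (rule continuous_support_bounded[OF c\<eta> z\<eta>]) auto
  have [measurable]: "?\<eta> \<in> borel_measurable lebesgue" by (rule continuous_borel_lebesgue[OF c\<eta>])
  show i2: "integrable lebesgue (\<lambda>y. (norm (f y))\<^sup>2 * ?\<eta> y)"
  proof (rule Bochner_Integration.integrable_bound)
    show "integrable lebesgue (\<lambda>y. B * (indicator (cball 0 (norm x + 1)) y * (norm (f y))\<^sup>2))"
      by (intro integrable_mult_right ball_int_norm2_integrable f)
    show "AE y in lebesgue. norm ((norm (f y))\<^sup>2 * ?\<eta> y) \<le> norm (B * (indicator (cball 0 (norm x + 1)) y * (norm (f y))\<^sup>2))"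
    proof (rule AE_I2)
      fix y
      have "(norm (f y))\<^sup>2 * norm (?\<eta> y) \<le> (norm (f y))\<^sup>2 * B" by (intro mult_left_mono B) auto
      then show "norm ((norm (f y))\<^sup>2 * ?\<eta> y) \<le> norm (B * (indicator (cball 0 (norm x + 1)) y * (norm (f y))\<^sup>2))"
        using z\<eta>[of y] B(1) by (cases "norm y \<le> norm x + 1") (auto simp: abs_mult mult.commute)
    qed
  qed measurable
  define c where "c = mollify m f x"
  have i1: "integrable lebesgue (\<lambda>y. f y * complex_of_real (?\<eta> y))"
    using conv_integrable_test[OF f test_function_mollifier] .
  have c_eq: "(LINT y|lebesgue. f y * complex_of_real (?\<eta> y)) = c" by (simp add: c_def mollify_def conv_def)
  define R where "R y = Re (f y * complex_of_real (?\<eta> y) * cnj c)" for y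
  have i3: "integrable lebesgue (\<lambda>y. f y * complex_of_real (?\<eta> y) * cnj c)"
    using i1 by (intro integrable_mult_left)
  have iR: "integrable lebesgue R" unfolding R_def using i3 by (rule integrable_Re)
  have R: "(LINT y|lebesgue. R y) = Re (c * cnj c)"
    unfolding R_def integral_Re[OF i3] using c_eq by simp
  have eq: "(norm (f y - c))\<^sup>2 * ?\<eta> y = (norm (f y))\<^sup>2 * ?\<eta> y - 2 * R y + (norm c)\<^sup>2 * ?\<eta> y" for y
    by (simp add: cnorm_diff_square R_def algebra_simps)
  have "0 \<le> (LINT y|lebesgue. (norm (f y - c))\<^sup>2 * ?\<eta> y)"
    by (intro integral_nonneg_AE) (simp add: mollifier_nonneg)
  also have "\<dots> = (LINT y|lebesgue. (norm (f y))\<^sup>2 * ?\<eta> y) - 2 * (LINT y|lebesgue. R y) + (norm c)\<^sup>2"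
    unfolding eq using i2 iR mollifier_integrable[of m x]
    by (simp add: mollifier_reflect_integral)
  also note R
  also have "Re (c * cnj c) = (norm c)\<^sup>2" unfolding cmod_power2 by (simp add: power2_eq_square)
  finally show "(norm (mollify m f x))\<^sup>2 \<le> (LINT y|lebesgue. (norm (f y))\<^sup>2 * ?\<eta> y)"
    by (simp add: c_def)
qed

lemma mollify_continuous: "locL2 f \<Longrightarrow> continuous_on UNIV (mollify m f)"
  unfolding mollify_def by (rule smooth_continuous[OF conv_smooth[OF _ test_function_mollifier]])

lemma mollify_locL2: "locL2 f \<Longrightarrow> locL2 (mollify m f)"
  by (rule locL2_continuous[OF mollify_continuous])

text \<open>The variance bound is integrated over the ball and the order of integration is
  exchanged; the kernel also has mass at most 1 in the variable \<open>x\<close> over the ball. The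
  radius grows by 1 because the kernel lives in the unit ball. The bound is uniform in
  \<open>m\<close>.\<close>

lemma mollify_ball_bound:
  assumes f: "locL2 f"
  shows "ball_int r (\<lambda>x. (norm (mollify m f x))\<^sup>2) \<le> ball_int (r + 1) (\<lambda>x. (norm (f x))\<^sup>2)"
proof -
  interpret L: sigma_finite_measure "lebesgue :: (real^2) measure" by (rule sigma_finite_lebesgue)
  interpret P: pair_sigma_finite "lebesgue :: (real^2) measure" "lebesgue :: (real^2) measure" ..
  have [measurable]: "f \<in> borel_measurable lebesgue" using f by (rule locL2_measurable)
  let ?I = "\<lambda>r x. indicator (cball (0::real^2) r) x :: real"
  have id: "(\<lambda>x. x) \<in> borel_measurable (lebesgue :: (real^2) measure)" by (rule borel_lebesgue) simp
  \<comment> \<open>The factors of the product carry completed sigma-algebras, so each projection is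
    composed with the identity into the Borel sets before subtracting.\<close>
  have [measurable]: "(\<lambda>p. fst p - snd p) \<in> borel_measurable ((lebesgue :: (real^2) measure) \<Otimes>\<^sub>M lebesgue)"
    using measurable_compose[OF measurable_fst id] measurable_compose[OF measurable_snd id]
    by (intro borel_measurable_diff)
  let ?g = "\<lambda>x y. ennreal (?I r x * ((norm (f y))\<^sup>2 * mollifier m (x - y)))"
  have meas: "case_prod ?g \<in> borel_measurable (lebesgue \<Otimes>\<^sub>M lebesgue)"
    unfolding case_prod_unfold by measurable
  have "ennreal (ball_int r (\<lambda>x. (norm (mollify m f x))\<^sup>2)) = (\<integral>\<^sup>+x. ennreal (?I r x * (norm (mollify m f x))\<^sup>2) \<partial>lebesgue)"
    unfolding ball_int_def
    by (intro nn_integral_eq_integral[symmetric] ball_int_norm2_integrable mollify_locL2 f) auto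
  also have "\<dots> \<le> (\<integral>\<^sup>+x. (\<integral>\<^sup>+y. ?g x y \<partial>lebesgue) \<partial>lebesgue)"
  proof (rule nn_integral_mono)
    fix x
    have i: "integrable lebesgue (\<lambda>y. (norm (f y))\<^sup>2 * mollifier m (x - y))" by (rule mollify_square_bound[OF f])
    have "ennreal (?I r x * (norm (mollify m f x))\<^sup>2) \<le> ennreal (LINT y|lebesgue. ?I r x * ((norm (f y))\<^sup>2 * mollifier m (x - y)))"
      using mollify_square_bound(2)[OF f, of m x] by (intro ennreal_leI) (auto simp: indicator_def)
    also have "\<dots> = (\<integral>\<^sup>+y. ?g x y \<partial>lebesgue)"
      by (intro nn_integral_eq_integral[symmetric] integrable_mult_right i) (auto simp: mollifier_nonneg)
    finally show "ennreal (?I r x * (norm (mollify m f x))\<^sup>2) \<le> (\<integral>\<^sup>+y. ?g x y \<partial>lebesgue)" .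
  qed
  also have "\<dots> = (\<integral>\<^sup>+y. (\<integral>\<^sup>+x. ?g x y \<partial>lebesgue) \<partial>lebesgue)"
    by (rule P.Fubini'[OF meas, symmetric])
  also have "\<dots> \<le> (\<integral>\<^sup>+y. ennreal (?I (r + 1) y * (norm (f y))\<^sup>2) \<partial>lebesgue)"
  proof (rule nn_integral_mono)
    fix y
    show "(\<integral>\<^sup>+x. ?g x y \<partial>lebesgue) \<le> ennreal (?I (r + 1) y * (norm (f y))\<^sup>2)"
    proof (cases "norm y \<le> r + 1")
      case True
      have i: "integrable lebesgue (\<lambda>x. mollifier m (x - y))"
      proof (rule continuous_support_integrable[where r = "norm y + 1"])
        show "continuous_on UNIV (\<lambda>x. mollifier m (x - y))"
          by (rule continuous_on_compose2[OF smooth_continuous[OF mollifier_smooth]]) (auto intro!: continuous_intros)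
      qed (use reflect_support[of y 1] in \<open>auto intro!: mollifier_support1 simp: norm_minus_commute\<close>)
      have "(\<integral>\<^sup>+x. ?g x y \<partial>lebesgue) \<le> (\<integral>\<^sup>+x. ennreal ((norm (f y))\<^sup>2 * mollifier m (x - y)) \<partial>lebesgue)"
        by (intro nn_integral_mono ennreal_leI) (auto simp: indicator_def mollifier_nonneg)
      also have "\<dots> = ennreal (LINT x|lebesgue. (norm (f y))\<^sup>2 * mollifier m (x - y))"
        by (intro nn_integral_eq_integral integrable_mult_right i) (auto simp: mollifier_nonneg)
      also have "(LINT x|lebesgue. (norm (f y))\<^sup>2 * mollifier m (x - y)) = (norm (f y))\<^sup>2"
        using integral_lebesgue_translate[of "mollifier m" "- y"] by (simp add: mollifier_integral)
      finally show ?thesis using True by simp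
    next
      case False
      have "?g x y = 0" for x
      proof (cases "norm x \<le> r")
        case True
        then have "norm (x - y) > 1" using False by (intro reflect_support) auto
        then show ?thesis by (simp add: mollifier_support1)
      qed simp
      then show ?thesis by simp
    qed
  qed
  also have "\<dots> = ennreal (ball_int (r + 1) (\<lambda>x. (norm (f x))\<^sup>2))"
    unfolding ball_int_def by (intro nn_integral_eq_integral ball_int_norm2_integrable f) auto
  finally show ?thesis by (simp add: ennreal_le_iff ball_int_nonneg)
qed

lemma mollify_continuous_close:
  assumes g: "continuous_on UNIV g" and "e > 0"
  shows "\<forall>\<^sub>F m in sequentially. \<forall>x\<in>cball 0 r. norm (mollify m g x - g x) \<le> e"
proof -
  have "uniformly_continuous_on (cball 0 (r + 1)) g"
    using g by (intro compact_uniformly_continuous) (auto intro: continuous_on_subset)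
  then obtain d where d: "d > 0"
    "\<And>x y. x \<in> cball 0 (r + 1) \<Longrightarrow> y \<in> cball 0 (r + 1) \<Longrightarrow> dist y x < d \<Longrightarrow> dist (g y) (g x) < e"
    using \<open>e > 0\<close> unfolding uniformly_continuous_on_def by metis
  have lg: "locL2 g" by (rule locL2_continuous[OF g])
  obtain N where N: "1 / (real N + 1) < d" using reals_Archimedean[OF d(1)] by (auto simp: inverse_eq_divide add.commute)
  have "norm (mollify m g x - g x) \<le> e" if m: "m \<ge> N" and x: "x \<in> cball 0 r" for m x
  proof -
    let ?\<eta> = "\<lambda>y. mollifier m (x - y)"
    have md: "1 / (real m + 1) < d"
      using N m by (smt (verit) frac_le of_nat_0_le_iff of_nat_mono)
    have i1: "integrable lebesgue (\<lambda>y. g y * complex_of_real (?\<eta> y))"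
      using conv_integrable_test[OF lg test_function_mollifier] .
    have i2: "integrable lebesgue (\<lambda>y. g x * complex_of_real (?\<eta> y))"
      by (intro integrable_mult_right integrable_of_real mollifier_integrable)
    have "mollify m g x - g x = (LINT y|lebesgue. g y * complex_of_real (?\<eta> y)) - (LINT y|lebesgue. g x * complex_of_real (?\<eta> y))"
      by (simp add: mollify_def conv_def mollifier_reflect_integral)
    also have "\<dots> = (LINT y|lebesgue. g y * complex_of_real (?\<eta> y) - g x * complex_of_real (?\<eta> y))"
      by (rule Bochner_Integration.integral_diff[symmetric, OF i1 i2])
    also have "norm \<dots> \<le> (LINT y|lebesgue. e * ?\<eta> y)"
    proof (rule order_trans[OF integral_norm_bound integral_mono])
      show "integrable lebesgue (\<lambda>y. norm (g y * complex_of_real (?\<eta> y) - g x * complex_of_real (?\<eta> y)))"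
        by (intro integrable_norm Bochner_Integration.integrable_diff i1 i2)
      show "integrable lebesgue (\<lambda>y. e * ?\<eta> y)" by (intro integrable_mult_right mollifier_integrable)
      fix y
      have "norm (g y - g x) * ?\<eta> y \<le> e * ?\<eta> y"
      proof (cases "norm (x - y) \<le> 1 / (real m + 1)")
        case True
        have "1 / (real m + 1) \<le> 1" by simp
        then have "norm (x - y) \<le> 1" using True by linarith
        then have "norm y \<le> r + 1" using x norm_triangle_sub[of y x] by (simp add: norm_minus_commute)
        then have "dist (g y) (g x) < e" using d(2)[of x y] x True md by (auto simp: dist_norm norm_minus_commute)
        then show ?thesis by (intro mult_right_mono mollifier_nonneg) (auto simp: dist_norm)
      qed (simp add: mollifier_support)
      then show "norm (g y * complex_of_real (?\<eta> y) - g x * complex_of_real (?\<eta> y)) \<le> e * ?\<eta> y"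
        by (simp add: left_diff_distrib[symmetric] norm_mult mollifier_nonneg)
    qed
    also have "\<dots> = e" by (simp add: mollifier_reflect_integral)
    finally show ?thesis .
  qed
  then show ?thesis unfolding eventually_sequentially by blast
qed

text \<open>A density argument: for a continuous \<open>g\<close> the convergence is uniform on
  balls, and mollifying \<open>f - g\<close> does not increase the error beyond that of a ball
  larger by 1, uniformly in \<open>m\<close>.\<close>

lemma mollify_converges:
  assumes f: "locL2 f" shows "L2conv (\<lambda>m. mollify m f) f"
  unfolding L2conv_def
proof (intro conjI allI f mollify_locL2)
  fix r
  show "(\<lambda>m. ball_int r (\<lambda>x. (norm (mollify m f x - f x))\<^sup>2)) \<longlonglongrightarrow> 0"
  proof (rule LIMSEQ_I)
    fix e :: real assume "e > 0"
    \<comment> \<open>Two applications of the triangle inequality for squares give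
      \<open>2 * (e/8) + 4 * (e/16) + 4 * (e/8) = e\<close>; the middle term is the uniform error
      for \<open>g\<close> times the area of the ball.\<close>
    obtain g where g: "continuous_on UNIV g" "ball_int (r + 1) (\<lambda>x. (norm (f x - g x))\<^sup>2) < e / 8"
      by (rule locL2_approx_continuous[OF f, of "e / 8" "r + 1"]) (use \<open>e > 0\<close> in auto)
    have lg: "locL2 g" by (rule locL2_continuous[OF g(1)])
    define V where "V = (LINT x::real^2|lebesgue. indicator (cball 0 r) x * (1::real))"
    have V: "V \<ge> 0" unfolding V_def by (intro integral_nonneg_AE) auto
    have "\<forall>\<^sub>F m in sequentially. \<forall>x\<in>cball 0 r. norm (mollify m g x - g x) \<le> sqrt (e / (16 * (V + 1)))"
      using \<open>e > 0\<close> V by (intro mollify_continuous_close g) auto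
    then obtain N where N: "\<And>m x. m \<ge> N \<Longrightarrow> x \<in> cball 0 r \<Longrightarrow> norm (mollify m g x - g x) \<le> sqrt (e / (16 * (V + 1)))"
      unfolding eventually_sequentially by blast
    have "ball_int r (\<lambda>x. (norm (mollify m f x - f x))\<^sup>2) < e" if m: "m \<ge> N" for m
    proof -
      have lm: "locL2 (mollify m g)" "locL2 (mollify m f)" by (intro mollify_locL2 lg f)+
      have "mollify m f x - mollify m g x = mollify m (\<lambda>x. f x - g x) x" for x
        unfolding mollify_def by (rule conv_diff[OF f lg test_function_mollifier, symmetric])
      then have 1: "ball_int r (\<lambda>x. (norm (mollify m f x - mollify m g x))\<^sup>2) < e / 8"
        using mollify_ball_bound[OF locL2_diff[OF f lg], of r m] g(2) by simp
      have 2: "ball_int r (\<lambda>x. (norm (g x - f x))\<^sup>2) < e / 8"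
        using ball_int_mono_radius[OF locL2_diff[OF f lg], of r "r + 1"] g(2)
        by (simp add: norm_minus_commute)
      have "(norm (mollify m g x - g x))\<^sup>2 \<le> e / (16 * (V + 1))" if "x \<in> cball 0 r" for x
        using power_mono[OF N[OF m that], of 2] \<open>e > 0\<close> V by simp
      then have "ball_int r (\<lambda>x. (norm (mollify m g x - g x))\<^sup>2) \<le> (LINT x::real^2|lebesgue. indicator (cball 0 r) x * (e / (16 * (V + 1))))"
        unfolding ball_int_def
        by (intro integral_mono ball_int_norm2_integrable locL2_diff lm lg indicator_ball_integrable)
           (auto simp: indicator_def)
      also have "\<dots> = V * (e / (16 * (V + 1)))" unfolding V_def by simp
      also have "\<dots> = e / 16 * (V / (V + 1))" by simp
      also have "\<dots> \<le> e / 16 * 1" using V \<open>e > 0\<close> by (intro mult_left_mono) auto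
      finally have 3: "ball_int r (\<lambda>x. (norm (mollify m g x - g x))\<^sup>2) \<le> e / 16" by simp
      have "ball_int r (\<lambda>x. (norm (mollify m f x - f x))\<^sup>2) \<le> 2 * ball_int r (\<lambda>x. (norm (mollify m f x - mollify m g x))\<^sup>2)
         + 2 * ball_int r (\<lambda>x. (norm (mollify m g x - f x))\<^sup>2)"
        by (rule ball_int_triangle[OF lm(2) lm(1) f])
      moreover have "ball_int r (\<lambda>x. (norm (mollify m g x - f x))\<^sup>2) \<le> 2 * ball_int r (\<lambda>x. (norm (mollify m g x - g x))\<^sup>2)
         + 2 * ball_int r (\<lambda>x. (norm (g x - f x))\<^sup>2)"
        by (rule ball_int_triangle[OF lm(1) lg f])
      ultimately show ?thesis using 1 2 3 \<open>e > 0\<close> by linarith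
    qed
    then show "\<exists>N. \<forall>m\<ge>N. norm (ball_int r (\<lambda>x. (norm (mollify m f x - f x))\<^sup>2) - 0) < e"
      by (intro exI[of _ N]) (auto simp: ball_int_nonneg)
  qed
qed

lemma ball_int_zero_AE:
  assumes "locL2 f" "\<And>r. ball_int r (\<lambda>x. (norm (f x))\<^sup>2) \<le> 0"
  shows "AE x in lebesgue. f x = 0"
proof -
  have "AE x in lebesgue. indicator (cball 0 r) x * (norm (f x))\<^sup>2 = 0" for r
  proof -
    have "ball_int r (\<lambda>x. (norm (f x))\<^sup>2) = 0"
      using assms(2)[of r] ball_int_nonneg[of "\<lambda>x. (norm (f x))\<^sup>2" r] by simp
    then show ?thesis unfolding ball_int_def
      using integral_nonneg_eq_0_iff_AE[OF ball_int_norm2_integrable[OF assms(1), of r]] by auto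
  qed
  then have "AE x in lebesgue. \<forall>n. indicator (cball 0 (real n)) x * (norm (f x))\<^sup>2 = 0"
    by (subst AE_all_countable) blast
  then show ?thesis
  proof eventually_elim
    case (elim x)
    obtain n where "norm x \<le> real n" using real_arch_simple by blast
    then show ?case using elim[rule_format, of n] by simp
  qed
qed

lemma L2conv_unique:
  assumes "L2conv F f" "L2conv F g" shows "AE x in lebesgue. f x = g x"
proof -
  have l: "locL2 f" "locL2 g" "locL2 (F m)" for m using assms by (auto simp: L2conv_def)
  have "ball_int r (\<lambda>x. (norm (f x - g x))\<^sup>2) \<le> 0" for r
  proof (rule LIMSEQ_le_const)
    show "(\<lambda>m. 2 * ball_int r (\<lambda>x. (norm (F m x - f x))\<^sup>2) + 2 * ball_int r (\<lambda>x. (norm (F m x - g x))\<^sup>2)) \<longlonglongrightarrow> 0"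
      using assms unfolding L2conv_def by (auto intro!: tendsto_eq_intros)
    show "\<exists>N. \<forall>m\<ge>N. ball_int r (\<lambda>x. (norm (f x - g x))\<^sup>2) \<le> 2 * ball_int r (\<lambda>x. (norm (F m x - f x))\<^sup>2) + 2 * ball_int r (\<lambda>x. (norm (F m x - g x))\<^sup>2)"
      using ball_int_triangle[OF l(1) l(3) l(2), of r] by (simp add: norm_minus_commute)
  qed
  then have "AE x in lebesgue. f x - g x = 0" by (intro ball_int_zero_AE locL2_diff l)
  then show ?thesis by simp
qed

subsection \<open>Energy identities for weak solutions\<close>

lemma Ck_on_Suc0_continuous:
  "Ck_on (Suc 0) UNIV f \<Longrightarrow> continuous_on UNIV f"
  "Ck_on (Suc 0) UNIV f \<Longrightarrow> continuous_on UNIV (partial_deriv i f)"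
  "Ck_on (Suc 0) UNIV f \<Longrightarrow> f differentiable (at x)"
  using Ck_on_Suc_imp[of 0 UNIV f] by (auto simp: differentiable_on_def)

lemma partial_deriv_support:
  "(\<And>x. norm x > r \<Longrightarrow> f x = 0) \<Longrightarrow> norm x > r \<Longrightarrow> partial_deriv i f x = 0"
  by (rule partial_deriv_zero_outside[of "cball 0 r"]) auto

text \<open>The integral of the divergence of \<psi> times \<open>cnj u\<close> times the gradient
  of \<open>u\<close> vanishes. One continuous derivative of \<psi> is all that the cutoff used
  later offers. The first term on the right is real and so drops out of the imaginary part.\<close>

lemma green_identity:
  assumes u: "smooth u" and \<psi>: "Ck_on (Suc 0) UNIV \<psi>" "\<And>x. norm x > r \<Longrightarrow> \<psi> x = 0"
  shows "(LINT x|lebesgue. laplacian u x * cnj (u x) * complex_of_real (\<psi> x)) =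
    - complex_of_real (LINT x|lebesgue. \<psi> x * (\<Sum>i\<in>UNIV. (norm (partial_deriv i u x))\<^sup>2))
    - (\<Sum>i\<in>UNIV. LINT x|lebesgue. cnj (u x) * partial_deriv i u x * complex_of_real (partial_deriv i \<psi> x))"
proof -
  have uc: "continuous_on UNIV u" "continuous_on UNIV (partial_deriv i u)" "continuous_on UNIV (laplacian u)" for i
    using u by (auto intro: smooth_continuous smooth_partial smooth_laplacian)
  have ud: "u differentiable (at x)" "partial_deriv i u differentiable (at x)" for i x
    using u by (auto intro: smooth_differentiable smooth_partial)
  note \<psi>c = Ck_on_Suc0_continuous[OF \<psi>(1)]
  let ?X = "\<lambda>i x. complex_of_real (\<psi> x) * (cnj (u x) * partial_deriv i u x)"
  have C1\<psi>: "Ck_on (Suc 0) UNIV (\<lambda>x. complex_of_real (\<psi> x))"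
    by (rule Ck_on_linear[OF bounded_linear_of_real \<psi>(1)])
  have C1u: "Ck_on (Suc 0) UNIV (\<lambda>x. cnj (u x) * partial_deriv i u x)" for i
    using u smooth_partial[OF u, of i] unfolding smooth_def
    by (intro Ck_on_mult Ck_on_linear[OF bounded_linear_cnj]) auto
  have C1: "Ck_on (Suc 0) UNIV (?X i)" for i
    by (rule Ck_on_mult[OF C1\<psi> C1u])
  have dX: "partial_deriv i (?X i) x = cnj (u x) * partial_deriv i (partial_deriv i u) x * complex_of_real (\<psi> x)
      + complex_of_real (\<psi> x * (norm (partial_deriv i u x))\<^sup>2)
      + cnj (u x) * partial_deriv i u x * complex_of_real (partial_deriv i \<psi> x)" for i x
  proof -
    have dc: "(\<lambda>x. cnj (u x)) differentiable (at x)"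
      using ud(1)[of x] bounded_linear.has_derivative[OF bounded_linear_cnj] unfolding differentiable_def by blast
    have "partial_deriv i (\<lambda>x. cnj (u x) * partial_deriv i u x) x =
       cnj (u x) * partial_deriv i (partial_deriv i u) x + cnj (partial_deriv i u x) * partial_deriv i u x"
      using partial_deriv_mult[OF dc ud(2)] partial_deriv_linear[OF bounded_linear_cnj ud(1)] by simp
    moreover have "partial_deriv i (\<lambda>x. complex_of_real (\<psi> x)) x = complex_of_real (partial_deriv i \<psi> x)"
      by (rule partial_deriv_linear[OF bounded_linear_of_real \<psi>c(3)])
    moreover have "cnj (partial_deriv i u x) * partial_deriv i u x = complex_of_real ((norm (partial_deriv i u x))\<^sup>2)"
      by (metis complex_norm_square mult.commute)
    ultimately show ?thesis
      using partial_deriv_mult[OF Ck_on_Suc0_continuous(3)[OF C1\<psi>, of x] Ck_on_Suc0_continuous(3)[OF C1u]]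
      by (simp add: algebra_simps)
  qed
  have i1: "integrable lebesgue (\<lambda>x. cnj (u x) * partial_deriv i (partial_deriv i u) x * complex_of_real (\<psi> x))" for i
    by (rule continuous_support_integrable[where r = r])
       (use \<psi> \<psi>c uc smooth_continuous[OF smooth_partial[OF smooth_partial[OF u]]] in \<open>auto intro!: continuous_intros\<close>)
  have i2r: "integrable lebesgue (\<lambda>x. \<psi> x * (norm (partial_deriv i u x))\<^sup>2)" for i
    by (rule continuous_support_integrable[where r = r]) (use \<psi> \<psi>c uc in \<open>auto intro!: continuous_intros\<close>)
  have i2: "integrable lebesgue (\<lambda>x. complex_of_real (\<psi> x * (norm (partial_deriv i u x))\<^sup>2))" for i
    by (rule integrable_of_real[OF i2r])
  have i3: "integrable lebesgue (\<lambda>x. cnj (u x) * partial_deriv i u x * complex_of_real (partial_deriv i \<psi> x))" for i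
    by (rule continuous_support_integrable[where r = r])
       (use \<psi> \<psi>c uc partial_deriv_support[OF \<psi>(2)] in \<open>auto intro!: continuous_intros\<close>)
  have "0 = (\<Sum>i\<in>UNIV. LINT x|lebesgue. partial_deriv i (?X i) x)"
    using integral_partial_deriv_zero[OF C1, of r] \<psi>(2) by simp
  also have "\<dots> = (\<Sum>i\<in>UNIV. (LINT x|lebesgue. cnj (u x) * partial_deriv i (partial_deriv i u) x * complex_of_real (\<psi> x))
     + complex_of_real (LINT x|lebesgue. \<psi> x * (norm (partial_deriv i u x))\<^sup>2)
     + (LINT x|lebesgue. cnj (u x) * partial_deriv i u x * complex_of_real (partial_deriv i \<psi> x)))"
    unfolding dX using i1 i2 i3 integral_complex_of_real[of lebesgue] 
    by (intro sum.cong refl) (simp only: Bochner_Integration.integral_add Bochner_Integration.integrable_add integral_complex_of_real)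
  also have "\<dots> = (LINT x|lebesgue. (\<Sum>i\<in>UNIV. cnj (u x) * partial_deriv i (partial_deriv i u) x * complex_of_real (\<psi> x)))
     + complex_of_real (LINT x|lebesgue. (\<Sum>i\<in>UNIV. \<psi> x * (norm (partial_deriv i u x))\<^sup>2))
     + (\<Sum>i\<in>UNIV. LINT x|lebesgue. cnj (u x) * partial_deriv i u x * complex_of_real (partial_deriv i \<psi> x))"
    using i1 i2r by (simp add: sum.distrib Bochner_Integration.integral_sum)
  also have "(\<lambda>x. \<Sum>i\<in>UNIV. cnj (u x) * partial_deriv i (partial_deriv i u) x * complex_of_real (\<psi> x)) = (\<lambda>x. laplacian u x * cnj (u x) * complex_of_real (\<psi> x))"
    by (simp add: laplacian_def sum_distrib_left sum_distrib_right mult_ac)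
  also have "(\<lambda>x. \<Sum>i\<in>UNIV. \<psi> x * (norm (partial_deriv i u x))\<^sup>2) = (\<lambda>x. \<psi> x * (\<Sum>i\<in>UNIV. (norm (partial_deriv i u x))\<^sup>2))"
    by (simp add: sum_distrib_left)
  finally show ?thesis by (simp add: algebra_simps eq_neg_iff_add_eq_0)
qed

text \<open>The assumption on \<psi> bounds its derivative by 2 sqrt (c \<psi>), so the inequality
  between a product and squares absorbs the mixed term into the gradient term and leaves
  \<open>c\<close> times the square of \<open>u\<close> for each of the two coordinates.\<close>

lemma caccioppoli_smooth:
  assumes u: "smooth u" and \<psi>: "Ck_on (Suc 0) UNIV \<psi>" "\<And>x. norm x > r \<Longrightarrow> \<psi> x = 0"
    and c: "c \<ge> 0" "\<And>x. \<psi> x \<ge> 0" "\<And>i x. (partial_deriv i \<psi> x)\<^sup>2 \<le> 4 * c * \<psi> x"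
  shows "Re (LINT x|lebesgue. laplacian u x * cnj (u x) * complex_of_real (\<psi> x))
    \<le> 2 * c * ball_int r (\<lambda>x. (norm (u x))\<^sup>2)"
proof -
  have uc: "continuous_on UNIV u" "continuous_on UNIV (partial_deriv i u)" for i
    using u by (auto intro: smooth_continuous smooth_partial)
  note \<psi>c = Ck_on_Suc0_continuous[OF \<psi>(1)]
  have i2: "integrable lebesgue (\<lambda>x. \<psi> x * (\<Sum>i\<in>UNIV. (norm (partial_deriv i u x))\<^sup>2))"
    by (rule continuous_support_integrable[where r = r]) (use \<psi> \<psi>c uc in \<open>auto intro!: continuous_intros\<close>)
  have i3: "integrable lebesgue (\<lambda>x. cnj (u x) * partial_deriv i u x * complex_of_real (partial_deriv i \<psi> x))" for i
    by (rule continuous_support_integrable[where r = r])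
       (use \<psi> \<psi>c uc partial_deriv_support[OF \<psi>(2)] in \<open>auto intro!: continuous_intros\<close>)
  let ?R = "\<lambda>i x. Re (cnj (u x) * partial_deriv i u x * complex_of_real (partial_deriv i \<psi> x))"
  have "Re (LINT x|lebesgue. laplacian u x * cnj (u x) * complex_of_real (\<psi> x)) =
      - (LINT x|lebesgue. \<psi> x * (\<Sum>i\<in>UNIV. (norm (partial_deriv i u x))\<^sup>2)) - (\<Sum>i\<in>UNIV. LINT x|lebesgue. ?R i x)"
    using integral_Re[OF i3] by (simp add: green_identity[OF u \<psi>])
  also have "\<dots> = (LINT x|lebesgue. - (\<psi> x * (\<Sum>i\<in>UNIV. (norm (partial_deriv i u x))\<^sup>2)) - (\<Sum>i\<in>UNIV. ?R i x))"
    using i2 integrable_Re[OF i3]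
    by (subst Bochner_Integration.integral_diff)
       (auto simp: Bochner_Integration.integral_sum intro!: Bochner_Integration.integrable_sum simp del: minus_mult_left times_complex.sel)
  also have "\<dots> \<le> (LINT x|lebesgue. 2 * c * (indicator (cball 0 r) x * (norm (u x))\<^sup>2))"
  proof (rule integral_mono)
    show "integrable lebesgue (\<lambda>x. - (\<psi> x * (\<Sum>i\<in>UNIV. (norm (partial_deriv i u x))\<^sup>2)) - (\<Sum>i\<in>UNIV. ?R i x))"
      using i2 integrable_Re[OF i3]
      by (intro Bochner_Integration.integrable_diff Bochner_Integration.integrable_sum Bochner_Integration.integrable_minus) 
    show "integrable lebesgue (\<lambda>x. 2 * c * (indicator (cball 0 r) x * (norm (u x))\<^sup>2))"
      by (intro integrable_mult_right ball_int_norm2_integrable locL2_continuous uc)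
    fix x
    have "- (\<psi> x * (norm (partial_deriv i u x))\<^sup>2) - ?R i x \<le> c * (indicator (cball 0 r) x * (norm (u x))\<^sup>2)" for i
    proof (cases "norm x > r")
      case True
      then show ?thesis using \<psi>(2)[OF True] partial_deriv_support[OF \<psi>(2) True] by simp
    next
      case False
      have "\<bar>partial_deriv i \<psi> x\<bar> \<le> sqrt (4 * c * \<psi> x)"
        using c(3)[of i x] by (simp add: real_le_rsqrt)
      also have "\<dots> = 2 * sqrt c * sqrt (\<psi> x)" by (simp add: real_sqrt_mult)
      finally have "norm (u x) * norm (partial_deriv i u x) * \<bar>partial_deriv i \<psi> x\<bar> \<le>
         norm (u x) * norm (partial_deriv i u x) * (2 * sqrt c * sqrt (\<psi> x))"
        by (intro mult_left_mono) auto
      also have "\<dots> = 2 * (sqrt c * norm (u x)) * (sqrt (\<psi> x) * norm (partial_deriv i u x))" by simp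
      also have "\<dots> \<le> (sqrt c * norm (u x))\<^sup>2 + (sqrt (\<psi> x) * norm (partial_deriv i u x))\<^sup>2"
        by (rule sum_squares_bound)
      also have "\<dots> = c * (norm (u x))\<^sup>2 + \<psi> x * (norm (partial_deriv i u x))\<^sup>2"
        using c by (simp add: power_mult_distrib)
      finally have "norm (u x) * norm (partial_deriv i u x) * \<bar>partial_deriv i \<psi> x\<bar> \<le> c * (norm (u x))\<^sup>2 + \<psi> x * (norm (partial_deriv i u x))\<^sup>2" .
      moreover have "- ?R i x \<le> norm (u x) * norm (partial_deriv i u x) * \<bar>partial_deriv i \<psi> x\<bar>"
        using abs_Re_le_cmod[of "cnj (u x) * partial_deriv i u x * complex_of_real (partial_deriv i \<psi> x)"]
        unfolding norm_mult complex_mod_cnj norm_of_real real_norm_def by linarith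
      ultimately have "- (\<psi> x * (norm (partial_deriv i u x))\<^sup>2) - ?R i x \<le> c * (norm (u x))\<^sup>2" by linarith
      then show ?thesis using False by simp
    qed
    from this[of 1] this[of 2]
    show "- (\<psi> x * (\<Sum>i\<in>UNIV. (norm (partial_deriv i u x))\<^sup>2)) - (\<Sum>i\<in>UNIV. ?R i x)
        \<le> 2 * c * (indicator (cball 0 r) x * (norm (u x))\<^sup>2)"
      unfolding sum_2 distrib_left by linarith
  qed
  also have "\<dots> = 2 * c * ball_int r (\<lambda>x. (norm (u x))\<^sup>2)" unfolding ball_int_def by simp
  finally show ?thesis .
qed

lemma L2conv_cnj: "L2conv F f \<Longrightarrow> L2conv (\<lambda>m x. cnj (F m x)) (\<lambda>x. cnj (f x))"
  unfolding L2conv_def by (auto simp: locL2_cnj complex_cnj_diff[symmetric] simp del: complex_cnj_diff)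

lemma L2conv_ball_int:
  assumes "L2conv F f"
  shows "(\<lambda>m. ball_int r (\<lambda>x. (norm (F m x))\<^sup>2)) \<longlonglongrightarrow> ball_int r (\<lambda>x. (norm (f x))\<^sup>2)"
proof -
  have eq: "(LINT x|lebesgue. g x * cnj (g x) * complex_of_real (indicator (cball 0 r) x)) = complex_of_real (ball_int r (\<lambda>x. (norm (g x))\<^sup>2))" for g
  proof -
    have "g x * cnj (g x) * complex_of_real (indicator (cball 0 r) x) = complex_of_real (indicator (cball 0 r) x * (norm (g x))\<^sup>2)" for x
      unfolding of_real_mult complex_norm_square by simp
    then show ?thesis by (simp only: ball_int_def integral_complex_of_real)
  qed
  have "(\<lambda>m. LINT x|lebesgue. F m x * cnj (F m x) * complex_of_real (indicator (cball 0 r) x))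
     \<longlonglongrightarrow> (LINT x|lebesgue. f x * cnj (f x) * complex_of_real (indicator (cball 0 r) x))"
    by (rule L2conv_integral_product[where B = 1 and r = r, OF assms L2conv_cnj[OF assms]])
       (auto simp: indicator_def)
  then show ?thesis unfolding eq by (simp only: tendsto_of_real_iff)
qed

lemma continuous_support_times_limit:
  assumes "L2conv F f" "L2conv G g" "continuous_on UNIV \<psi>" "\<And>x. norm x > r \<Longrightarrow> \<psi> x = 0"
  shows "(\<lambda>m. LINT x|lebesgue. F m x * G m x * complex_of_real (\<psi> x)) \<longlonglongrightarrow> (LINT x|lebesgue. f x * g x * complex_of_real (\<psi> x))"
proof -
  obtain B where B: "\<And>x. norm (\<psi> x) \<le> B" by (rule continuous_support_bounded[OF assms(3,4)]) auto
  show ?thesis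
    by (rule L2conv_integral_product[where B = B and r = r, OF assms(1,2)])
       (use assms B in \<open>auto intro!: continuous_borel_lebesgue continuous_intros\<close>)
qed

lemma weak_lap_mollify: "weak_lap u q \<Longrightarrow> laplacian (mollify m u) = mollify m q"
  unfolding mollify_def by (rule weak_lap_conv[OF _ test_function_mollifier])

lemma mollify_smooth: "locL2 f \<Longrightarrow> smooth (mollify m f)"
  unfolding mollify_def by (rule conv_smooth[OF _ test_function_mollifier])

text \<open>Both sides are free of the gradient of \<open>u\<close>, so the inequality passes to the
  limit along the mollifications by L2 convergence alone.\<close>

lemma caccioppoli:
  assumes w: "weak_lap u q" and \<psi>: "Ck_on (Suc 0) UNIV \<psi>" "\<And>x. norm x > r \<Longrightarrow> \<psi> x = 0"
    and c: "c \<ge> 0" "\<And>x. \<psi> x \<ge> 0" "\<And>i x. (partial_deriv i \<psi> x)\<^sup>2 \<le> 4 * c * \<psi> x"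
  shows "Re (LINT x|lebesgue. q x * cnj (u x) * complex_of_real (\<psi> x))
    \<le> 2 * c * ball_int r (\<lambda>x. (norm (u x))\<^sup>2)"
proof (rule LIMSEQ_le)
  have l: "locL2 u" "locL2 q" using w by (auto simp: weak_lap_def)
  show "(\<lambda>m. Re (LINT x|lebesgue. laplacian (mollify m u) x * cnj (mollify m u x) * complex_of_real (\<psi> x)))
      \<longlonglongrightarrow> Re (LINT x|lebesgue. q x * cnj (u x) * complex_of_real (\<psi> x))"
    unfolding weak_lap_mollify[OF w]
    by (intro tendsto_Re continuous_support_times_limit[where r = r] mollify_converges L2conv_cnj l \<psi> Ck_on_Suc0_continuous(1))
  show "(\<lambda>m. 2 * c * ball_int r (\<lambda>x. (norm (mollify m u x))\<^sup>2)) \<longlonglongrightarrow> 2 * c * ball_int r (\<lambda>x. (norm (u x))\<^sup>2)"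
    by (intro tendsto_mult tendsto_const L2conv_ball_int mollify_converges l)
  show "\<exists>N. \<forall>m\<ge>N. Re (LINT x|lebesgue. laplacian (mollify m u) x * cnj (mollify m u x) * complex_of_real (\<psi> x))
      \<le> 2 * c * ball_int r (\<lambda>x. (norm (mollify m u x))\<^sup>2)"
    using caccioppoli_smooth[OF mollify_smooth[OF l(1)] \<psi> c] by blast
qed

section \<open>Energy flux through the region where the field is classical\<close>

definition C1_outside :: "real \<Rightarrow> (real^2 \<Rightarrow> complex) \<Rightarrow> bool" where
  "C1_outside R v \<longleftrightarrow> (\<forall>x. norm x > R \<longrightarrow> v differentiable (at x)) \<and>
     (\<forall>i. continuous_on {x. norm x > R} (partial_deriv i v))"

lemma open_outside: "open {x::real^2. norm x > R}" "open {x::real^2. norm x < R}"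
  by (auto intro!: open_Collect_less continuous_intros)

lemma C1_outside_continuous: "C1_outside R v \<Longrightarrow> continuous_on {x. norm x > R} v"
  unfolding C1_outside_def
  by (intro differentiable_imp_continuous_on) (auto simp: differentiable_on_def intro: differentiable_at_withinI)

text \<open>Nothing is known about \<open>g\<close> inside radius \<open>R\<close>, but the kernel
  vanishes for \<open>norm y < norm x - 1\<close>. The two open sets on which continuity is clear
  cover the plane because \<open>norm x > R + 1\<close>.\<close>

lemma glued_product_continuous:
  fixes g \<zeta> :: "real^2 \<Rightarrow> complex"
  assumes "continuous_on {y. norm y > R} g" "continuous_on UNIV \<zeta>" "\<And>z. norm z > 1 \<Longrightarrow> \<zeta> z = 0" "norm x > R + 1"
  shows "continuous_on UNIV (\<lambda>y. g y * \<zeta> (x - y))"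
proof -
  have cont: "continuous_on ({y. norm y > R} \<union> {y. norm y < norm x - 1}) (\<lambda>y. g y * \<zeta> (x - y))"
  proof (rule continuous_on_open_Un)
    show "continuous_on {y. norm y > R} (\<lambda>y. g y * \<zeta> (x - y))"
      by (intro continuous_on_mult assms(1) continuous_reflect[OF assms(2)])
    have z: "\<zeta> (x - y) = 0" if "norm y < norm x - 1" for y
      using that norm_triangle_ineq2[of x y] by (intro assms(3)) linarith
    show "continuous_on {y. norm y < norm x - 1} (\<lambda>y. g y * \<zeta> (x - y))"
      by (rule continuous_on_eq[of _ "\<lambda>_. 0"]) (auto simp: z)
  qed (rule open_outside)+
  have eq: "{y. norm y > R} \<union> {y. norm y < norm x - 1} = UNIV" using assms(4) by auto
  show ?thesis using cont unfolding eq .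
qed

text \<open>Integration by parts against the reflected kernel. The product of \<open>v\<close> with
  this kernel is continuously differentiable on the whole plane, since the kernel vanishes where
  \<open>v\<close> is uncontrolled.\<close>

lemma conv_partial_outside:
  assumes v: "C1_outside R v" and \<eta>: "smooth \<eta>" "\<And>z. norm z > 1 \<Longrightarrow> \<eta> z = 0" and x: "norm x > R + 1"
  shows "conv v (partial_deriv i \<eta>) x = conv (partial_deriv i v) \<eta> x"
proof -
  have vd: "v differentiable (at y)" if "norm y > R" for y using v that by (auto simp: C1_outside_def)
  have pvc: "continuous_on {y. norm y > R} (partial_deriv j v)" for j using v by (auto simp: C1_outside_def)
  have \<eta>c: "continuous_on UNIV \<eta>" "continuous_on UNIV (partial_deriv j \<eta>)" for j
    using \<eta>(1) by (auto intro: smooth_continuous smooth_partial)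
  have \<eta>z: "partial_deriv j \<eta> z = 0" if "norm z > 1" for j z
    using partial_deriv_support[OF \<eta>(2) that] .
  let ?P = "\<lambda>y. v y * \<eta> (x - y)"
  have inner: "\<eta> (x - y) = 0" "partial_deriv j \<eta> (x - y) = 0" if "norm y < norm x - 1" for y j
    using that norm_triangle_ineq2[of x y] by (auto intro!: \<eta>(2) \<eta>z)
  have dP: "?P differentiable (at y) \<and> partial_deriv j ?P y = partial_deriv j v y * \<eta> (x - y) - v y * partial_deriv j \<eta> (x - y)" for y j
  proof (cases "norm y > R")
    case True
    have d2: "(\<lambda>y. \<eta> (x - y)) differentiable (at y)"
      using smooth_differentiable[OF smooth_reflect[OF \<eta>(1)]] .
    show ?thesis
      using partial_deriv_mult[OF vd[OF True] d2, of j] partial_deriv_reflect[OF smooth_differentiable[OF \<eta>(1)], of j x y]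
        differentiable_mult[OF vd[OF True] d2] by (simp add: algebra_simps)
  next
    case False
    then have y: "y \<in> {y. norm y < norm x - 1}" using x by auto
    have "partial_deriv j ?P y = partial_deriv j (\<lambda>_. 0) y"
      by (rule partial_deriv_cong_open[OF open_outside(2) y]) (simp add: inner)
    moreover have "partial_deriv j (\<lambda>_::real^2. 0::complex) y = 0"
      by (subst partial_deriv_eq[of _ "\<lambda>_. 0"]) auto
    moreover have "?P differentiable (at y)"
    proof -
      have "((\<lambda>_. 0) has_derivative (\<lambda>_. 0)) (at y)" by simp
      then have "(?P has_derivative (\<lambda>_. 0)) (at y)"
        by (rule has_derivative_transform_within_open[OF _ open_outside(2) y]) (simp add: inner)
      then show ?thesis by (auto simp: differentiable_def)
    qed
    ultimately show ?thesis using inner y by simp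
  qed
  have c1: "continuous_on UNIV (\<lambda>y. partial_deriv j v y * \<eta> (x - y))" for j
    by (rule glued_product_continuous[OF pvc \<eta>c(1) \<eta>(2) x])
  have c2: "continuous_on UNIV (\<lambda>y. v y * partial_deriv j \<eta> (x - y))" for j
    by (rule glued_product_continuous[OF C1_outside_continuous[OF v] \<eta>c(2) \<eta>z x])
  have s: "\<eta> (x - y) = 0" "partial_deriv j \<eta> (x - y) = 0" if "norm y > norm x + 1" for y j
    using that reflect_support by (auto intro!: \<eta>(2) \<eta>z)
  have "Ck_on (Suc 0) UNIV ?P"
  proof -
    have "partial_deriv j ?P = (\<lambda>y. partial_deriv j v y * \<eta> (x - y) - v y * partial_deriv j \<eta> (x - y))" for j
      using dP by blast
    then show ?thesis using c1 c2 dP by (auto simp: differentiable_on_def intro!: continuous_on_diff)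
  qed
  then have "(LINT y|lebesgue. partial_deriv i ?P y) = 0"
    by (rule integral_partial_deriv_zero[where r = "norm x + 1"]) (simp add: s)
  then have "(LINT y|lebesgue. partial_deriv i v y * \<eta> (x - y) - v y * partial_deriv i \<eta> (x - y)) = 0"
    using dP by simp
  moreover have "integrable lebesgue (\<lambda>y. partial_deriv i v y * \<eta> (x - y))"
    by (rule continuous_support_integrable[OF c1, where r = "norm x + 1"]) (simp add: s)
  moreover have "integrable lebesgue (\<lambda>y. v y * partial_deriv i \<eta> (x - y))"
    by (rule continuous_support_integrable[OF c2, where r = "norm x + 1"]) (simp add: s)
  ultimately show ?thesis by (simp add: conv_def Bochner_Integration.integral_diff)
qed

text \<open>A function controlled only outside a ball is set to 0 inside, so that it becomes locally
  square integrable and can be mollified.\<close>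

definition cut :: "real \<Rightarrow> (real^2 \<Rightarrow> complex) \<Rightarrow> real^2 \<Rightarrow> complex" where
  "cut R f x = (if norm x \<ge> R then f x else 0)"

lemma locL2_cut:
  assumes "continuous_on {x. norm x > R} f" "R < R'"
  shows "locL2 (cut R' f)"
proof -
  have cl: "closed {x::real^2. norm x \<ge> R'}" by (intro closed_Collect_le continuous_intros)
  have c: "continuous_on {x. norm x \<ge> R'} f"
    by (rule continuous_on_subset[OF assms(1)]) (use assms(2) in auto)
  have m: "cut R' f \<in> borel_measurable lebesgue"
  proof -
    have "(\<lambda>x. if x \<in> {x. norm x \<ge> R'} then f x else 0) \<in> borel_measurable borel"
      by (rule borel_measurable_continuous_on_if) (use cl c in auto)
    then have "cut R' f \<in> borel_measurable borel" by (simp add: cut_def[abs_def])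
    then show ?thesis by (rule borel_lebesgue)
  qed
  have "locL2 (\<lambda>x. cut R' f x * 1)"
  proof (rule locL2_mult[OF _ m])
    fix r
    have "compact (cball (0::real^2) r \<inter> {x. norm x \<ge> R'})" by (intro compact_Int_closed compact_cball cl)
    then have "bounded (f ` (cball 0 r \<inter> {x. norm x \<ge> R'}))"
      by (intro compact_imp_bounded compact_continuous_image continuous_on_subset[OF c]) auto
    then obtain B where B: "B > 0" "\<forall>y\<in>f ` (cball 0 r \<inter> {x. norm x \<ge> R'}). norm y \<le> B" by (auto simp: bounded_pos)
    then show "\<exists>B. AE x in lebesgue. norm x \<le> r \<longrightarrow> norm (cut R' f x) \<le> B"
      by (intro exI[of _ B] AE_I2) (auto simp: cut_def)
  qed (rule locL2_continuous, simp)
  then show ?thesis by simp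
qed

lemma conv_cut:
  assumes "\<And>z. norm z > 1 \<Longrightarrow> \<eta> z = 0" "norm x > R + 1"
  shows "conv (cut R f) \<eta> x = conv f \<eta> x"
proof -
  have "cut R f y * \<eta> (x - y) = f y * \<eta> (x - y)" for y
  proof (cases "norm y \<ge> R")
    case False
    then have "norm (x - y) > 1" using assms(2) norm_triangle_ineq2[of x y] by linarith
    then show ?thesis by (simp add: assms(1))
  qed (simp add: cut_def)
  then show ?thesis by (simp only: conv_def)
qed

lemma conv_cut_AE:
  assumes "AE y in lebesgue. norm y > R \<longrightarrow> u y = v y" "\<And>z. norm z > 1 \<Longrightarrow> \<eta> z = 0" "norm x > R + 1"
    "locL2 u" "continuous_on UNIV \<eta>" "C1_outside R v"
  shows "conv u \<eta> x = conv v \<eta> x"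
proof -
  \<comment> \<open>The cut needs a radius strictly above \<open>R\<close>, since \<open>v\<close>
    may be unbounded near that circle, and strictly below \<open>norm x - 1\<close>, where the
    kernel begins; the midpoint is both.\<close>
  define R' where "R' = (R + (norm x - 1)) / 2"
  have R': "R < R'" "norm x > R' + 1" unfolding R'_def using assms(3) by argo+
  have "conv u \<eta> x = conv (cut R' v) \<eta> x"
  proof (rule conv_cong_AE)
    show "AE y in lebesgue. u y * \<eta> (x - y) = cut R' v y * \<eta> (x - y)"
      using assms(1)
    proof eventually_elim
      case (elim y)
      show ?case
      proof (cases "norm y \<ge> R'")
        case False
        then have "norm (x - y) > 1" using R' norm_triangle_ineq2[of x y] by linarith
        then show ?thesis by (simp add: assms(2))
      qed (use elim R' in \<open>auto simp: cut_def\<close>)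
    qed
  qed (use assms locL2_measurable locL2_cut[OF C1_outside_continuous[OF assms(6)] R'(1)] in auto)
  also have "\<dots> = conv v \<eta> x" by (rule conv_cut[OF assms(2) R'(2)])
  finally show ?thesis .
qed

text \<open>Far out the gradient of the mollification is the mollification of the classical
  gradient, and therefore converges in L2 there.\<close>

lemma mollify_partial_outside:
  assumes u: "locL2 u" "AE y in lebesgue. norm y > R \<longrightarrow> u y = v y" "C1_outside R v"
    and x: "R < R'" "norm x > R' + 1"
  shows "partial_deriv i (mollify m u) x = mollify m (cut R' (partial_deriv i v)) x"
proof -
  let ?\<eta> = "\<lambda>z. complex_of_real (mollifier m z)"
  have s: "smooth ?\<eta>" by (intro smooth_of_real mollifier_smooth)
  have z: "?\<eta> z = 0" if "norm z > 1" for z using mollifier_support1[OF that] by simp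
  have z': "partial_deriv i ?\<eta> z = 0" if "norm z > 1" for z by (rule partial_deriv_support[OF z that])
  have x': "norm x > R + 1" using x by simp
  have "partial_deriv i (mollify m u) x = conv u (partial_deriv i ?\<eta>) x"
    unfolding mollify_def by (simp add: conv_partial[OF u(1) test_function_mollifier])
  also have "\<dots> = conv v (partial_deriv i ?\<eta>) x"
    by (rule conv_cut_AE[OF u(2) z' x' u(1) _ u(3)]) (auto intro: smooth_continuous smooth_partial s)
  also have "\<dots> = conv (partial_deriv i v) ?\<eta> x"
    by (rule conv_partial_outside[OF u(3) s z x'])
  also have "\<dots> = mollify m (cut R' (partial_deriv i v)) x"
    unfolding mollify_def by (rule conv_cut[OF z x(2), symmetric])
  finally show ?thesis .
qed

text \<open>In the imaginary part of Green's identity the squared gradient disappears, and the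
  remaining gradient occurs only where \<psi> varies. There it is the mollification of a classical
  derivative, so every term has a limit.\<close>

lemma flux_identity:
  assumes w: "weak_lap u q" and v: "AE y in lebesgue. norm y > R \<longrightarrow> u y = v y" "C1_outside R v"
    and \<psi>: "Ck_on (Suc 0) UNIV \<psi>" "\<And>x. norm x > r \<Longrightarrow> \<psi> x = 0"
    and R': "R < R'" and z: "\<And>i x. norm x \<le> R' + 1 \<Longrightarrow> partial_deriv i \<psi> x = 0"
  shows "Im (LINT x|lebesgue. q x * cnj (u x) * complex_of_real (\<psi> x)) =
     - (LINT x|lebesgue. (\<Sum>i\<in>UNIV. partial_deriv i \<psi> x * Im (cnj (v x) * partial_deriv i v x)))"
    and "integrable lebesgue (\<lambda>x. \<Sum>i\<in>UNIV. partial_deriv i \<psi> x * Im (cnj (v x) * partial_deriv i v x))"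
proof -
  have l: "locL2 u" "locL2 q" using w by (auto simp: weak_lap_def)
  note \<psi>c = Ck_on_Suc0_continuous[OF \<psi>(1)]
  let ?P = "\<lambda>i. cut R' (partial_deriv i v)"
  have lP: "locL2 (?P i)" for i
    by (rule locL2_cut[OF _ R']) (use v(2) in \<open>auto simp: C1_outside_def\<close>)
  have z\<psi>: "partial_deriv i \<psi> x = 0" if "norm x > r" for i x by (rule partial_deriv_support[OF \<psi>(2) that])
  let ?b = "\<lambda>i x. complex_of_real (partial_deriv i \<psi> x)"
  have lim1: "(\<lambda>m. Im (LINT x|lebesgue. laplacian (mollify m u) x * cnj (mollify m u x) * complex_of_real (\<psi> x)))
      \<longlonglongrightarrow> Im (LINT x|lebesgue. q x * cnj (u x) * complex_of_real (\<psi> x))"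
    unfolding weak_lap_mollify[OF w]
    by (intro tendsto_Im continuous_support_times_limit[where r = r] mollify_converges L2conv_cnj l \<psi> \<psi>c)
  have eq: "Im (LINT x|lebesgue. laplacian (mollify m u) x * cnj (mollify m u x) * complex_of_real (\<psi> x)) =
      - (\<Sum>i\<in>UNIV. Im (LINT x|lebesgue. cnj (mollify m u x) * mollify m (?P i) x * ?b i x))" for m
  proof -
    have "cnj (mollify m u x) * partial_deriv i (mollify m u) x * ?b i x = cnj (mollify m u x) * mollify m (?P i) x * ?b i x" for i x
      by (cases "norm x \<le> R' + 1")
         (auto simp: z mollify_partial_outside[OF l(1) v R'])
    then show ?thesis by (simp only: green_identity[OF mollify_smooth[OF l(1)] \<psi>]) (simp add: Im_sum)
  qed
  have lim2: "(\<lambda>m. - (\<Sum>i\<in>UNIV. Im (LINT x|lebesgue. cnj (mollify m u x) * mollify m (?P i) x * ?b i x)))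
     \<longlonglongrightarrow> - (\<Sum>i\<in>UNIV. Im (LINT x|lebesgue. cnj (u x) * ?P i x * ?b i x))"
    by (intro tendsto_minus tendsto_sum tendsto_Im continuous_support_times_limit[where r = r]
        mollify_converges L2conv_cnj l lP z\<psi> \<psi>c)
  have "Im (LINT x|lebesgue. q x * cnj (u x) * complex_of_real (\<psi> x)) = - (\<Sum>i\<in>UNIV. Im (LINT x|lebesgue. cnj (u x) * ?P i x * ?b i x))"
    using LIMSEQ_unique[OF lim1[unfolded eq] lim2] .
  moreover have i: "integrable lebesgue (\<lambda>x. cnj (u x) * ?P i x * ?b i x)" for i
  proof -
    obtain B where B: "\<And>x. norm (partial_deriv i \<psi> x) \<le> B"
      by (rule continuous_support_bounded[OF \<psi>c(2)[of i] z\<psi>]) auto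
    show ?thesis
      by (rule locL2_integrable_product[where B = B and r = r, OF locL2_cnj[OF l(1)] lP])
         (use B z\<psi> in \<open>auto intro!: continuous_borel_lebesgue continuous_intros \<psi>c\<close>)
  qed
  have lv: "locL2 (cut R' v)" by (rule locL2_cut[OF C1_outside_continuous[OF v(2)] R'])
  have vb: "cnj (cut R' v x) * ?P i x * ?b i x = cnj (v x) * partial_deriv i v x * ?b i x" for i x
    using z[of x i] by (auto simp: cut_def)
  have ae: "AE x in lebesgue. cnj (u x) * ?P i x * ?b i x = cnj (cut R' v x) * ?P i x * ?b i x" for i
    using v(1) by eventually_elim (use R' in \<open>auto simp: cut_def\<close>)
  have bm: "?b i \<in> borel_measurable lebesgue" for i
    by (intro continuous_borel_lebesgue continuous_intros \<psi>c)
  have m1: "(\<lambda>x. cnj (u x) * ?P i x * ?b i x) \<in> borel_measurable lebesgue"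
    "(\<lambda>x. cnj (cut R' v x) * ?P i x * ?b i x) \<in> borel_measurable lebesgue" for i
    by (intro borel_measurable_times bm locL2_measurable locL2_cnj l lP lv)+
  have i': "integrable lebesgue (\<lambda>x. cnj (v x) * partial_deriv i v x * ?b i x)" for i
    using integrable_cong_AE[OF m1 ae] i[of i] unfolding vb by blast
  moreover have "(LINT x|lebesgue. cnj (u x) * ?P i x * ?b i x) = (LINT x|lebesgue. cnj (v x) * partial_deriv i v x * ?b i x)" for i
    using integral_cong_AE[OF m1 ae] unfolding vb .
  moreover have im: "Im (cnj (v x) * partial_deriv i v x * ?b i x) = partial_deriv i \<psi> x * Im (cnj (v x) * partial_deriv i v x)" for i x
    by simp
  have ii: "integrable lebesgue (\<lambda>x. partial_deriv i \<psi> x * Im (cnj (v x) * partial_deriv i v x))" for i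
    using integrable_Im[OF i'[of i]] unfolding im .
  have li: "(LINT x|lebesgue. partial_deriv i \<psi> x * Im (cnj (v x) * partial_deriv i v x)) = Im (LINT x|lebesgue. cnj (v x) * partial_deriv i v x * ?b i x)" for i
    using integral_Im[OF i'[of i]] unfolding im .
  show "integrable lebesgue (\<lambda>x. \<Sum>i\<in>UNIV. partial_deriv i \<psi> x * Im (cnj (v x) * partial_deriv i v x))"
    by (intro Bochner_Integration.integrable_sum ii)
  have "(LINT x|lebesgue. (\<Sum>i\<in>UNIV. partial_deriv i \<psi> x * Im (cnj (v x) * partial_deriv i v x))) =
     (\<Sum>i\<in>UNIV. LINT x|lebesgue. partial_deriv i \<psi> x * Im (cnj (v x) * partial_deriv i v x))"
    by (rule Bochner_Integration.integral_sum[OF ii])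
  ultimately show "Im (LINT x|lebesgue. q x * cnj (u x) * complex_of_real (\<psi> x)) =
     - (LINT x|lebesgue. (\<Sum>i\<in>UNIV. partial_deriv i \<psi> x * Im (cnj (v x) * partial_deriv i v x)))"
    unfolding li by simp
qed

subsection \<open>Cutoffs and the radiation condition\<close>

text \<open>A continuously differentiable function that vanishes on a half-line; composed with
  itself it yields a cutoff with one continuous derivative and explicit constants.\<close>

definition pos_square :: "real \<Rightarrow> real" where "pos_square t = (max 0 t)\<^sup>2"

lemma pos_square_deriv: "(pos_square has_real_derivative 2 * max 0 t) (at t)"
proof -
  consider "t > 0" | "t < 0" | "t = 0" by linarith
  then show ?thesis
  proof cases
    case 1
    have "((\<lambda>t. t\<^sup>2) has_real_derivative 2 * max 0 t) (at t)"
      using 1 by (auto intro!: derivative_eq_intros)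
    then show ?thesis
      by (rule has_field_derivative_transform_within_open[of _ _ _ "{0<..}"]) (use 1 in \<open>auto simp: pos_square_def\<close>)
  next
    case 2
    have "((\<lambda>t. 0) has_real_derivative 2 * max 0 t) (at t)"
      using 2 by auto
    then show ?thesis
      by (rule has_field_derivative_transform_within_open[of _ _ _ "{..<0}"]) (use 2 in \<open>auto simp: pos_square_def\<close>)
  next
    case 3
    have "((\<lambda>h. (pos_square (0 + h) - pos_square 0) / h) \<longlongrightarrow> 0) (at 0)"
    proof (rule tendsto_0_le[where K = 1 and f = "\<lambda>h::real. h"])
      show "\<forall>\<^sub>F h in at 0. norm ((pos_square (0 + h) - pos_square 0) / h) \<le> norm h * 1"
        by (intro eventuallyI) (auto simp: pos_square_def max_def power2_eq_square)
    qed (auto intro!: tendsto_eq_intros)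
    then show ?thesis using 3 by (simp add: DERIV_def)
  qed
qed

text \<open>The argument of the profile is \<open>\<bar>x\<bar>\<^sup>2 / R\<^sup>2\<close>. The constants make the slope positive on \<open>[1, 4]\<close>, that is for
  \<open>R \<le> \<bar>x\<bar> \<le> 2 R\<close>, and squaring makes it bounded by the root of the profile, as the Caccioppoli
  estimate requires.\<close>

definition cutoff_profile :: "real \<Rightarrow> real" where
  "cutoff_profile t = pos_square (1 - pos_square (t - 1/2) / 25)"

definition cutoff_slope :: "real \<Rightarrow> real" where
  "cutoff_slope t = 4 / 25 * max 0 (1 - pos_square (t - 1/2) / 25) * max 0 (t - 1/2)"

lemma cutoff_profile_deriv: "(cutoff_profile has_real_derivative - cutoff_slope t) (at t)"
proof -
  have "((\<lambda>t. 1 - pos_square (t - 1/2) / 25) has_real_derivative - (2 * max 0 (t - 1/2) / 25)) (at t)"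
    by (auto intro!: derivative_eq_intros DERIV_chain2[OF pos_square_deriv])
  from DERIV_chain2[OF pos_square_deriv this] show ?thesis
    by (simp add: cutoff_profile_def[abs_def] cutoff_slope_def mult_ac)
qed

lemma cutoff_slope_continuous: "continuous_on S cutoff_slope"
  unfolding cutoff_slope_def[abs_def] pos_square_def by (intro continuous_intros) auto

lemma pos_square_nonneg: "pos_square t \<ge> 0" by (simp add: pos_square_def)

lemma cutoff_profile_bounds: "0 \<le> cutoff_profile t" "cutoff_profile t \<le> 1"
proof -
  have "max 0 (1 - pos_square (t - 1/2) / 25) \<le> 1" using pos_square_nonneg by simp
  then show "cutoff_profile t \<le> 1" unfolding cutoff_profile_def pos_square_def[of "1 - _"]
    by (simp add: power_le_one)
qed (simp add: cutoff_profile_def pos_square_nonneg)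

lemma cutoff_profile_one: "t \<le> 1/2 \<Longrightarrow> cutoff_profile t = 1"
  by (simp add: cutoff_profile_def pos_square_def)

text \<open>The threshold is \<open>1/2 + 5\<close>, the point where the squared distance from
  \<open>1/2\<close> reaches 25.\<close>

lemma cutoff_inner_zero: "t \<ge> 11/2 \<Longrightarrow> max 0 (1 - pos_square (t - 1/2) / 25) = 0"
proof -
  assume "t \<ge> 11/2"
  then have "5\<^sup>2 \<le> (t - 1/2)\<^sup>2" by (intro power_mono) auto
  then show ?thesis using \<open>t \<ge> 11/2\<close> by (simp add: pos_square_def max_def)
qed

lemma cutoff_profile_zero: "t \<ge> 11/2 \<Longrightarrow> cutoff_profile t = 0"
  using cutoff_inner_zero[of t] by (simp add: cutoff_profile_def pos_square_def[of "1 - _"])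

lemma cutoff_slope_zero: "t \<le> 1/2 \<or> t \<ge> 11/2 \<Longrightarrow> cutoff_slope t = 0"
  using cutoff_inner_zero[of t] by (auto simp: cutoff_slope_def)

text \<open>The square of the slope is the profile times the square of
  \<open>4 / 25 * max 0 (t - 1/2)\<close>. Where the slope is nonzero, this factor is at most 4/25
  times 5, hence below 1.\<close>

lemma cutoff_slope_bounds: "0 \<le> cutoff_slope t" "(cutoff_slope t)\<^sup>2 \<le> cutoff_profile t" "cutoff_slope t \<le> 1"
proof -
  show "0 \<le> cutoff_slope t" by (simp add: cutoff_slope_def)
  show *: "(cutoff_slope t)\<^sup>2 \<le> cutoff_profile t"
  proof (cases "t \<le> 1/2 \<or> t \<ge> 11/2")
    case True
    then show ?thesis using cutoff_slope_zero cutoff_profile_bounds by simp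
  next
    case False
    then have "4 / 25 * max 0 (t - 1/2) \<le> 1" by (simp add: max_def)
    then have "(4 / 25 * max 0 (t - 1/2))\<^sup>2 \<le> 1" by (simp add: power_le_one)
    then have "(max 0 (1 - pos_square (t - 1/2) / 25))\<^sup>2 * (4 / 25 * max 0 (t - 1/2))\<^sup>2 \<le> (max 0 (1 - pos_square (t - 1/2) / 25))\<^sup>2 * 1"
      by (intro mult_left_mono) auto
    moreover have "(cutoff_slope t)\<^sup>2 = (max 0 (1 - pos_square (t - 1/2) / 25))\<^sup>2 * (4 / 25 * max 0 (t - 1/2))\<^sup>2"
      unfolding cutoff_slope_def power_mult_distrib[symmetric] by (simp only: mult_ac)
    ultimately show ?thesis by (simp only: cutoff_profile_def pos_square_def[of "1 - _"] mult_1_right)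
  qed
  have "(cutoff_slope t)\<^sup>2 \<le> 1\<^sup>2" using * cutoff_profile_bounds(2)[of t] by simp
  then show "cutoff_slope t \<le> 1" by (rule power2_le_imp_le) simp
qed

text \<open>On this interval the inner square is at most 49/4, which leaves 1 - 49/100 = 51/100 in
  the first factor; then 4/25 times 51/100 times 1/2 is 0.0408, just above 1/25.\<close>

lemma cutoff_slope_lower: "1 \<le> t \<Longrightarrow> t \<le> 4 \<Longrightarrow> cutoff_slope t \<ge> 1 / 25"
proof -
  assume t: "1 \<le> t" "t \<le> 4"
  have "(t - 1/2)\<^sup>2 \<le> (7/2)\<^sup>2" using t by (intro power_mono) auto
  then have 1: "1 - pos_square (t - 1/2) / 25 \<ge> 51 / 100"
    using t by (simp add: pos_square_def max_def power2_eq_square)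
  have "4 / 25 * (51 / 100) * (1/2) \<le> 4 / 25 * max 0 (1 - pos_square (t - 1/2) / 25) * max 0 (t - 1/2)"
    using 1 t by (intro mult_mono) auto
  then show ?thesis unfolding cutoff_slope_def by linarith
qed

section \<open>The radial cutoff in the plane\<close>

definition cutoff :: "real \<Rightarrow> real^2 \<Rightarrow> real" where
  "cutoff R x = cutoff_profile (x \<bullet> x / R\<^sup>2)"

text \<open>Minus the radial derivative of \<open>cutoff R\<close>. Integration against this density
  takes the place of integrals over circles.\<close>

definition weight :: "real \<Rightarrow> real^2 \<Rightarrow> real" where
  "weight R x = cutoff_slope (x \<bullet> x / R\<^sup>2) * (2 * norm x / R\<^sup>2)"

lemma cutoff_has_derivative:
  "(cutoff R has_derivative (\<lambda>h. - cutoff_slope (x \<bullet> x / R\<^sup>2) * (2 * (x \<bullet> h) / R\<^sup>2))) (at x)"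
proof -
  have "((\<lambda>x::real^2. (x \<bullet> x) * c) has_derivative (\<lambda>h. 2 * (x \<bullet> h) * c)) (at x)" for c
    by (auto intro!: derivative_eq_intros simp: inner_commute)
  from this[of "1 / R\<^sup>2"] have "((\<lambda>x::real^2. x \<bullet> x / R\<^sup>2) has_derivative (\<lambda>h. 2 * (x \<bullet> h) / R\<^sup>2)) (at x)" by simp
  from DERIV_compose_FDERIV[OF cutoff_profile_deriv this] show ?thesis
    by (simp add: cutoff_def[abs_def] mult_ac)
qed

lemma cutoff_partial: "partial_deriv i (cutoff R) x = - cutoff_slope (x \<bullet> x / R\<^sup>2) * (2 * x $ i / R\<^sup>2)"
  by (subst partial_deriv_eq[OF cutoff_has_derivative]) (simp add: inner_axis)

lemma cutoff_C1: "Ck_on (Suc 0) UNIV (cutoff R)"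
proof -
  have "cutoff R differentiable (at x)" for x
    using cutoff_has_derivative differentiable_def by blast
  moreover have "continuous_on UNIV (partial_deriv i (cutoff R))" for i
    unfolding cutoff_partial[abs_def] divide_inverse
    by (intro continuous_intros continuous_on_compose2[OF cutoff_slope_continuous]) auto
  ultimately show ?thesis by (auto simp: differentiable_on_def)
qed

text \<open>The thresholds of the profile are translated into radii: the support radius
  \<open>3 * R\<close> works because 9 exceeds 11/2, the plateau radius \<open>R / 2\<close> because
  1/4 is below 1/2.\<close>

lemma norm_square_ratio:
  fixes x :: "real^2"
  assumes "R > 0"
  shows "norm x > 3 * R \<Longrightarrow> x \<bullet> x / R\<^sup>2 \<ge> 11/2" "norm x \<le> R / 2 \<Longrightarrow> x \<bullet> x / R\<^sup>2 \<le> 1/2"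
    "R \<le> norm x \<Longrightarrow> norm x \<le> 2 * R \<Longrightarrow> 1 \<le> x \<bullet> x / R\<^sup>2" "R \<le> norm x \<Longrightarrow> norm x \<le> 2 * R \<Longrightarrow> x \<bullet> x / R\<^sup>2 \<le> 4"
proof -
  have e: "x \<bullet> x / R\<^sup>2 = (norm x / R)\<^sup>2" by (simp add: power_divide power2_norm_eq_inner)
  show "x \<bullet> x / R\<^sup>2 \<ge> 11/2" if "norm x > 3 * R"
  proof -
    have "3\<^sup>2 \<le> (norm x / R)\<^sup>2" using that assms by (intro power_mono) (auto simp: field_simps)
    then show ?thesis unfolding e by simp
  qed
  show "x \<bullet> x / R\<^sup>2 \<le> 1/2" if "norm x \<le> R / 2"
  proof -
    have "(norm x / R)\<^sup>2 \<le> (1/2)\<^sup>2" using that assms by (intro power_mono) (auto simp: field_simps)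
    moreover have "(1/2)\<^sup>2 = (1/4 :: real)" by (simp add: power2_eq_square)
    ultimately show ?thesis unfolding e by linarith
  qed
  show "1 \<le> x \<bullet> x / R\<^sup>2" if "R \<le> norm x"
  proof -
    have "1\<^sup>2 \<le> (norm x / R)\<^sup>2" using that assms by (intro power_mono) (auto simp: field_simps)
    then show ?thesis unfolding e by simp
  qed
  show "x \<bullet> x / R\<^sup>2 \<le> 4" if "norm x \<le> 2 * R"
  proof -
    have "(norm x / R)\<^sup>2 \<le> 2\<^sup>2" using that assms by (intro power_mono) (auto simp: field_simps)
    then show ?thesis unfolding e by simp
  qed
qed

lemma cutoff_bounds: "0 \<le> cutoff R x" "cutoff R x \<le> 1"
  by (simp_all add: cutoff_def cutoff_profile_bounds)

lemma cutoff_support: "R > 0 \<Longrightarrow> norm x > 3 * R \<Longrightarrow> cutoff R x = 0"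
  unfolding cutoff_def by (rule cutoff_profile_zero[OF norm_square_ratio(1)])

lemma cutoff_one: "R > 0 \<Longrightarrow> norm x \<le> R / 2 \<Longrightarrow> cutoff R x = 1"
  unfolding cutoff_def by (rule cutoff_profile_one[OF norm_square_ratio(2)])

lemma cutoff_partial_inner: "R > 0 \<Longrightarrow> norm x \<le> R / 2 \<Longrightarrow> partial_deriv i (cutoff R) x = 0"
  using cutoff_slope_zero norm_square_ratio(2) by (simp add: cutoff_partial)

text \<open>The hypothesis of the Caccioppoli estimate with \<open>c = 9 / R\<^sup>2\<close>. The
  squared slope is at most the profile, and on the support the inner derivative is at most
  \<open>6 / R\<close>.\<close>

lemma cutoff_partial_square:
  assumes "R > 0"
  shows "(partial_deriv i (cutoff R) x)\<^sup>2 \<le> 4 * (9 / R\<^sup>2) * cutoff R x"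
proof (cases "norm x > 3 * R")
  case True
  then show ?thesis using partial_deriv_support[OF cutoff_support[OF assms] True] cutoff_bounds by simp
next
  case False
  have "\<bar>x $ i\<bar> \<le> 3 * R" using component_le_norm_cart[of x i] False by linarith
  then have "(2 * x $ i / R\<^sup>2)\<^sup>2 \<le> 4 * (9 / R\<^sup>2)"
  proof -
    have "(x $ i)\<^sup>2 \<le> (3 * R)\<^sup>2" using \<open>\<bar>x $ i\<bar> \<le> 3 * R\<close> by (metis abs_ge_zero power2_abs power_mono)
    then have "4 * (x $ i)\<^sup>2 / (R\<^sup>2 * R\<^sup>2) \<le> 4 * (9 * R\<^sup>2) / (R\<^sup>2 * R\<^sup>2)"
      by (intro divide_right_mono) (auto simp: power_mult_distrib)
    then show ?thesis using assms by (simp add: power_divide power_mult_distrib power2_eq_square)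
  qed
  then have "(cutoff_slope (x \<bullet> x / R\<^sup>2))\<^sup>2 * (2 * x $ i / R\<^sup>2)\<^sup>2 \<le> cutoff R x * (4 * (9 / R\<^sup>2))"
    unfolding cutoff_def by (intro mult_mono cutoff_slope_bounds cutoff_profile_bounds) auto
  moreover have "(partial_deriv i (cutoff R) x)\<^sup>2 = (cutoff_slope (x \<bullet> x / R\<^sup>2))\<^sup>2 * (2 * x $ i / R\<^sup>2)\<^sup>2"
    by (simp only: cutoff_partial mult_minus_left power2_minus power_mult_distrib)
  ultimately show ?thesis by (simp only: mult.commute[of "cutoff R x"])
qed

lemma weight_nonneg: "0 \<le> weight R x"
  by (simp add: weight_def cutoff_slope_bounds)

lemma weight_zero: "R > 0 \<Longrightarrow> norm x \<le> R / 2 \<or> norm x > 3 * R \<Longrightarrow> weight R x = 0"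
  using cutoff_slope_zero norm_square_ratio(1,2)[of R x] by (auto simp: weight_def)

lemma weight_upper: assumes "R > 0" shows "weight R x \<le> 6 / R"
proof (cases "norm x > 3 * R")
  case True
  then show ?thesis using assms by (simp add: weight_zero)
next
  case False
  have "weight R x \<le> 1 * (2 * (3 * R) / R\<^sup>2)"
    unfolding weight_def using False
    by (intro mult_mono cutoff_slope_bounds divide_right_mono) auto
  also have "\<dots> = 6 / R" using assms by (simp add: power2_eq_square)
  finally show ?thesis .
qed

lemma weight_lower:
  assumes "R > 0" "R \<le> norm x" "norm x \<le> 2 * R" shows "2 / (25 * R) \<le> weight R x"
proof -
  have "2 / (25 * R) = (1 / 25) * (2 * R / R\<^sup>2)" using assms(1) by (simp add: power2_eq_square)
  also have "\<dots> \<le> weight R x"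
    unfolding weight_def using assms
    by (intro mult_mono cutoff_slope_lower norm_square_ratio divide_right_mono cutoff_slope_bounds) auto
  finally show ?thesis .
qed

lemma weight_continuous: "continuous_on UNIV (weight R)"
  unfolding weight_def[abs_def] divide_inverse
  by (intro continuous_intros continuous_on_compose2[OF cutoff_slope_continuous]) auto

section \<open>Means over annuli and growth on balls\<close>

definition weighted_int :: "real \<Rightarrow> (real^2 \<Rightarrow> complex) \<Rightarrow> real" where
  "weighted_int R u = (LINT x|lebesgue. weight R x * (norm (u x))\<^sup>2)"

lemma weighted_integrable:
  assumes "locL2 u" "R > 0"
  shows "integrable lebesgue (\<lambda>x. weight R x * (norm (u x))\<^sup>2)"
proof (rule Bochner_Integration.integrable_bound)
  have [measurable]: "u \<in> borel_measurable lebesgue" "weight R \<in> borel_measurable lebesgue"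
    using locL2_measurable[OF assms(1)] continuous_borel_lebesgue[OF weight_continuous] by auto
  show "(\<lambda>x. weight R x * (norm (u x))\<^sup>2) \<in> borel_measurable lebesgue" by measurable
  show "integrable lebesgue (\<lambda>x. 6 / R * (indicator (cball 0 (3 * R)) x * (norm (u x))\<^sup>2))"
    by (intro integrable_mult_right ball_int_norm2_integrable assms)
  show "AE x in lebesgue. norm (weight R x * (norm (u x))\<^sup>2) \<le> norm (6 / R * (indicator (cball 0 (3 * R)) x * (norm (u x))\<^sup>2))"
  proof (rule AE_I2)
    fix x
    show "norm (weight R x * (norm (u x))\<^sup>2) \<le> norm (6 / R * (indicator (cball 0 (3 * R)) x * (norm (u x))\<^sup>2))"
      using weight_zero[OF assms(2), of x] mult_right_mono[OF weight_upper[OF assms(2), of x], of "(norm (u x))\<^sup>2"]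
        weight_nonneg[of R x] assms(2)
      by (cases "norm x > 3 * R") (auto simp: abs_mult)
  qed
qed

lemma weighted_int_nonneg: "0 \<le> weighted_int R u"
  unfolding weighted_int_def by (intro integral_nonneg_AE) (simp add: weight_nonneg)

lemma weighted_int_le:
  assumes "locL2 u" "R > 0"
  shows "weighted_int R u \<le> 6 / R * ball_int (3 * R) (\<lambda>x. (norm (u x))\<^sup>2)"
proof -
  have "weighted_int R u \<le> (LINT x|lebesgue. 6 / R * (indicator (cball 0 (3 * R)) x * (norm (u x))\<^sup>2))"
    unfolding weighted_int_def
  proof (rule integral_mono)
    show "weight R x * (norm (u x))\<^sup>2 \<le> 6 / R * (indicator (cball 0 (3 * R)) x * (norm (u x))\<^sup>2)" for x
      using weight_zero[OF assms(2), of x] mult_right_mono[OF weight_upper[OF assms(2), of x], of "(norm (u x))\<^sup>2"]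
      by (cases "norm x > 3 * R") auto
  qed (intro weighted_integrable integrable_mult_right ball_int_norm2_integrable assms)+
  then show ?thesis by (simp add: ball_int_def)
qed

text \<open>On the annulus between \<open>R\<close> and \<open>2 * R\<close> the weight is at least
  \<open>2 / (25 * R)\<close>, so multiplication by \<open>25 / 2 * R\<close> dominates the
  indicator of the annulus.\<close>

lemma ball_int_doubling:
  assumes "locL2 u" "R > 0"
  shows "ball_int (2 * R) (\<lambda>x. (norm (u x))\<^sup>2) \<le> ball_int R (\<lambda>x. (norm (u x))\<^sup>2) + 25 / 2 * R * weighted_int R u"
proof -
  have i: "integrable lebesgue (\<lambda>x. 25 / 2 * R * (weight R x * (norm (u x))\<^sup>2))"
    "integrable lebesgue (\<lambda>x. indicator (cball 0 R) x * (norm (u x))\<^sup>2)"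
    by (intro weighted_integrable integrable_mult_right ball_int_norm2_integrable assms)+
  have "ball_int (2 * R) (\<lambda>x. (norm (u x))\<^sup>2) \<le>
     (LINT x|lebesgue. indicator (cball 0 R) x * (norm (u x))\<^sup>2 + 25 / 2 * R * (weight R x * (norm (u x))\<^sup>2))"
    unfolding ball_int_def
  proof (rule integral_mono)
    fix x
    have "1 \<le> 25 / 2 * R * weight R x" if "norm x > R" "norm x \<le> 2 * R"
      using weight_lower[OF assms(2), of x] that assms(2) by (simp add: field_simps)
    then have "1 * (norm (u x))\<^sup>2 \<le> 25 / 2 * R * weight R x * (norm (u x))\<^sup>2" if "norm x > R" "norm x \<le> 2 * R"
      using that by (intro mult_right_mono) auto
    moreover have "0 \<le> 25 / 2 * R * (weight R x * (norm (u x))\<^sup>2)" using assms(2) by (simp add: weight_nonneg)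
    ultimately show "indicator (cball 0 (2 * R)) x * (norm (u x))\<^sup>2 \<le>
       indicator (cball 0 R) x * (norm (u x))\<^sup>2 + 25 / 2 * R * (weight R x * (norm (u x))\<^sup>2)"
      by (cases "norm x \<le> R"; cases "norm x \<le> 2 * R") (auto simp: mult.assoc)
  qed (use i in \<open>auto intro!: Bochner_Integration.integrable_add ball_int_norm2_integrable assms\<close>)
  also have "\<dots> = ball_int R (\<lambda>x. (norm (u x))\<^sup>2) + 25 / 2 * R * weighted_int R u"
    unfolding ball_int_def weighted_int_def using i by simp
  finally show ?thesis .
qed

text \<open>The radius is halved until it lies between \<open>R1\<close> and \<open>2 * R1\<close>.
  The increments L R / 2 + L R / 4 + ... sum to at most L R.\<close>

lemma doubling_linear_growth:
  fixes A :: "real \<Rightarrow> real"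
  assumes "mono A" "R1 > 0" "L \<ge> 0" "\<And>R. R \<ge> R1 \<Longrightarrow> A (2 * R) \<le> A R + L * R" "R \<ge> R1"
  shows "A R \<le> A (2 * R1) + L * R"
proof -
  have "\<forall>R. R1 \<le> R \<and> R \<le> 2 ^ Suc m * R1 \<longrightarrow> A R \<le> A (2 * R1) + L * R" for m
  proof (induction m)
    case 0
    have "A R \<le> A (2 * R1) + L * R" if "R1 \<le> R" "R \<le> 2 * R1" for R
    proof -
      have "A R \<le> A (2 * R1)" using assms(1) that by (auto dest: monoD)
      moreover have "0 \<le> L * R" using assms that by auto
      ultimately show ?thesis by simp
    qed
    then show ?case by simp
  next
    case (Suc m)
    show ?case
    proof (intro allI impI)
      fix R assume R: "R1 \<le> R \<and> R \<le> 2 ^ Suc (Suc m) * R1"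
      show "A R \<le> A (2 * R1) + L * R"
      proof (cases "R \<le> 2 * R1")
        case True
        have "(2::real) * 1 \<le> 2 * 2 ^ m" by (intro mult_left_mono) auto
        then have "2 * R1 \<le> 2 ^ Suc m * R1" using assms(2) by (intro mult_right_mono) auto
        then show ?thesis using Suc R True by auto
      next
        case False
        then have "R1 \<le> R / 2 \<and> R / 2 \<le> 2 ^ Suc m * R1" using R by simp
        then have "A (R / 2) \<le> A (2 * R1) + L * (R / 2)" using Suc.IH by blast
        moreover have "A R \<le> A (R / 2) + L * (R / 2)" using assms(4)[of "R / 2"] False by simp
        ultimately show ?thesis by simp
      qed
    qed
  qed
  moreover obtain m where "R / R1 < 2 ^ m" using real_arch_pow[of 2 "R / R1"] by auto
  then have "R \<le> 2 ^ m * R1" using assms(2) by (simp add: field_simps)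
  then have "R \<le> 2 ^ Suc m * R1" using assms(2,5) by simp
  ultimately show ?thesis using assms(5) by blast
qed

section \<open>The radiation condition and the flux\<close>

text \<open>The Sommerfeld condition squared and stated in the point \<open>x\<close> instead of
  polar coordinates, the form that enters the integrals.\<close>

definition radiating :: "real \<Rightarrow> (real^2 \<Rightarrow> complex) \<Rightarrow> bool" where
  "radiating k v \<longleftrightarrow> (\<forall>e>0. \<exists>R. \<forall>x. norm x \<ge> R \<longrightarrow>
     norm x * (norm (directional_deriv (sgn x) v x - \<i> * of_real k * v x))\<^sup>2 \<le> e)"

lemma sommerfeld_radiating:
  assumes "sommerfeld k v" shows "radiating k v"
  unfolding radiating_def
proof (intro allI impI)
  fix e :: real assume "e > 0"
  then have "sqrt e > 0" by simp
  then have "\<forall>\<^sub>F r in at_top. \<forall>\<xi>\<in>sphere (0::real^2) 1.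
      dist (of_real (sqrt r) * (directional_deriv \<xi> v (r *\<^sub>R \<xi>) - \<i> * of_real k * v (r *\<^sub>R \<xi>))) 0 < sqrt e"
    using assms unfolding sommerfeld_def uniform_limit_iff by blast
  then obtain R where R0: "\<forall>r\<ge>R. \<forall>\<xi>\<in>sphere (0::real^2) 1.
      dist (of_real (sqrt r) * (directional_deriv \<xi> v (r *\<^sub>R \<xi>) - \<i> * of_real k * v (r *\<^sub>R \<xi>))) 0 < sqrt e"
    unfolding eventually_at_top_linorder by blast
  have R: "norm (of_real (sqrt r) * (directional_deriv \<xi> v (r *\<^sub>R \<xi>) - \<i> * of_real k * v (r *\<^sub>R \<xi>))) < sqrt e"
    if "r \<ge> R" "norm (\<xi>::real^2) = 1" for r \<xi>
    using R0[rule_format, of r \<xi>] that by (simp add: dist_norm)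
  have "norm x * (norm (directional_deriv (sgn x) v x - \<i> * of_real k * v x))\<^sup>2 \<le> e" if x: "norm x \<ge> max R 1" for x
  proof -
    have nz: "x \<noteq> 0" using x by auto
    have "norm (of_real (sqrt (norm x)) * (directional_deriv (sgn x) v x - \<i> * of_real k * v x)) < sqrt e"
      using R[of "norm x" "sgn x"] x nz by (simp add: norm_sgn sgn_div_norm)
    then have "(sqrt (norm x) * norm (directional_deriv (sgn x) v x - \<i> * of_real k * v x))\<^sup>2 \<le> (sqrt e)\<^sup>2"
      by (intro power_mono) (auto simp: norm_mult)
    then show ?thesis using \<open>e > 0\<close> by (simp add: power_mult_distrib)
  qed
  then show "\<exists>R. \<forall>x. norm x \<ge> R \<longrightarrow> norm x * (norm (directional_deriv (sgn x) v x - \<i> * of_real k * v x))\<^sup>2 \<le> e" by blast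
qed

text \<open>The quadratic growth of the area cancels the factor \<open>1 / R\<^sup>2\<close> of the
  error density in the flux estimate.\<close>

lemma cball_int_one: "r \<ge> 0 \<Longrightarrow> ball_int r (\<lambda>_. 1) = r\<^sup>2 * ball_int 1 (\<lambda>_. 1)"
proof -
  have 1: "ball_int s (\<lambda>_. 1) = measure lebesgue (ball (0::real^2) s)" for s
    using content_cball_conv_ball[of "0::real^2" s] by (simp add: ball_int_def)
  assume "r \<ge> 0"
  then show ?thesis unfolding 1 using content_ball_conv_unit_ball[of r "0::real^2"] by simp
qed

lemma radial_flux:
  assumes "v differentiable (at x)"
  shows "(\<Sum>i\<in>UNIV. partial_deriv i (cutoff R) x * Im (cnj (v x) * partial_deriv i v x))
    = - (weight R x * Im (cnj (v x) * directional_deriv (sgn x) v x))"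
proof (cases "x = 0")
  case True
  then show ?thesis by (simp add: cutoff_partial weight_def)
next
  case False
  have "Im (cnj (v x) * directional_deriv (sgn x) v x) = (\<Sum>i\<in>UNIV. (sgn x $ i) * Im (cnj (v x) * partial_deriv i v x))"
    by (simp add: directional_deriv_partial[OF assms] sum_distrib_left Im_sum algebra_simps)
  also have "weight R x * \<dots> = (\<Sum>i\<in>UNIV. cutoff_slope (x \<bullet> x / R\<^sup>2) * (2 * x $ i / R\<^sup>2) * Im (cnj (v x) * partial_deriv i v x))"
    unfolding weight_def sum_distrib_left using False
    by (intro sum.cong refl) (simp add: sgn_div_norm)
  finally show ?thesis by (simp add: cutoff_partial sum_negf[symmetric])
qed

text \<open>Replacing the radial derivative by \<open>\<i> * k * v + z\<close> gives the flux
  density \<open>k\<close> times the squared modulus plus the imaginary part of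
  \<open>cnj v * z\<close>. The last term is at most half of the first plus an error quadratic in
  \<open>z\<close>, so the flux lies between k/2 and 3k/2 times the weighted integral, up to that
  error.\<close>

lemma radiation_flux:
  assumes k: "k > 0" and w: "weak_lap u q" and v: "AE y in lebesgue. norm y > R0 \<longrightarrow> u y = v y" "C1_outside R0 v"
    and rad: "radiating k v" and e: "e > 0" and R0: "R0 > 0"
  shows "\<exists>R1>0. \<forall>R\<ge>R1.
      k / 2 * weighted_int R u \<le> Im (LINT x|lebesgue. q x * cnj (u x) * complex_of_real (cutoff R x)) + e \<and>
      \<bar>Im (LINT x|lebesgue. q x * cnj (u x) * complex_of_real (cutoff R x))\<bar> \<le> 2 * k * weighted_int R u + e"
proof -
  define V where "V = ball_int 1 (\<lambda>_. 1)"
  have V: "V \<ge> 0" unfolding V_def by (intro ball_int_nonneg) simp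
  \<comment> \<open>The error density is \<open>6 * e' / (k * R\<^sup>2)\<close> on a disc of area
    \<open>9 * R\<^sup>2 * V\<close>, where \<open>V\<close> is the area of the unit disc. The total
    \<open>54 * e' * V / k\<close> is then at most \<open>e\<close>.\<close>
  define e' where "e' = e * k / (54 * (V + 1))"
  have e': "e' > 0" using e k V by (simp add: e'_def)
  obtain R2 where R2: "\<And>x. norm x \<ge> R2 \<Longrightarrow>
     norm x * (norm (directional_deriv (sgn x) v x - \<i> * of_real k * v x))\<^sup>2 \<le> e'"
    using rad e' unfolding radiating_def by blast
  \<comment> \<open>The cutoff is constant up to \<open>R / 2\<close>. This radius has to reach
    \<open>R0 + 2\<close>, one for the cut beyond \<open>R0\<close> and one for the kernel in
    \<open>flux_identity\<close>, and also \<open>R2\<close>, where the radiation estimate sets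
    in.\<close>
  define R1 where "R1 = max (2 * (R0 + 2)) (2 * R2)"
  have l: "locL2 u" using w by (simp add: weak_lap_def)
  have "k / 2 * weighted_int R u \<le> Im (LINT x|lebesgue. q x * cnj (u x) * complex_of_real (cutoff R x)) + e \<and>
      \<bar>Im (LINT x|lebesgue. q x * cnj (u x) * complex_of_real (cutoff R x))\<bar> \<le> 2 * k * weighted_int R u + e"
    if R: "R \<ge> R1" for R
  proof -
    have Rp: "R > 0" "R / 2 \<ge> R0 + 2" "R / 2 \<ge> R2" using R R0 by (auto simp: R1_def)
    let ?F = "\<lambda>x. \<Sum>i\<in>UNIV. partial_deriv i (cutoff R) x * Im (cnj (v x) * partial_deriv i v x)"
    have fl: "Im (LINT x|lebesgue. q x * cnj (u x) * complex_of_real (cutoff R x)) = - (LINT x|lebesgue. ?F x)"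
      "integrable lebesgue ?F"
      using flux_identity[OF w v cutoff_C1 cutoff_support[OF Rp(1)], where R' = "R0 + 1"]
        cutoff_partial_inner[OF Rp(1)] Rp(2) by (auto simp del: times_complex.sel)
    let ?E = "\<lambda>x::real^2. indicator (cball 0 (3 * R)) x * (6 * e' / (k * R\<^sup>2)) :: real"
    let ?W = "\<lambda>x. weight R x * (norm (u x))\<^sup>2"
    have iE: "integrable lebesgue ?E" by (rule indicator_ball_integrable)
    have iW: "integrable lebesgue ?W" by (rule weighted_integrable[OF l Rp(1)])
    have "(LINT x|lebesgue. ?E x) = 6 * e' / (k * R\<^sup>2) * ball_int (3 * R) (\<lambda>_. 1)"
      by (simp add: ball_int_def)
    also have "\<dots> = 54 * e' / k * V"
      using cball_int_one[of "3 * R"] Rp(1) by (simp add: V_def power_mult_distrib)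
    also have "54 * e' / k = e / (V + 1)" using k V by (simp add: e'_def divide_simps)
    also have "e / (V + 1) * V = e * (V / (V + 1))" by simp
    also have "\<dots> \<le> e * 1" using e V by (intro mult_left_mono) auto
    finally have E: "(LINT x|lebesgue. ?E x) \<le> e" by simp
    have pt: "k / 2 * ?W x - ?E x \<le> - ?F x \<and> \<bar>- ?F x\<bar> \<le> 2 * k * ?W x + ?E x"
      if uv: "norm x > R0 \<longrightarrow> u x = v x" for x
    proof (cases "norm x \<le> R / 2 \<or> norm x > 3 * R")
      case True
      then have F0: "?F x = 0" using cutoff_partial_inner[OF Rp(1)] partial_deriv_support[OF cutoff_support[OF Rp(1)]] by auto
      have W0: "?W x = 0" using weight_zero[OF Rp(1)] True by simp
      have "?E x \<ge> 0" using e' k by simp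
      then show ?thesis unfolding F0 W0 by linarith
    next
      case False
      then have x: "norm x > R0" "norm x \<ge> R2" "norm x > R / 2" "norm x \<le> 3 * R" using Rp by auto
      have uv: "u x = v x" using uv x by simp
      have vd: "v differentiable (at x)" using v(2) x(1) by (simp add: C1_outside_def)
      define z where "z = directional_deriv (sgn x) v x - \<i> * of_real k * v x"
      have dz: "directional_deriv (sgn x) v x = \<i> * of_real k * v x + z" by (simp add: z_def)
      have im: "Im (cnj (v x) * directional_deriv (sgn x) v x) = k * (norm (v x))\<^sup>2 + Im (cnj (v x) * z)"
        unfolding dz cmod_power2 by (simp add: power2_eq_square algebra_simps)
      have "\<bar>Im (cnj (v x) * z)\<bar> \<le> norm (v x) * norm z"
        using abs_Im_le_cmod[of "cnj (v x) * z"] by (simp only: norm_mult complex_mod_cnj)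
      also have "\<dots> \<le> k / 2 * (norm (v x))\<^sup>2 + (norm z)\<^sup>2 / (2 * k)"
      proof -
        have "0 \<le> (k * norm (v x) - norm z)\<^sup>2 / (2 * k)" using k by simp
        also have "\<dots> = k / 2 * (norm (v x))\<^sup>2 + (norm z)\<^sup>2 / (2 * k) - norm (v x) * norm z"
          using k by (simp add: power2_eq_square field_simps)
        finally show ?thesis by simp
      qed
      finally have c: "\<bar>Im (cnj (v x) * z)\<bar> \<le> k / 2 * (norm (v x))\<^sup>2 + (norm z)\<^sup>2 / (2 * k)" .
      have "R / 2 * (norm z)\<^sup>2 \<le> norm x * (norm z)\<^sup>2" using x by (intro mult_right_mono) auto
      then have "R / 2 * (norm z)\<^sup>2 \<le> e'" using R2[OF x(2)] by (simp add: z_def)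
      then have "(norm z)\<^sup>2 \<le> 2 * e' / R" using Rp(1) by (simp add: field_simps)
      then have "weight R x * ((norm z)\<^sup>2 / (2 * k)) \<le> (6 / R) * ((2 * e' / R) / (2 * k))"
        using weight_upper[OF Rp(1), of x] weight_nonneg[of R x] k Rp(1)
        by (intro mult_mono divide_right_mono) auto
      also have "\<dots> = 6 * e' / (k * R\<^sup>2)" by (simp add: power2_eq_square)
      finally have d: "weight R x * ((norm z)\<^sup>2 / (2 * k)) \<le> ?E x" using x by simp
      have f: "- ?F x = k * ?W x + weight R x * Im (cnj (v x) * z)"
        unfolding radial_flux[OF vd] im uv by (simp add: algebra_simps)
      have "\<bar>weight R x * Im (cnj (v x) * z)\<bar> \<le> weight R x * (k / 2 * (norm (v x))\<^sup>2 + (norm z)\<^sup>2 / (2 * k))"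
        using c weight_nonneg[of R x] by (simp add: abs_mult mult_left_mono)
      also have "\<dots> = k / 2 * ?W x + weight R x * ((norm z)\<^sup>2 / (2 * k))" by (simp add: uv algebra_simps)
      finally have g: "\<bar>weight R x * Im (cnj (v x) * z)\<bar> \<le> k / 2 * ?W x + ?E x" using d by linarith
      have "0 \<le> k * ?W x" using k weight_nonneg[of R x] by simp
      then show ?thesis using f g unfolding abs_le_iff by linarith
    qed
    have ae: "AE x in lebesgue. k / 2 * ?W x - ?E x \<le> - ?F x \<and> \<bar>- ?F x\<bar> \<le> 2 * k * ?W x + ?E x"
      using v(1) by eventually_elim (rule pt)
    have "(LINT x|lebesgue. k / 2 * ?W x - ?E x) \<le> (LINT x|lebesgue. - ?F x)"
      by (rule integral_mono_AE)
         (use ae iW iE fl(2) in \<open>auto intro!: Bochner_Integration.integrable_diff Bochner_Integration.integrable_minus integrable_mult_right elim: eventually_mono\<close>)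
    moreover have "(LINT x|lebesgue. k / 2 * ?W x - ?E x) = k / 2 * weighted_int R u - (LINT x|lebesgue. ?E x)"
      unfolding weighted_int_def using iW iE by (subst Bochner_Integration.integral_diff) auto
    moreover have "(LINT x|lebesgue. \<bar>- ?F x\<bar>) \<le> (LINT x|lebesgue. 2 * k * ?W x + ?E x)"
      by (rule integral_mono_AE)
         (use ae iW iE fl(2) in \<open>auto intro!: Bochner_Integration.integrable_add integrable_mult_right elim: eventually_mono\<close>)
    moreover have "(LINT x|lebesgue. 2 * k * ?W x + ?E x) = 2 * k * weighted_int R u + (LINT x|lebesgue. ?E x)"
      unfolding weighted_int_def using iW iE by (subst Bochner_Integration.integral_add) auto
    moreover have "\<bar>LINT x|lebesgue. - ?F x\<bar> \<le> (LINT x|lebesgue. \<bar>- ?F x\<bar>)"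
      using integral_norm_bound[of lebesgue "\<lambda>x. - ?F x"] by simp
    moreover have "(LINT x|lebesgue. - ?F x) = - (LINT x|lebesgue. ?F x)" by simp
    ultimately show ?thesis unfolding fl(1) using E by linarith
  qed
  moreover have "R1 > 0" using R0 by (simp add: R1_def)
  ultimately show ?thesis by blast
qed

subsection \<open>Entire solutions of the Helmholtz equation\<close>

lemma smooth_real_derivative:
  fixes u :: "real^2 \<Rightarrow> real"
  assumes "smooth u"
  shows "(u has_derivative (\<lambda>h. h $ 1 * partial_deriv 1 u x + h $ 2 * partial_deriv 2 u x)) (at x)"
  using has_derivative_partial[OF smooth_differentiable[OF assms], of x] by (simp add: sum_2)

lemma laplacian_2: "laplacian f x = partial_deriv 1 (partial_deriv 1 f) x + partial_deriv 2 (partial_deriv 2 f) x"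
  by (simp add: laplacian_def sum_2)

lemma indicator_continuous_integrable:
  fixes f :: "real^2 \<Rightarrow> real"
  assumes "continuous_on UNIV f"
  shows "integrable lebesgue (\<lambda>x. indicator (cball 0 r) x * f x)"
proof -
  have "integrable lborel (\<lambda>x. indicator (cball 0 r) x *\<^sub>R f x)"
    by (rule borel_integrable_compact) (use assms in \<open>auto intro: continuous_on_subset\<close>)
  then show ?thesis using borel_measurable_continuous_onI[OF assms]
    by (subst integrable_completion) auto
qed

lemma cutoff_integrable:
  fixes f :: "real^2 \<Rightarrow> real"
  assumes "continuous_on UNIV f" "R > 0"
  shows "integrable lebesgue (\<lambda>x. cutoff R x * f x)"
    and "integrable lebesgue (\<lambda>x. partial_deriv i (cutoff R) x * f x)"
proof -
  note c = Ck_on_Suc0_continuous[OF cutoff_C1[of R]]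
  show "integrable lebesgue (\<lambda>x. cutoff R x * f x)"
    by (rule continuous_support_integrable[where r = "3 * R"])
       (use assms c(1) cutoff_support in \<open>auto intro!: continuous_intros\<close>)
  show "integrable lebesgue (\<lambda>x. partial_deriv i (cutoff R) x * f x)"
    by (rule continuous_support_integrable[where r = "3 * R"])
       (use assms c(2) partial_deriv_support[OF cutoff_support] in \<open>auto intro!: continuous_intros\<close>)
qed

lemma divergence_cutoff:
  fixes Y1 Y2 :: "real^2 \<Rightarrow> real"
  assumes "Ck_on (Suc 0) UNIV Y1" "Ck_on (Suc 0) UNIV Y2" "R > 0"
  shows "(LINT x|lebesgue. cutoff R x * (partial_deriv 1 Y1 x + partial_deriv 2 Y2 x)) =
    - (LINT x|lebesgue. partial_deriv 1 (cutoff R) x * Y1 x + partial_deriv 2 (cutoff R) x * Y2 x)"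
proof -
  have *: "(LINT x|lebesgue. cutoff R x * partial_deriv i Y x) = - (LINT x|lebesgue. partial_deriv i (cutoff R) x * Y x)"
    if Y: "Ck_on (Suc 0) UNIV Y" for i and Y :: "real^2 \<Rightarrow> real"
  proof -
    note c = Ck_on_Suc0_continuous[OF cutoff_C1[of R]] Ck_on_Suc0_continuous[OF Y]
    have "(LINT x|lebesgue. partial_deriv i (\<lambda>x. cutoff R x * Y x) x) = 0"
      by (rule integral_partial_deriv_zero[OF Ck_on_mult[OF cutoff_C1 Y], where r = "3 * R"])
         (use assms(3) cutoff_support in auto)
    then have "(LINT x|lebesgue. cutoff R x * partial_deriv i Y x + partial_deriv i (cutoff R) x * Y x) = 0"
      by (simp add: partial_deriv_mult c)
    then show ?thesis using cutoff_integrable[OF c(5) assms(3)] cutoff_integrable(2)[OF c(4) assms(3)]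
      by (simp add: Bochner_Integration.integral_add)
  qed
  note c1 = Ck_on_Suc0_continuous[OF assms(1)] and c2 = Ck_on_Suc0_continuous[OF assms(2)]
  show ?thesis
    using *[OF assms(1), of 1] *[OF assms(2), of 2] cutoff_integrable(1)[OF c1(2) assms(3), of 1]
      cutoff_integrable(1)[OF c2(2) assms(3), of 2]
      cutoff_integrable(2)[OF c1(1) assms(3), of 1] cutoff_integrable(2)[OF c2(1) assms(3), of 2]
    by (simp add: distrib_left Bochner_Integration.integral_add)
qed

lemma cutoff_partial_bound: assumes "R > 0" shows "\<bar>partial_deriv i (cutoff R) x\<bar> \<le> 6 / R"
proof -
  have "\<bar>partial_deriv i (cutoff R) x\<bar> \<le> weight R x"
    unfolding cutoff_partial weight_def using component_le_norm_cart[of x i] cutoff_slope_bounds(1)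
    by (auto simp: abs_mult intro!: mult_mono divide_right_mono)
  then show ?thesis using weight_upper[OF assms, of x] by linarith
qed

text \<open>The divergence of \<open>u\<close> times its gradient is the squared gradient minus
  \<open>k\<^sup>2 * u\<^sup>2\<close>. Integrated against the cutoff, half of the gradient term
  absorbs the derivative of the cutoff at the cost \<open>36 / R\<^sup>2\<close>; moving that half
  to the left doubles the remaining constants.\<close>

lemma helmholtz_gradient_bound:
  fixes u :: "real^2 \<Rightarrow> real"
  assumes u: "smooth u" and eq: "\<And>x. laplacian u x = - k\<^sup>2 * u x" and R: "R > 0"
  shows "ball_int (R / 2) (\<lambda>x. (partial_deriv 1 u x)\<^sup>2 + (partial_deriv 2 u x)\<^sup>2)
    \<le> (2 * k\<^sup>2 + 72 / R\<^sup>2) * ball_int (3 * R) (\<lambda>x. (u x)\<^sup>2)"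
proof -
  define u1 u2 where "u1 = partial_deriv 1 u" and "u2 = partial_deriv 2 u"
  have sm: "smooth u1" "smooth u2" unfolding u1_def u2_def using u by (auto intro: smooth_partial)
  have c: "continuous_on UNIV u" "continuous_on UNIV u1" "continuous_on UNIV u2"
    using u sm by (auto intro: smooth_continuous)
  have C1: "Ck_on (Suc 0) UNIV u" "Ck_on (Suc 0) UNIV u1" "Ck_on (Suc 0) UNIV u2"
    using u sm unfolding smooth_def by blast+
  have "partial_deriv 1 (\<lambda>x. u x * u1 x) x + partial_deriv 2 (\<lambda>x. u x * u2 x) x = (u1 x)\<^sup>2 + (u2 x)\<^sup>2 - k\<^sup>2 * (u x)\<^sup>2" for x
  proof -
    have "partial_deriv 1 (\<lambda>x. u x * u1 x) x + partial_deriv 2 (\<lambda>x. u x * u2 x) x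
      = u x * (partial_deriv 1 u1 x + partial_deriv 2 u2 x) + (u1 x)\<^sup>2 + (u2 x)\<^sup>2"
      using u sm by (simp add: partial_deriv_mult smooth_differentiable u1_def[symmetric] u2_def[symmetric] power2_eq_square algebra_simps)
    also have "partial_deriv 1 u1 x + partial_deriv 2 u2 x = - k\<^sup>2 * u x"
      using eq[of x] unfolding laplacian_2 u1_def u2_def .
    finally show ?thesis by (simp add: power2_eq_square)
  qed
  then have id: "(LINT x|lebesgue. cutoff R x * ((u1 x)\<^sup>2 + (u2 x)\<^sup>2 - k\<^sup>2 * (u x)\<^sup>2)) =
     - (LINT x|lebesgue. partial_deriv 1 (cutoff R) x * (u x * u1 x) + partial_deriv 2 (cutoff R) x * (u x * u2 x))"
    using divergence_cutoff[OF Ck_on_mult[OF C1(1,2)] Ck_on_mult[OF C1(1,3)] R] by simp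
  let ?I = "\<lambda>r x. indicator (cball 0 r) (x::real^2) :: real"
  have pt: "- (partial_deriv i (cutoff R) x * (u x * g)) \<le> 1/2 * (cutoff R x * g\<^sup>2) + 18 / R\<^sup>2 * (?I (3 * R) x * (u x)\<^sup>2)" for i x g
  proof (cases "norm x > 3 * R")
    case True
    then show ?thesis using partial_deriv_support[OF cutoff_support[OF R] True] cutoff_bounds by simp
  next
    case False
    have "\<bar>partial_deriv i (cutoff R) x\<bar> \<le> sqrt (4 * (9 / R\<^sup>2) * cutoff R x)"
      using cutoff_partial_square[OF R, of i x] by (simp add: real_le_rsqrt)
    also have "4 * (9 / R\<^sup>2) * cutoff R x = (6 / R)\<^sup>2 * cutoff R x" by (simp add: power_divide)
    also have "sqrt \<dots> = 6 / R * sqrt (cutoff R x)" using R by (simp add: real_sqrt_mult)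
    finally have "\<bar>partial_deriv i (cutoff R) x\<bar> * (\<bar>u x\<bar> * \<bar>g\<bar>) \<le> 6 / R * sqrt (cutoff R x) * (\<bar>u x\<bar> * \<bar>g\<bar>)"
      by (intro mult_right_mono) auto
    also have "\<dots> = 1/2 * (2 * (6 / R * \<bar>u x\<bar>) * (sqrt (cutoff R x) * \<bar>g\<bar>))" by simp
    also have "\<dots> \<le> 1/2 * ((6 / R * \<bar>u x\<bar>)\<^sup>2 + (sqrt (cutoff R x) * \<bar>g\<bar>)\<^sup>2)"
      by (intro mult_left_mono sum_squares_bound) auto
    also have "\<dots> = 18 / R\<^sup>2 * (u x)\<^sup>2 + 1/2 * (cutoff R x * g\<^sup>2)"
      using cutoff_bounds(1)[of R x] by (simp add: power_mult_distrib power_divide)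
    finally have "\<bar>partial_deriv i (cutoff R) x * (u x * g)\<bar> \<le> 18 / R\<^sup>2 * (u x)\<^sup>2 + 1/2 * (cutoff R x * g\<^sup>2)"
      by (simp add: abs_mult)
    then show ?thesis using False by (simp add: abs_le_iff)
  qed
  have iG: "integrable lebesgue (\<lambda>x. cutoff R x * ((u1 x)\<^sup>2 + (u2 x)\<^sup>2))"
    "integrable lebesgue (\<lambda>x. cutoff R x * (u x)\<^sup>2)"
    by (intro cutoff_integrable R continuous_intros c)+
  have iP: "integrable lebesgue (\<lambda>x. partial_deriv 1 (cutoff R) x * (u x * u1 x) + partial_deriv 2 (cutoff R) x * (u x * u2 x))"
    by (intro Bochner_Integration.integrable_add cutoff_integrable R continuous_intros c)
  have iU: "integrable lebesgue (\<lambda>x. ?I r x * (u x)\<^sup>2)" for r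
    by (intro indicator_continuous_integrable continuous_intros c)
  have "(LINT x|lebesgue. cutoff R x * ((u1 x)\<^sup>2 + (u2 x)\<^sup>2 - k\<^sup>2 * (u x)\<^sup>2))
      = (LINT x|lebesgue. cutoff R x * ((u1 x)\<^sup>2 + (u2 x)\<^sup>2) - k\<^sup>2 * (cutoff R x * (u x)\<^sup>2))"
    by (intro Bochner_Integration.integral_cong) (auto simp: algebra_simps)
  also have "\<dots> = (LINT x|lebesgue. cutoff R x * ((u1 x)\<^sup>2 + (u2 x)\<^sup>2)) - k\<^sup>2 * (LINT x|lebesgue. cutoff R x * (u x)\<^sup>2)"
    using iG by simp
  finally have 1: "(LINT x|lebesgue. cutoff R x * ((u1 x)\<^sup>2 + (u2 x)\<^sup>2)) - k\<^sup>2 * (LINT x|lebesgue. cutoff R x * (u x)\<^sup>2)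
     = - (LINT x|lebesgue. partial_deriv 1 (cutoff R) x * (u x * u1 x) + partial_deriv 2 (cutoff R) x * (u x * u2 x))"
    using id by simp
  have "- (LINT x|lebesgue. partial_deriv 1 (cutoff R) x * (u x * u1 x) + partial_deriv 2 (cutoff R) x * (u x * u2 x))
     = (LINT x|lebesgue. - (partial_deriv 1 (cutoff R) x * (u x * u1 x) + partial_deriv 2 (cutoff R) x * (u x * u2 x)))"
    by (rule Bochner_Integration.integral_minus[symmetric])
  also have "\<dots> \<le> (LINT x|lebesgue. 1/2 * (cutoff R x * ((u1 x)\<^sup>2 + (u2 x)\<^sup>2)) + 36 / R\<^sup>2 * (?I (3 * R) x * (u x)\<^sup>2))"
  proof (rule integral_mono)
    fix x
    show "- (partial_deriv 1 (cutoff R) x * (u x * u1 x) + partial_deriv 2 (cutoff R) x * (u x * u2 x))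
      \<le> 1/2 * (cutoff R x * ((u1 x)\<^sup>2 + (u2 x)\<^sup>2)) + 36 / R\<^sup>2 * (?I (3 * R) x * (u x)\<^sup>2)"
      using pt[of 1 x "u1 x"] pt[of 2 x "u2 x"] by (simp add: distrib_left)
  qed (intro Bochner_Integration.integrable_minus iP Bochner_Integration.integrable_add integrable_mult_right iG iU)+
  also have "\<dots> = 1/2 * (LINT x|lebesgue. cutoff R x * ((u1 x)\<^sup>2 + (u2 x)\<^sup>2)) + 36 / R\<^sup>2 * ball_int (3 * R) (\<lambda>x. (u x)\<^sup>2)"
    unfolding ball_int_def using iG iU by (subst Bochner_Integration.integral_add) auto
  finally have 2: "- (LINT x|lebesgue. partial_deriv 1 (cutoff R) x * (u x * u1 x) + partial_deriv 2 (cutoff R) x * (u x * u2 x))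
    \<le> 1/2 * (LINT x|lebesgue. cutoff R x * ((u1 x)\<^sup>2 + (u2 x)\<^sup>2)) + 36 / R\<^sup>2 * ball_int (3 * R) (\<lambda>x. (u x)\<^sup>2)" .
  have 3: "(LINT x|lebesgue. cutoff R x * (u x)\<^sup>2) \<le> ball_int (3 * R) (\<lambda>x. (u x)\<^sup>2)"
    unfolding ball_int_def
  proof (rule integral_mono)
    fix x
    show "cutoff R x * (u x)\<^sup>2 \<le> ?I (3 * R) x * (u x)\<^sup>2"
      using cutoff_bounds[of R x] cutoff_support[OF R, of x]
      by (cases "norm x > 3 * R") (auto intro: mult_left_le_one_le)
  qed (use iG iU in auto)
  have 4: "ball_int (R / 2) (\<lambda>x. (u1 x)\<^sup>2 + (u2 x)\<^sup>2) \<le> (LINT x|lebesgue. cutoff R x * ((u1 x)\<^sup>2 + (u2 x)\<^sup>2))"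
    unfolding ball_int_def
  proof (rule integral_mono)
    fix x
    show "?I (R / 2) x * ((u1 x)\<^sup>2 + (u2 x)\<^sup>2) \<le> cutoff R x * ((u1 x)\<^sup>2 + (u2 x)\<^sup>2)"
      using cutoff_bounds[of R x] cutoff_one[OF R, of x] by (cases "norm x \<le> R / 2") auto
  qed (use iG in \<open>auto intro!: indicator_continuous_integrable continuous_intros c\<close>)
  have "k\<^sup>2 * (LINT x|lebesgue. cutoff R x * (u x)\<^sup>2) \<le> k\<^sup>2 * ball_int (3 * R) (\<lambda>x. (u x)\<^sup>2)"
    using 3 by (intro mult_left_mono) auto
  then show ?thesis unfolding u1_def[symmetric] u2_def[symmetric] using 1 2 4
    by (simp add: algebra_simps)
qed

section \<open>A Rellich identity with a bounded multiplier\<close>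

text \<open>Multiplying the position vector by this factor gives a radial field of length at most
  \<open>inverse (sqrt d)\<close>. It behaves like the classical multiplier x near 0 and becomes
  constant in size far out; small \<open>d\<close> keeps the lower-order error small.\<close>

definition bracket :: "real \<Rightarrow> real^2 \<Rightarrow> real" where
  "bracket d x = inverse (sqrt (1 + d * (x \<bullet> x)))"

lemma bracket_props:
  assumes "d > 0"
  shows "0 < bracket d x" "bracket d x \<le> 1" "(bracket d x)\<^sup>2 * (1 + d * (x \<bullet> x)) = 1"
proof -
  have p: "1 + d * (x \<bullet> x) \<ge> 1" using assms by simp
  then show "0 < bracket d x" by (simp add: bracket_def)
  show "bracket d x \<le> 1" using p unfolding bracket_def by (intro inverse_le_1_iff[THEN iffD2]) auto
  show "(bracket d x)\<^sup>2 * (1 + d * (x \<bullet> x)) = 1" using p by (simp add: bracket_def power_inverse)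
qed

lemma bracket_derivative:
  assumes "d > 0"
  shows "(bracket d has_derivative (\<lambda>h. - d * (x $ 1 * h $ 1 + x $ 2 * h $ 2) * bracket d x ^ 3)) (at x)"
proof -
  have p: "1 + d * (x \<bullet> x) > 0" using assms by (simp add: add_pos_nonneg)
  have 1: "((\<lambda>x::real^2. 1 + d * (x \<bullet> x)) has_derivative (\<lambda>h. 2 * d * (x \<bullet> h))) (at x)"
    by (auto intro!: derivative_eq_intros simp: inner_commute)
  have "((\<lambda>t. inverse (sqrt t)) has_real_derivative - (inverse (sqrt t) ^ 3 / 2)) (at t)" if "t > 0" for t
    using that by (auto intro!: derivative_eq_intros simp: power3_eq_cube divide_simps)
  from DERIV_compose_FDERIV[OF this[OF p] 1]
  have "(bracket d has_derivative (\<lambda>h. 2 * d * (x \<bullet> h) * - (bracket d x ^ 3 / 2))) (at x)"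
    by (simp add: bracket_def[abs_def])
  then show ?thesis
    by (rule has_derivative_eq_rhs) (simp add: fun_eq_iff inner_vec_def sum_2 algebra_simps)
qed

lemma bracket_C1: assumes "d > 0" shows "Ck_on (Suc 0) UNIV (bracket d)"
proof -
  have d: "bracket d differentiable (at x)" for x
    using bracket_derivative[OF assms] differentiable_def by blast
  then have c: "continuous_on UNIV (bracket d)"
    by (intro differentiable_imp_continuous_on) (auto simp: differentiable_on_def)
  have "partial_deriv i (bracket d) x = - d * (x $ 1 * axis i 1 $ 1 + x $ 2 * axis i 1 $ 2) * bracket d x ^ 3" for i x
    by (rule partial_deriv_eq[OF bracket_derivative[OF assms]])
  then have "partial_deriv i (bracket d) = (\<lambda>x. - d * (x $ 1 * axis i 1 $ 1 + x $ 2 * axis i 1 $ 2) * bracket d x ^ 3)" for i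
    by blast
  then have "continuous_on UNIV (partial_deriv i (bracket d))" for i
    using c by (auto intro!: continuous_intros)
  with d show ?thesis by (auto simp: differentiable_on_def)
qed

text \<open>For \<open>\<Delta>u = - k\<^sup>2 u\<close>, the field built from \<open>F = x s\<close> and \<open>\<theta> = s - s\<^sup>3\<close> by the Rellich identity,
  \<open>2 (F \<cdot> \<nabla>u) \<nabla>u - \<bar>\<nabla>u\<bar>\<^sup>2 F + k\<^sup>2 u\<^sup>2 F + \<theta> u \<nabla>u - u\<^sup>2 \<nabla>\<theta> / 2\<close>, where \<open>s\<close> is the bracket.
  Here \<open>x\<close> is the coordinate of the component, \<open>y\<close> the other one, \<open>p\<close> and \<open>q\<close> are the
  corresponding partial derivatives and \<open>v\<close> is the value of \<open>u\<close>. The choice of \<open>\<theta>\<close> leaves only the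
  square of the angular derivative in the gradient part of the divergence.\<close>

definition multiplier :: "real \<Rightarrow> real \<Rightarrow> real \<Rightarrow> real \<Rightarrow> real \<Rightarrow> real \<Rightarrow> real \<Rightarrow> real \<Rightarrow> real" where
  "multiplier d k x y p q v s = 2 * p * (s * (x * p + y * q)) + (-1) * (x * s * (p * p + q * q))
     + k\<^sup>2 * (x * s * (v * v)) + (s + (-1) * (s * s * s)) * (v * p)
     + (- d / 2) * (x * (3 * (s * s * s * s * s) + (-1) * (s * s * s)) * (v * v))"

text \<open>The gradient terms add up to \<open>2 * (s - s ^ 3)\<close> times the squared gradient
  minus \<open>2 * d * s ^ 3\<close> times the square of x . grad u. Since
  \<open>d * (x \<bullet> x) * s\<^sup>2 = 1 - s\<^sup>2\<close>, this is the square of the angular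
  derivative. The remaining coefficient of \<open>u\<^sup>2\<close> is \<open>k\<^sup>2\<close>
  times (div F - \<theta>), that is \<open>2 * k\<^sup>2 * s ^ 3\<close>, minus half the Laplacian
  of \<theta>.\<close>

lemma multiplier_divergence:
  fixes u :: "real^2 \<Rightarrow> real"
  assumes u: "smooth u" and sym: "partial_deriv 1 (partial_deriv 2 u) = partial_deriv 2 (partial_deriv 1 u)"
    and eq: "\<And>x. laplacian u x = - k\<^sup>2 * u x" and d: "d > 0"
  defines "u1 \<equiv> partial_deriv 1 u" and "u2 \<equiv> partial_deriv 2 u"
  shows "partial_deriv 1 (\<lambda>x. multiplier d k (x $ 1) (x $ 2) (u1 x) (u2 x) (u x) (bracket d x)) x
     + partial_deriv 2 (\<lambda>x. multiplier d k (x $ 2) (x $ 1) (u2 x) (u1 x) (u x) (bracket d x)) x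
   = 2 * d * bracket d x ^ 3 * (x $ 2 * u1 x - x $ 1 * u2 x)\<^sup>2
     + (2 * k\<^sup>2 * bracket d x ^ 3 - d / 2 * (bracket d x ^ 3 - 12 * bracket d x ^ 5 + 15 * bracket d x ^ 7)) * (u x)\<^sup>2"
proof -
  have hu: "(u has_derivative (\<lambda>h. h $ 1 * u1 x + h $ 2 * u2 x)) (at x)"
    unfolding u1_def u2_def by (rule smooth_real_derivative[OF u])
  define a b c where "a = partial_deriv 1 u1 x" and "b = partial_deriv 2 u1 x" and "c = partial_deriv 2 u2 x"
  have hu1: "(u1 has_derivative (\<lambda>h. h $ 1 * a + h $ 2 * b)) (at x)"
    unfolding a_def b_def using smooth_real_derivative[OF smooth_partial[OF u, of 1], of x] by (simp add: u1_def)
  have "partial_deriv 1 u2 x = b" using sym by (simp add: b_def u1_def u2_def)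
  then have hu2: "(u2 has_derivative (\<lambda>h. h $ 1 * b + h $ 2 * c)) (at x)"
    unfolding c_def using smooth_real_derivative[OF smooth_partial[OF u, of 2], of x] by (simp add: u2_def)
  have ac: "c = - k\<^sup>2 * u x - a" using eq[of x] by (simp add: laplacian_2 a_def c_def u1_def u2_def)
  note hs = bracket_derivative[OF d, of x]
  have hx: "((\<lambda>x::real^2. x $ i) has_derivative (\<lambda>h. h $ i)) (at x)" for i
    by (rule bounded_linear_imp_has_derivative[OF bounded_linear_vec_nth])
  define X Y p q v s where "X = x $ 1" and "Y = x $ 2" and "p = u1 x" and "q = u2 x" and "v = u x" and "s = bracket d x"
  note defs = X_def Y_def p_def q_def v_def s_def
  have s2: "d * (X * X + Y * Y) * s\<^sup>2 = 1 - s\<^sup>2"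
    using bracket_props(3)[OF d, of x] by (simp add: defs inner_vec_def sum_2 algebra_simps)
  let ?ds1 = "- d * X * s ^ 3" and ?ds2 = "- d * Y * s ^ 3"
  have ax: "axis 1 1 $ (1::2) = (1::real)" "axis 1 1 $ (2::2) = (0::real)" "axis 2 1 $ (1::2) = (0::real)" "axis 2 1 $ (2::2) = (1::real)"
    by (simp_all add: axis_def)
  have D1: "partial_deriv 1 (\<lambda>x. multiplier d k (x $ 1) (x $ 2) (u1 x) (u2 x) (u x) (bracket d x)) x =
     2 * a * (s * (X * p + Y * q)) + 2 * p * (?ds1 * (X * p + Y * q) + s * (p + X * a + Y * b))
     - (s * (p * p + q * q) + X * ?ds1 * (p * p + q * q) + X * s * (2 * p * a + 2 * q * b))
     + k\<^sup>2 * (s * (v * v) + X * ?ds1 * (v * v) + X * s * (2 * v * p))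
     + (?ds1 - 3 * s\<^sup>2 * ?ds1) * (v * p) + (s - s ^ 3) * (p * p + v * a)
     - d / 2 * ((3 * s ^ 5 - s ^ 3) * (v * v) + X * (15 * s ^ 4 * ?ds1 - 3 * s\<^sup>2 * ?ds1) * (v * v) + X * (3 * s ^ 5 - s ^ 3) * (2 * v * p))"
    unfolding multiplier_def
    by (rule trans[OF partial_deriv_eq], (rule derivative_intros hu hu1 hu2 hs hx)+)
       (simp add: ax defs[symmetric], simp add: field_simps power2_eq_square power3_eq_cube eval_nat_numeral)
  have D2: "partial_deriv 2 (\<lambda>x. multiplier d k (x $ 2) (x $ 1) (u2 x) (u1 x) (u x) (bracket d x)) x =
     2 * c * (s * (Y * q + X * p)) + 2 * q * (?ds2 * (Y * q + X * p) + s * (q + Y * c + X * b))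
     - (s * (q * q + p * p) + Y * ?ds2 * (q * q + p * p) + Y * s * (2 * q * c + 2 * p * b))
     + k\<^sup>2 * (s * (v * v) + Y * ?ds2 * (v * v) + Y * s * (2 * v * q))
     + (?ds2 - 3 * s\<^sup>2 * ?ds2) * (v * q) + (s - s ^ 3) * (q * q + v * c)
     - d / 2 * ((3 * s ^ 5 - s ^ 3) * (v * v) + Y * (15 * s ^ 4 * ?ds2 - 3 * s\<^sup>2 * ?ds2) * (v * v) + Y * (3 * s ^ 5 - s ^ 3) * (2 * v * q))"
    unfolding multiplier_def
    by (rule trans[OF partial_deriv_eq], (rule derivative_intros hu hu1 hu2 hs hx)+)
       (simp add: ax defs[symmetric], simp add: field_simps power2_eq_square power3_eq_cube eval_nat_numeral)
  have c': "c = - k\<^sup>2 * v - a" using ac by (simp add: v_def)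
  \<comment> \<open>With the equation used to eliminate \<open>c\<close> and symmetry used to share
    \<open>b\<close>, what remains is a polynomial identity modulo \<open>s2\<close>.\<close>
  show ?thesis unfolding D1 D2 c' defs[symmetric]
    using s2 by algebra
qed

text \<open>The five summands contribute \<open>3 * c\<close>, \<open>c\<close>,
  \<open>k\<^sup>2 * c\<close>, 1 and \<open>2 * d * c\<close>, where \<open>c\<close> bounds the
  components of the field and powers of \<open>s\<close> are at most 1.\<close>

lemma multiplier_bound:
  assumes s: "0 < s" "s \<le> 1" and X: "\<bar>X * s\<bar> \<le> c" and Y: "\<bar>Y * s\<bar> \<le> c" and d: "d > 0"
  shows "\<bar>multiplier d k X Y p q v s\<bar> \<le> (4 * c + k\<^sup>2 * c + 1 + 2 * d * c) * (p\<^sup>2 + q\<^sup>2 + v\<^sup>2)"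
proof -
  have c: "c \<ge> 0" using X by linarith
  have s3: "0 \<le> s * s * s" "s * s * s \<le> 1" using s by (auto intro!: mult_le_one)
  have pq: "2 * \<bar>p * q\<bar> \<le> p\<^sup>2 + q\<^sup>2" using sum_squares_bound[of "\<bar>p\<bar>" "\<bar>q\<bar>"] by (simp add: abs_mult)
  have vp: "2 * \<bar>v * p\<bar> \<le> v\<^sup>2 + p\<^sup>2" using sum_squares_bound[of "\<bar>v\<bar>" "\<bar>p\<bar>"] by (simp add: abs_mult)
  have t1: "\<bar>2 * p * (s * (X * p + Y * q))\<bar> \<le> 3 * c * (p\<^sup>2 + q\<^sup>2)"
  proof -
    have eq: "2 * p * (s * (X * p + Y * q)) = 2 * (X * s) * p\<^sup>2 + 2 * (Y * s) * (p * q)"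
      by (simp add: power2_eq_square algebra_simps)
    have "\<bar>2 * (X * s) * p\<^sup>2\<bar> \<le> 2 * c * p\<^sup>2"
      using X by (simp add: abs_mult mult_right_mono)
    moreover have "\<bar>2 * (Y * s) * (p * q)\<bar> \<le> c * (p\<^sup>2 + q\<^sup>2)"
    proof -
      have "\<bar>2 * (Y * s) * (p * q)\<bar> = \<bar>Y * s\<bar> * (2 * \<bar>p * q\<bar>)" by (simp add: abs_mult)
      also have "\<dots> \<le> c * (p\<^sup>2 + q\<^sup>2)" using Y pq c by (intro mult_mono) auto
      finally show ?thesis .
    qed
    moreover have "0 \<le> c * q\<^sup>2" using c by simp
    moreover have "3 * c * (p\<^sup>2 + q\<^sup>2) = 2 * c * p\<^sup>2 + 2 * (c * q\<^sup>2) + c * (p\<^sup>2 + q\<^sup>2)" by (simp add: algebra_simps)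
    ultimately show ?thesis unfolding eq by linarith
  qed
  have t2: "\<bar>(-1) * (X * s * (p * p + q * q))\<bar> \<le> c * (p\<^sup>2 + q\<^sup>2)"
    using X by (simp add: abs_mult power2_eq_square mult_right_mono)
  have t3: "\<bar>k\<^sup>2 * (X * s * (v * v))\<bar> \<le> k\<^sup>2 * c * v\<^sup>2"
  proof -
    have "\<bar>k\<^sup>2 * (X * s * (v * v))\<bar> = k\<^sup>2 * (\<bar>X * s\<bar> * v\<^sup>2)" by (simp add: abs_mult power2_eq_square[of v])
    also have "\<dots> \<le> k\<^sup>2 * (c * v\<^sup>2)" using X by (intro mult_left_mono mult_right_mono) auto
    finally show ?thesis by simp
  qed
  have t4: "\<bar>(s + (-1) * (s * s * s)) * (v * p)\<bar> \<le> p\<^sup>2 + q\<^sup>2 + v\<^sup>2"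
  proof -
    have "\<bar>s + (-1) * (s * s * s)\<bar> \<le> 1" using s s3 by linarith
    then have "\<bar>(s + (-1) * (s * s * s)) * (v * p)\<bar> \<le> 1 * \<bar>v * p\<bar>" unfolding abs_mult by (intro mult_right_mono) auto
    moreover have "0 \<le> q\<^sup>2" "0 \<le> p\<^sup>2" "0 \<le> v\<^sup>2" by auto
    ultimately show ?thesis using vp by linarith
  qed
  have t5: "\<bar>(- d / 2) * (X * (3 * (s * s * s * s * s) + (-1) * (s * s * s)) * (v * v))\<bar> \<le> 2 * d * c * v\<^sup>2"
  proof -
    have "0 \<le> s * s * s * s" "s * s * s * s \<le> 1" "0 \<le> s * s" "s * s \<le> 1" using s by (auto intro!: mult_le_one)
    then have "\<bar>3 * (s * s * s * s) - s * s\<bar> \<le> 4" by linarith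
    then have "\<bar>X * s\<bar> * \<bar>3 * (s * s * s * s) - s * s\<bar> * v\<^sup>2 \<le> c * 4 * v\<^sup>2"
      using X c by (intro mult_right_mono mult_mono) auto
    then have "d / 2 * (\<bar>X * s\<bar> * \<bar>3 * (s * s * s * s) - s * s\<bar> * v\<^sup>2) \<le> d / 2 * (c * 4 * v\<^sup>2)"
      using d by (intro mult_left_mono) auto
    moreover have eq: "X * (3 * (s * s * s * s * s) + (-1) * (s * s * s)) * (v * v) = (X * s) * (3 * (s * s * s * s) - s * s) * v\<^sup>2"
      by (simp add: power2_eq_square algebra_simps)
    moreover have "\<bar>(- d / 2) * ((X * s) * (3 * (s * s * s * s) - s * s) * v\<^sup>2)\<bar>
        = d / 2 * (\<bar>X * s\<bar> * \<bar>3 * (s * s * s * s) - s * s\<bar> * v\<^sup>2)"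
      using d unfolding abs_mult by simp
    ultimately show ?thesis unfolding eq by linarith
  qed
  have "\<bar>multiplier d k X Y p q v s\<bar> \<le> 3 * c * (p\<^sup>2 + q\<^sup>2) + c * (p\<^sup>2 + q\<^sup>2) + k\<^sup>2 * c * v\<^sup>2 + (p\<^sup>2 + q\<^sup>2 + v\<^sup>2) + 2 * d * c * v\<^sup>2"
    unfolding multiplier_def using t1 t2 t3 t4 t5 by linarith
  also have "\<dots> \<le> (4 * c + k\<^sup>2 * c + 1 + 2 * d * c) * (p\<^sup>2 + q\<^sup>2 + v\<^sup>2)"
  proof -
    have "0 \<le> 4 * c * v\<^sup>2" "0 \<le> k\<^sup>2 * c * (p\<^sup>2 + q\<^sup>2)" "0 \<le> 2 * d * c * (p\<^sup>2 + q\<^sup>2)" using c d by auto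
    then show ?thesis by (simp add: algebra_simps)
  qed
  finally show ?thesis .
qed

lemma bracket_coordinate_bound:
  assumes "d > 0" shows "\<bar>x $ i * bracket d x\<bar> \<le> inverse (sqrt d)"
proof -
  have "(x $ i)\<^sup>2 \<le> x \<bullet> x"
    using component_le_norm_cart[of x i] by (metis abs_ge_zero power2_abs power2_norm_eq_inner power_mono)
  then have "d * (x $ i)\<^sup>2 \<le> 1 + d * (x \<bullet> x)" using assms by (simp add: add_increasing)
  then have "(bracket d x)\<^sup>2 * (d * (x $ i)\<^sup>2) \<le> (bracket d x)\<^sup>2 * (1 + d * (x \<bullet> x))" by (intro mult_left_mono) auto
  then have "(x $ i * bracket d x)\<^sup>2 * d \<le> 1" using bracket_props(3)[OF assms, of x] by (simp add: power_mult_distrib mult_ac)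
  then have "\<bar>x $ i * bracket d x\<bar>\<^sup>2 \<le> (inverse (sqrt d))\<^sup>2" using assms by (simp add: power_inverse field_simps)
  then show ?thesis by (rule power2_le_imp_le) (use assms in simp)
qed

text \<open>The multiplier is spelled with \<open>(-1) *\<close> and products instead of differences
  and powers so that the closure rules apply term by term.\<close>

lemma multiplier_C1:
  fixes u p q :: "real^2 \<Rightarrow> real"
  assumes "Ck_on (Suc 0) UNIV u" "Ck_on (Suc 0) UNIV p" "Ck_on (Suc 0) UNIV q" "d > 0"
  shows "Ck_on (Suc 0) UNIV (\<lambda>x. multiplier d k (x $ i) (x $ j) (p x) (q x) (u x) (bracket d x))"
  unfolding multiplier_def
  by (intro Ck_on_add Ck_on_mult Ck_on_const Ck_on_coord bracket_C1 assms)

text \<open>The divergence of the Rellich field is bounded below by a positive multiple of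
  \<open>u\<^sup>2\<close>. Against the cutoff its integral is at most a constant over R times the
  integral of \<open>u\<^sup>2\<close> and the squared gradient over a larger ball. The gradient
  estimate reduces this to \<open>u\<^sup>2\<close>, and the decay assumption sends it to 0.\<close>

lemma helmholtz_entire_zero:
  fixes u :: "real^2 \<Rightarrow> real"
  assumes u: "smooth u" and sym: "partial_deriv 1 (partial_deriv 2 u) = partial_deriv 2 (partial_deriv 1 u)"
    and eq: "\<And>x. laplacian u x = - k\<^sup>2 * u x" and k: "k > 0"
    and decay: "\<And>e. e > 0 \<Longrightarrow> \<exists>R1. \<forall>R\<ge>R1. ball_int R (\<lambda>x. (u x)\<^sup>2) \<le> e * R"
  shows "AE x in lebesgue. u x = 0"
proof -
  define u1 u2 where "u1 = partial_deriv 1 u" and "u2 = partial_deriv 2 u"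
  have sm: "smooth u1" "smooth u2" unfolding u1_def u2_def using u by (auto intro: smooth_partial)
  have c: "continuous_on UNIV u" "continuous_on UNIV u1" "continuous_on UNIV u2"
    using u sm by (auto intro: smooth_continuous)
  have C1: "Ck_on (Suc 0) UNIV u" "Ck_on (Suc 0) UNIV u1" "Ck_on (Suc 0) UNIV u2"
    using u sm unfolding smooth_def by blast+
  \<comment> \<open>Half the Laplacian of \<theta> is at most \<open>d / 2 * 16 * s ^ 3\<close>,
    with 16 = 1 + 15 after dropping the negative term; this choice of \<open>d\<close> makes it
    \<open>k\<^sup>2 * s ^ 3\<close>, half of the main term.\<close>
  define d where "d = k\<^sup>2 / 8"
  have d: "d > 0" using k by (simp add: d_def)
  define c0 where "c0 = inverse (sqrt d)"
  define K where "K = 4 * c0 + k\<^sup>2 * c0 + 1 + 2 * d * c0"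
  have c0: "c0 > 0" using d by (simp add: c0_def)
  have "0 \<le> k\<^sup>2 * c0" "0 \<le> 2 * d * c0" using c0 d by auto
  then have K: "K > 0" using c0 unfolding K_def by linarith
  let ?S = "bracket d"
  have cS: "continuous_on UNIV ?S" by (rule Ck_on_Suc0_continuous(1)[OF bracket_C1[OF d]])
  let ?Y1 = "\<lambda>x. multiplier d k (x $ 1) (x $ 2) (u1 x) (u2 x) (u x) (?S x)"
  let ?Y2 = "\<lambda>x. multiplier d k (x $ 2) (x $ 1) (u2 x) (u1 x) (u x) (?S x)"
  let ?e = "\<lambda>x. (u1 x)\<^sup>2 + (u2 x)\<^sup>2 + (u x)\<^sup>2"
  have CY: "Ck_on (Suc 0) UNIV ?Y1" "Ck_on (Suc 0) UNIV ?Y2" by (intro multiplier_C1 C1 d)+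
  have bY: "\<bar>?Y1 x\<bar> \<le> K * ?e x" "\<bar>?Y2 x\<bar> \<le> K * ?e x" for x
    using multiplier_bound[where k = k and v = "u x", OF bracket_props(1,2)[OF d] bracket_coordinate_bound[OF d, of x 1] bracket_coordinate_bound[OF d, of x 2] d, of "u1 x" "u2 x"]
      multiplier_bound[where k = k and v = "u x", OF bracket_props(1,2)[OF d] bracket_coordinate_bound[OF d, of x 2] bracket_coordinate_bound[OF d, of x 1] d, of "u2 x" "u1 x"]
    by (simp_all add: K_def c0_def add.commute)
  define G where "G x = partial_deriv 1 ?Y1 x + partial_deriv 2 ?Y2 x" for x
  have G: "k\<^sup>2 * ?S x ^ 3 * (u x)\<^sup>2 \<le> G x" for x
  proof -
    let ?s = "?S x"
    have s: "0 < ?s" "?s \<le> 1" using bracket_props[OF d] by auto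
    have "?s ^ 7 \<le> ?s ^ 3" "0 \<le> ?s ^ 5" using s by (auto intro: power_decreasing)
    then have "?s ^ 3 - 12 * ?s ^ 5 + 15 * ?s ^ 7 \<le> 16 * ?s ^ 3" by linarith
    then have "d / 2 * (?s ^ 3 - 12 * ?s ^ 5 + 15 * ?s ^ 7) \<le> d / 2 * (16 * ?s ^ 3)" using d by (intro mult_left_mono) auto
    also have "\<dots> = k\<^sup>2 * ?s ^ 3" by (simp add: d_def)
    finally have "k\<^sup>2 * ?s ^ 3 \<le> 2 * k\<^sup>2 * ?s ^ 3 - d / 2 * (?s ^ 3 - 12 * ?s ^ 5 + 15 * ?s ^ 7)" by linarith
    then have "k\<^sup>2 * ?s ^ 3 * (u x)\<^sup>2 \<le> (2 * k\<^sup>2 * ?s ^ 3 - d / 2 * (?s ^ 3 - 12 * ?s ^ 5 + 15 * ?s ^ 7)) * (u x)\<^sup>2"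
      by (intro mult_right_mono) auto
    moreover have "0 \<le> 2 * d * ?s ^ 3 * (x $ 2 * u1 x - x $ 1 * u2 x)\<^sup>2" using d s by simp
    ultimately show ?thesis
      unfolding G_def u1_def u2_def multiplier_divergence[OF u sym eq d] by linarith
  qed
  have cG: "continuous_on UNIV G"
    unfolding G_def[abs_def] by (intro continuous_on_add Ck_on_Suc0_continuous(2) CY)
  have cE: "continuous_on UNIV ?e" "continuous_on UNIV (\<lambda>x. k\<^sup>2 * ?S x ^ 3 * (u x)\<^sup>2)"
    by (intro continuous_intros c cS)+
  \<comment> \<open>The divergence is nonnegative, so the ball where the cutoff is 1 may be singled
    out on the left. On the right each of the two partial derivatives of the cutoff contributes
    \<open>6 / R\<close>.\<close>
  have main: "ball_int r (\<lambda>x. k\<^sup>2 * ?S x ^ 3 * (u x)\<^sup>2) \<le> 12 * K / R * ball_int (3 * R) ?e" if R: "R > 0" "r \<le> R / 2" for r R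
  proof -
    have "ball_int r (\<lambda>x. k\<^sup>2 * ?S x ^ 3 * (u x)\<^sup>2) \<le> (LINT x|lebesgue. cutoff R x * G x)"
      unfolding ball_int_def
    proof (rule integral_mono)
      fix x
      have nn: "0 \<le> k\<^sup>2 * ?S x ^ 3 * (u x)\<^sup>2" using bracket_props(1)[OF d, of x] by simp
      then have "0 \<le> G x" using G[of x] by linarith
      show "indicator (cball 0 r) x * (k\<^sup>2 * ?S x ^ 3 * (u x)\<^sup>2) \<le> cutoff R x * G x"
      proof (cases "norm x \<le> r")
        case True
        then show ?thesis using cutoff_one[OF R(1), of x] R(2) G[of x] by simp
      qed (use cutoff_bounds(1)[of R x] \<open>0 \<le> G x\<close> in simp)
    qed (intro indicator_continuous_integrable cutoff_integrable cE cG R)+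
    also have "\<dots> = - (LINT x|lebesgue. partial_deriv 1 (cutoff R) x * ?Y1 x + partial_deriv 2 (cutoff R) x * ?Y2 x)"
      unfolding G_def by (rule divergence_cutoff[OF CY R(1)])
    also have "\<dots> = (LINT x|lebesgue. - (partial_deriv 1 (cutoff R) x * ?Y1 x + partial_deriv 2 (cutoff R) x * ?Y2 x))"
      by (rule Bochner_Integration.integral_minus[symmetric])
    also have "\<dots> \<le> (LINT x|lebesgue. 12 * K / R * (indicator (cball 0 (3 * R)) x * ?e x))"
    proof (rule integral_mono)
      fix x
      show "- (partial_deriv 1 (cutoff R) x * ?Y1 x + partial_deriv 2 (cutoff R) x * ?Y2 x) \<le> 12 * K / R * (indicator (cball 0 (3 * R)) x * ?e x)"
      proof (cases "norm x > 3 * R")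
        case True
        then show ?thesis using partial_deriv_support[OF cutoff_support[OF R(1)] True] by simp
      next
        case False
        have "\<bar>partial_deriv 1 (cutoff R) x * ?Y1 x\<bar> \<le> 6 / R * (K * ?e x)"
          unfolding abs_mult by (intro mult_mono cutoff_partial_bound bY R) (use R in auto)
        moreover have "\<bar>partial_deriv 2 (cutoff R) x * ?Y2 x\<bar> \<le> 6 / R * (K * ?e x)"
          unfolding abs_mult by (intro mult_mono cutoff_partial_bound bY R) (use R in auto)
        moreover have "12 * K / R * (indicator (cball 0 (3 * R)) x * ?e x) = 6 / R * (K * ?e x) + 6 / R * (K * ?e x)"
          using False by simp
        ultimately show ?thesis by linarith
      qed
    qed (intro Bochner_Integration.integrable_minus Bochner_Integration.integrable_add integrable_mult_right
        indicator_continuous_integrable cutoff_integrable cE Ck_on_Suc0_continuous(1) CY R)+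
    also have "\<dots> = 12 * K / R * ball_int (3 * R) ?e" by (simp add: ball_int_def)
    finally show ?thesis .
  qed
  have ints: "integrable lebesgue (\<lambda>x. indicator (cball 0 r) x * ((u1 x)\<^sup>2 + (u2 x)\<^sup>2))"
    "integrable lebesgue (\<lambda>x. indicator (cball 0 r) x * (u x)\<^sup>2)" for r
    by (intro indicator_continuous_integrable continuous_intros c)+
  have zero: "ball_int r (\<lambda>x. k\<^sup>2 * ?S x ^ 3 * (u x)\<^sup>2) \<le> 0" for r
  proof (rule field_le_epsilon)
    fix e :: real assume "e > 0"
    define C where "C = 12 * K * (2 * k\<^sup>2 + 73) * 18"
    have "2 * k\<^sup>2 + 73 > 0" by (simp add: add_nonneg_pos)
    then have C: "C > 0" using K by (simp add: C_def)
    obtain R1 where R1: "\<And>R. R \<ge> R1 \<Longrightarrow> ball_int R (\<lambda>x. (u x)\<^sup>2) \<le> e / C * R"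
      using decay[of "e / C"] \<open>e > 0\<close> C by auto
    define R where "R = max (max 1 (2 * r)) R1"
    have R: "R \<ge> 1" "R > 0" "r \<le> R / 2" "18 * R \<ge> R1"
    proof -
      have *: "R \<ge> 1" "R \<ge> 2 * r" "R \<ge> R1" unfolding R_def by auto
      then show "R \<ge> 1" "R > 0" "r \<le> R / 2" "18 * R \<ge> R1" by linarith+
    qed
    have g: "ball_int (3 * R) (\<lambda>x. (u1 x)\<^sup>2 + (u2 x)\<^sup>2) \<le> (2 * k\<^sup>2 + 72) * ball_int (18 * R) (\<lambda>x. (u x)\<^sup>2)"
    proof -
      \<comment> \<open>The gradient estimate is applied at radius \<open>6 * R\<close>: it controls
        the gradient on half of it, \<open>3 * R\<close>, by the function on three times it,
        \<open>18 * R\<close>.\<close>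
      have "ball_int (6 * R / 2) (\<lambda>x. (u1 x)\<^sup>2 + (u2 x)\<^sup>2) \<le> (2 * k\<^sup>2 + 72 / (6 * R)\<^sup>2) * ball_int (3 * (6 * R)) (\<lambda>x. (u x)\<^sup>2)"
        unfolding u1_def u2_def by (rule helmholtz_gradient_bound[OF u eq]) (use R in auto)
      also have "\<dots> \<le> (2 * k\<^sup>2 + 72) * ball_int (3 * (6 * R)) (\<lambda>x. (u x)\<^sup>2)"
      proof (rule mult_right_mono)
        have "1 \<le> (6 * R)\<^sup>2" using R by (intro one_le_power) auto
        then show "2 * k\<^sup>2 + 72 / (6 * R)\<^sup>2 \<le> 2 * k\<^sup>2 + 72" by (simp add: divide_le_eq)
      qed (intro ball_int_nonneg, simp)
      finally show ?thesis by simp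
    qed
    have m: "ball_int (3 * R) (\<lambda>x. (u x)\<^sup>2) \<le> ball_int (18 * R) (\<lambda>x. (u x)\<^sup>2)"
      unfolding ball_int_def using R by (intro integral_mono ints) (auto simp: indicator_def)
    have "ball_int (3 * R) ?e = ball_int (3 * R) (\<lambda>x. (u1 x)\<^sup>2 + (u2 x)\<^sup>2) + ball_int (3 * R) (\<lambda>x. (u x)\<^sup>2)"
      unfolding ball_int_def distrib_left[of _ "_ + _"] by (rule Bochner_Integration.integral_add[OF ints])
    also have "\<dots> \<le> (2 * k\<^sup>2 + 73) * ball_int (18 * R) (\<lambda>x. (u x)\<^sup>2)"
      using g m by (simp add: distrib_right)
    also have "\<dots> \<le> (2 * k\<^sup>2 + 73) * (e / C * (18 * R))"
      using R1[OF R(4)] \<open>2 * k\<^sup>2 + 73 > 0\<close> by (intro mult_left_mono) auto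
    finally have "12 * K / R * ball_int (3 * R) ?e \<le> 12 * K / R * ((2 * k\<^sup>2 + 73) * (e / C * (18 * R)))"
      using K R by (intro mult_left_mono) auto
    also have "\<dots> = C * (e / C)" using R by (simp add: C_def)
    also have "\<dots> = e" using C by simp
    finally show "ball_int r (\<lambda>x. k\<^sup>2 * ?S x ^ 3 * (u x)\<^sup>2) \<le> 0 + e" using main[OF R(2,3)] by linarith
  qed
  have "AE x in lebesgue. indicator (cball 0 r) x * (k\<^sup>2 * ?S x ^ 3 * (u x)\<^sup>2) = 0" for r
  proof -
    have nn: "0 \<le> k\<^sup>2 * ?S x ^ 3 * (u x)\<^sup>2" for x using bracket_props(1)[OF d, of x] by simp
    have "ball_int r (\<lambda>x. k\<^sup>2 * ?S x ^ 3 * (u x)\<^sup>2) = 0"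
      using zero[of r] ball_int_nonneg[of "\<lambda>x. k\<^sup>2 * ?S x ^ 3 * (u x)\<^sup>2" r, OF nn] by linarith
    then show ?thesis unfolding ball_int_def
      using integral_nonneg_eq_0_iff_AE[OF indicator_continuous_integrable[OF cE(2), of r]] nn by auto
  qed
  then have "AE x in lebesgue. \<forall>n. indicator (cball 0 (real n)) x * (k\<^sup>2 * ?S x ^ 3 * (u x)\<^sup>2) = 0"
    by (subst AE_all_countable) blast
  then show ?thesis
  proof eventually_elim
    case (elim x)
    obtain n where "norm x \<le> real n" using real_arch_simple by blast
    then show ?case using elim[rule_format, of n] k bracket_props(1)[OF d, of x] by simp
  qed
qed

subsection \<open>Radiating solutions\<close>

lemma mollifier_complex_symmetric:
  "partial_deriv i (partial_deriv j (\<lambda>x. complex_of_real (mollifier m x))) =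
   partial_deriv j (partial_deriv i (\<lambda>x. complex_of_real (mollifier m x)))"
proof -
  have "partial_deriv i (partial_deriv j (\<lambda>x. complex_of_real (mollifier m x))) =
      (\<lambda>x. complex_of_real (partial_deriv i (partial_deriv j (mollifier m)) x))" for i j
  proof -
    have 1: "partial_deriv j (\<lambda>x. complex_of_real (mollifier m x)) = (\<lambda>x. complex_of_real (partial_deriv j (mollifier m) x))"
      by (rule ext, rule partial_deriv_linear[OF bounded_linear_of_real smooth_differentiable[OF mollifier_smooth]])
    show ?thesis unfolding 1
      by (rule ext, rule partial_deriv_linear[OF bounded_linear_of_real smooth_differentiable[OF smooth_partial[OF mollifier_smooth]]])
  qed
  then show ?thesis using mollifier_symmetric by metis
qed

text \<open>The mollifications are smooth solutions of the same equation with symmetric second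
  derivatives and the same decay up to a shift of the radius by 1. They vanish, and so does their L2
  limit.\<close>

lemma helmholtz_decay_zero:
  assumes H: "weak_lap H (\<lambda>x. - (of_real k)\<^sup>2 * H x)" and k: "k > 0"
    and decay: "\<And>e. e > 0 \<Longrightarrow> \<exists>R1. \<forall>R\<ge>R1. ball_int R (\<lambda>x. (norm (H x))\<^sup>2) \<le> e * R"
  shows "AE x in lebesgue. H x = 0"
proof -
  have lH: "locL2 H" using H by (simp add: weak_lap_def)
  have zero: "ball_int r (\<lambda>x. (norm (mollify m H x))\<^sup>2) = 0" for m r
  proof -
    let ?h = "mollify m H"
    have sh: "smooth ?h" by (rule mollify_smooth[OF lH])
    have lap: "laplacian ?h x = - (of_real k)\<^sup>2 * ?h x" for x
      unfolding weak_lap_mollify[OF H] unfolding mollify_def by (rule conv_cmult)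
    have sym: "partial_deriv 1 (partial_deriv 2 ?h) = partial_deriv 2 (partial_deriv 1 ?h)"
      unfolding mollify_def
      by (simp only: conv_partial lH test_function_mollifier test_function_partial mollifier_complex_symmetric[of 1 2])
    \<comment> \<open>\<open>L\<close> stands for \<open>Re\<close> and \<open>Im\<close>. Real
      linearity and norm at most 1 transfer the equation, the symmetry and the decay to a real
      function.\<close>
    have part: "AE x in lebesgue. L (?h x) = 0"
      if L: "bounded_linear L" "\<And>z. \<bar>L z\<bar> \<le> norm z" "\<And>(a::real) z. L (of_real a * z) = a * L z" for L :: "complex \<Rightarrow> real"
    proof (rule helmholtz_entire_zero[OF _ _ _ k])
      have p: "partial_deriv i (\<lambda>x. L (f x)) = (\<lambda>x. L (partial_deriv i f x))" if "smooth f" for i and f :: "real^2 \<Rightarrow> complex"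
        by (rule ext, rule partial_deriv_linear[OF L(1) smooth_differentiable[OF that]])
      show "smooth (\<lambda>x. L (?h x))" using sh Ck_on_linear[OF L(1)] unfolding smooth_def by blast
      show "partial_deriv 1 (partial_deriv 2 (\<lambda>x. L (?h x))) = partial_deriv 2 (partial_deriv 1 (\<lambda>x. L (?h x)))"
        by (simp only: p sh smooth_partial sym)
      have "laplacian (\<lambda>x. L (?h x)) x = L (laplacian ?h x)" for x
        unfolding laplacian_2 by (simp only: p sh smooth_partial linear_simps[OF L(1)])
      then show "laplacian (\<lambda>x. L (?h x)) x = - k\<^sup>2 * L (?h x)" for x
        using L(3)[of "- k\<^sup>2" "?h x"] by (simp add: lap)
      show "\<exists>R1. \<forall>R\<ge>R1. ball_int R (\<lambda>x. (L (?h x))\<^sup>2) \<le> e * R" if "e > 0" for e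
      proof -
        obtain R1 where R1: "\<And>R. R \<ge> R1 \<Longrightarrow> ball_int R (\<lambda>x. (norm (H x))\<^sup>2) \<le> e / 2 * R"
          using decay[of "e/2"] \<open>e > 0\<close> by auto
        have "ball_int R (\<lambda>x. (L (?h x))\<^sup>2) \<le> e * R" if "R \<ge> max R1 1" for R
        proof -
          have "ball_int R (\<lambda>x. (L (?h x))\<^sup>2) \<le> ball_int R (\<lambda>x. (norm (?h x))\<^sup>2)"
            unfolding ball_int_def
          proof (rule integral_mono)
            show "integrable lebesgue (\<lambda>x. indicator (cball 0 R) x * (L (?h x))\<^sup>2)"
              by (intro indicator_continuous_integrable continuous_intros bounded_linear.continuous_on[OF L(1)] mollify_continuous lH)
            show "integrable lebesgue (\<lambda>x. indicator (cball 0 R) x * (norm (?h x))\<^sup>2)"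
              by (intro ball_int_norm2_integrable mollify_locL2 lH)
            fix x
            have "(L (?h x))\<^sup>2 \<le> (norm (?h x))\<^sup>2"
              using power_mono[OF L(2)[of "?h x"], of 2] by simp
            then show "indicator (cball 0 R) x * (L (?h x))\<^sup>2 \<le> indicator (cball 0 R) x * (norm (?h x))\<^sup>2"
              by (intro mult_left_mono) auto
          qed
          also have "\<dots> \<le> ball_int (R + 1) (\<lambda>x. (norm (H x))\<^sup>2)" by (rule mollify_ball_bound[OF lH])
          also have "\<dots> \<le> e / 2 * (R + 1)" by (rule R1) (use that in simp)
          also have "\<dots> \<le> e / 2 * (2 * R)" using \<open>e > 0\<close> that by (intro mult_left_mono) auto
          finally show ?thesis by simp
        qed
        then show ?thesis by blast
      qed
    qed
    have "AE x in lebesgue. Re (?h x) = 0"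
      by (rule part) (auto intro: bounded_linear_Re abs_Re_le_cmod)
    moreover have "AE x in lebesgue. Im (?h x) = 0"
      by (rule part) (auto intro: bounded_linear_Im abs_Im_le_cmod)
    ultimately have "AE x in lebesgue. indicator (cball 0 r) x * (norm (?h x))\<^sup>2 = 0"
      by eventually_elim (simp add: complex_eq_iff)
    then show ?thesis unfolding ball_int_def by (rule integral_eq_zero_AE)
  qed
  show ?thesis
  proof (rule ball_int_zero_AE[OF lH])
    fix r
    have "(\<lambda>m. ball_int r (\<lambda>x. (norm (mollify m H x))\<^sup>2)) \<longlonglongrightarrow> ball_int r (\<lambda>x. (norm (H x))\<^sup>2)"
      by (rule L2conv_ball_int[OF mollify_converges[OF lH]])
    then have "(\<lambda>m::nat. 0) \<longlonglongrightarrow> ball_int r (\<lambda>x. (norm (H x))\<^sup>2)" unfolding zero .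
    then show "ball_int r (\<lambda>x. (norm (H x))\<^sup>2) \<le> 0" using LIMSEQ_unique[OF _ tendsto_const] by fastforce
  qed
qed

lemma weak_lap_integrable:
  assumes "locL2 u" "test_function UNIV \<phi>"
  shows "integrable lebesgue (\<lambda>x. u x * \<phi> x)" "integrable lebesgue (\<lambda>x. u x * laplacian \<phi> x)"
proof -
  have *: "integrable lebesgue (\<lambda>x. u x * f x)" if f: "test_function UNIV f" for f
  proof -
    obtain r where "\<And>x. norm x > r \<Longrightarrow> f x = 0" using test_function_support[OF f] by blast
    then show ?thesis
      by (rule locL2_times_continuous_integrable[OF assms(1) smooth_continuous[OF test_function_smooth[OF f]]])
  qed
  show "integrable lebesgue (\<lambda>x. u x * \<phi> x)" "integrable lebesgue (\<lambda>x. u x * laplacian \<phi> x)"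
    using *[OF assms(2)] *[OF test_function_laplacian[OF assms(2)]] .
qed

lemma weak_lap_lincomb:
  assumes "weak_lap u p" "weak_lap v q"
  shows "weak_lap (\<lambda>x. a * u x + b * v x) (\<lambda>x. a * p x + b * q x)"
proof -
  have l: "locL2 u" "locL2 p" "locL2 v" "locL2 q" using assms by (auto simp: weak_lap_def)
  have "(LINT x|lebesgue. (a * u x + b * v x) * laplacian \<phi> x) = (LINT x|lebesgue. (a * p x + b * q x) * \<phi> x)"
    if \<phi>: "test_function UNIV \<phi>" for \<phi>
    using weak_lap_integrable[OF l(1) \<phi>] weak_lap_integrable[OF l(2) \<phi>] weak_lap_integrable[OF l(3) \<phi>]
      weak_lap_integrable[OF l(4) \<phi>] assms \<phi> unfolding weak_lap_def
    by (simp add: distrib_right mult.assoc)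
  then show ?thesis unfolding weak_lap_def by (intro conjI locL2_add locL2_cmult l allI impI)
qed

lemma locL2_cong_AE:
  assumes "locL2 f" "AE x in lebesgue. f x = g x" "g \<in> borel_measurable lebesgue"
  shows "locL2 g"
  unfolding locL2_def
proof (intro conjI allI assms(3))
  fix r
  note [measurable] = assms(3) locL2_measurable[OF assms(1)]
  show "integrable lebesgue (\<lambda>x. indicator (cball 0 r) x * (norm (g x))\<^sup>2)"
  proof (rule integrable_cong_AE_imp[OF ball_int_norm2_integrable[OF assms(1), of r]])
    show "AE x in lebesgue. indicator (cball 0 r) x * (norm (f x))\<^sup>2 = indicator (cball 0 r) x * (norm (g x))\<^sup>2"
      using assms(2) by eventually_elim simp
  qed measurable
qed

lemma weak_lap_cong_AE:
  assumes "weak_lap u p" "AE x in lebesgue. p x = q x" "q \<in> borel_measurable lebesgue"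
  shows "weak_lap u q"
proof -
  have l: "locL2 p" using assms(1) by (auto simp: weak_lap_def)
  have "(LINT x|lebesgue. p x * \<phi> x) = (LINT x|lebesgue. q x * \<phi> x)" if \<phi>: "test_function UNIV \<phi>" for \<phi>
  proof (rule integral_cong_AE)
    show "AE x in lebesgue. p x * \<phi> x = q x * \<phi> x" using assms(2) by eventually_elim simp
  qed (intro borel_measurable_times locL2_measurable l assms(3)
      continuous_borel_lebesgue smooth_continuous test_function_smooth \<phi>)+
  then show ?thesis using assms(1) locL2_cong_AE[OF l assms(2,3)] by (simp add: weak_lap_def)
qed

text \<open>For \<open>R \<ge> 2 * R0\<close> the cutoff equals 1 on the support of the source, so
  the source term no longer depends on \<open>R\<close>.\<close>

lemma source_split:
  fixes a :: real
  assumes u: "locL2 u" and \<rho>: "locL2 \<rho>" "\<And>x. norm x \<ge> R0 \<Longrightarrow> \<rho> x = 0" and R: "R \<ge> 2 * R0" "R0 > 0"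
  shows "(LINT x|lebesgue. (of_real a * u x + \<rho> x) * cnj (u x) * complex_of_real (cutoff R x)) =
     complex_of_real (a * (LINT x|lebesgue. cutoff R x * (norm (u x))\<^sup>2)) + (LINT x|lebesgue. \<rho> x * cnj (u x))"
    and "integrable lebesgue (\<lambda>x. \<rho> x * cnj (u x))"
    and "integrable lebesgue (\<lambda>x. cutoff R x * (norm (u x))\<^sup>2)"
proof -
  have Rp: "R > 0" using R by linarith
  have b: "(\<lambda>x. complex_of_real (cutoff R x)) \<in> borel_measurable lebesgue"
    by (intro continuous_borel_lebesgue continuous_intros Ck_on_Suc0_continuous(1)[OF cutoff_C1])
  have bb: "norm (complex_of_real (cutoff R x)) \<le> 1" for x using cutoff_bounds[of R x] by simp
  have bz: "complex_of_real (cutoff R x) = 0" if "norm x > 3 * R" for x using cutoff_support[OF Rp that] by simp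
  have i1: "integrable lebesgue (\<lambda>x. u x * cnj (u x) * complex_of_real (cutoff R x))"
    by (rule locL2_integrable_product[OF u locL2_cnj[OF u] b bb bz])
  have i2: "integrable lebesgue (\<lambda>x. \<rho> x * cnj (u x) * complex_of_real (cutoff R x))"
    by (rule locL2_integrable_product[OF \<rho>(1) locL2_cnj[OF u] b bb bz])
  have e1: "u x * cnj (u x) * complex_of_real (cutoff R x) = complex_of_real (cutoff R x * (norm (u x))\<^sup>2)" for x
    unfolding of_real_mult complex_norm_square by simp
  have e2: "\<rho> x * cnj (u x) * complex_of_real (cutoff R x) = \<rho> x * cnj (u x)" for x
    using \<rho>(2)[of x] cutoff_one[OF Rp, of x] R by (cases "norm x \<ge> R0") auto
  show "integrable lebesgue (\<lambda>x. \<rho> x * cnj (u x))" using i2 unfolding e2 .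
  show "integrable lebesgue (\<lambda>x. cutoff R x * (norm (u x))\<^sup>2)"
    using integrable_Re[OF i1] unfolding e1 by simp
  have "(LINT x|lebesgue. (of_real a * u x + \<rho> x) * cnj (u x) * complex_of_real (cutoff R x)) =
     (LINT x|lebesgue. of_real a * (u x * cnj (u x) * complex_of_real (cutoff R x)) + \<rho> x * cnj (u x) * complex_of_real (cutoff R x))"
    by (intro Bochner_Integration.integral_cong) (auto simp: algebra_simps)
  also have "\<dots> = of_real a * (LINT x|lebesgue. u x * cnj (u x) * complex_of_real (cutoff R x)) + (LINT x|lebesgue. \<rho> x * cnj (u x) * complex_of_real (cutoff R x))"
    using i1 i2 by simp
  also have "\<dots> = complex_of_real (a * (LINT x|lebesgue. cutoff R x * (norm (u x))\<^sup>2)) + (LINT x|lebesgue. \<rho> x * cnj (u x))"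
    unfolding e1 e2 integral_complex_of_real by simp
  finally show "(LINT x|lebesgue. (of_real a * u x + \<rho> x) * cnj (u x) * complex_of_real (cutoff R x)) =
     complex_of_real (a * (LINT x|lebesgue. cutoff R x * (norm (u x))\<^sup>2)) + (LINT x|lebesgue. \<rho> x * cnj (u x))" .
qed

lemma ball_int_mono_fun: "locL2 u \<Longrightarrow> mono (\<lambda>R. ball_int R (\<lambda>x. (norm (u x))\<^sup>2))"
  by (intro monoI ball_int_mono_radius)

lemma weighted_bound_linear_growth:
  assumes u: "locL2 u" and R1: "R1 > 0" and L: "L \<ge> 0" "\<And>R. R \<ge> R1 \<Longrightarrow> weighted_int R u \<le> L" and R: "R \<ge> R1"
  shows "ball_int R (\<lambda>x. (norm (u x))\<^sup>2) \<le> ball_int (2 * R1) (\<lambda>x. (norm (u x))\<^sup>2) + 25 / 2 * L * R"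
proof (rule doubling_linear_growth[OF ball_int_mono_fun[OF u] R1 _ _ R])
  fix R assume R: "R \<ge> R1"
  have "25 / 2 * R * weighted_int R u \<le> 25 / 2 * R * L" using L(2)[OF R] R R1 by (intro mult_left_mono) auto
  then show "ball_int (2 * R) (\<lambda>x. (norm (u x))\<^sup>2) \<le> ball_int R (\<lambda>x. (norm (u x))\<^sup>2) + 25 / 2 * L * R"
    using ball_int_doubling[OF u, of R] R R1 by (simp only: mult.commute[of R L] mult.assoc) linarith
qed (use L in simp)

text \<open>A radiating solution of the modified Helmholtz equation is square integrable, hence carries no
  energy to infinity.\<close>

lemma modified_helmholtz_radiating:
  assumes k: "k > 0" and R0: "R0 > 0" and M: "weak_lap M (\<lambda>x. of_real (k\<^sup>2) * M x + \<sigma> x)"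
    and \<sigma>: "locL2 \<sigma>" "\<And>x. norm x \<ge> R0 \<Longrightarrow> \<sigma> x = 0"
    and v: "AE y in lebesgue. norm y > R0 \<longrightarrow> M y = v y" "C1_outside R0 v" and rad: "radiating k v"
  shows "Im (LINT x|lebesgue. \<sigma> x * cnj (M x)) = 0"
    and "(LINT x|lebesgue. \<sigma> x * cnj (M x)) = 0 \<Longrightarrow> AE x in lebesgue. M x = 0"
proof -
  have lM: "locL2 M" using M by (simp add: weak_lap_def)
  define A where "A R = ball_int R (\<lambda>x. (norm (M x))\<^sup>2)" for R
  have A0: "A R \<ge> 0" for R unfolding A_def by (intro ball_int_nonneg) simp
  define E where "E = (LINT x|lebesgue. \<sigma> x * cnj (M x))"
  have split: "(LINT x|lebesgue. (of_real (k\<^sup>2) * M x + \<sigma> x) * cnj (M x) * complex_of_real (cutoff R x)) =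
     complex_of_real (k\<^sup>2 * (LINT x|lebesgue. cutoff R x * (norm (M x))\<^sup>2)) + E" if "R \<ge> 2 * R0" for R
    unfolding E_def by (rule source_split[OF lM \<sigma> that R0])
  have flux: "\<exists>R1>0. \<forall>R\<ge>R1. k / 2 * weighted_int R M \<le> Im E + e \<and> \<bar>Im E\<bar> \<le> 2 * k * weighted_int R M + e"
    if e: "e > 0" for e
  proof -
    obtain R1 where R1: "R1 > 0" "\<forall>R\<ge>R1.
      k / 2 * weighted_int R M \<le> Im (LINT x|lebesgue. (of_real (k\<^sup>2) * M x + \<sigma> x) * cnj (M x) * complex_of_real (cutoff R x)) + e \<and>
      \<bar>Im (LINT x|lebesgue. (of_real (k\<^sup>2) * M x + \<sigma> x) * cnj (M x) * complex_of_real (cutoff R x))\<bar> \<le> 2 * k * weighted_int R M + e"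
      using radiation_flux[OF k M v rad e R0] by (elim exE conjE)
    show ?thesis
    proof (intro exI[of _ "max R1 (2 * R0)"] conjI allI impI)
      fix R assume "R \<ge> max R1 (2 * R0)"
      then have "R \<ge> R1" "R \<ge> 2 * R0" by auto
      then show "k / 2 * weighted_int R M \<le> Im E + e" "\<bar>Im E\<bar> \<le> 2 * k * weighted_int R M + e"
        using R1(2)[rule_format, of R] split[of R] by auto
    qed (use R1 in simp)
  qed
  \<comment> \<open>The positive sign of \<open>k\<^sup>2\<close> enters here: the mass term stands
    on the side that the Caccioppoli estimate bounds, with \<open>c = 9 / R\<^sup>2\<close>.\<close>
  have cacc: "k\<^sup>2 * A (R / 2) + Re E \<le> 18 / R\<^sup>2 * A (3 * R)" if R: "R \<ge> 2 * R0" for R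
  proof -
    have Rp: "R > 0" using R R0 by linarith
    have "Re (LINT x|lebesgue. (of_real (k\<^sup>2) * M x + \<sigma> x) * cnj (M x) * complex_of_real (cutoff R x)) \<le> 2 * (9 / R\<^sup>2) * A (3 * R)"
      unfolding A_def
      by (rule caccioppoli[OF M cutoff_C1 cutoff_support[OF Rp]]) (use cutoff_partial_square[OF Rp] in \<open>auto intro: cutoff_bounds\<close>)
    then have 1: "k\<^sup>2 * (LINT x|lebesgue. cutoff R x * (norm (M x))\<^sup>2) + Re E \<le> 18 / R\<^sup>2 * A (3 * R)"
      unfolding split[OF R] by simp
    have "A (R / 2) \<le> (LINT x|lebesgue. cutoff R x * (norm (M x))\<^sup>2)"
      unfolding A_def ball_int_def
    proof (rule integral_mono)
      show "indicator (cball 0 (R / 2)) x * (norm (M x))\<^sup>2 \<le> cutoff R x * (norm (M x))\<^sup>2" for x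
        using cutoff_bounds[of R x] cutoff_one[OF Rp, of x] by (cases "norm x \<le> R / 2") auto
    qed (intro ball_int_norm2_integrable lM source_split(3)[OF lM \<sigma> R R0])+
    then have "k\<^sup>2 * A (R / 2) \<le> k\<^sup>2 * (LINT x|lebesgue. cutoff R x * (norm (M x))\<^sup>2)" by (intro mult_left_mono) auto
    with 1 show ?thesis by linarith
  qed
  \<comment> \<open>The flux estimate bounds the weighted means, doubling turns this into linear
    growth of \<open>A\<close>, and the factor \<open>18 / R\<^sup>2\<close> in \<open>cacc\<close>
    outweighs linear growth.\<close>
  have bounded: "\<exists>B. \<forall>R. A R \<le> B"
  proof -
    obtain R1 where R1: "R1 > 0" "\<And>R. R \<ge> R1 \<Longrightarrow> k / 2 * weighted_int R M \<le> Im E + 1" using flux[of 1] by auto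
    define L where "L = 2 * (Im E + 1) / k"
    have wL: "weighted_int R M \<le> L" if "R \<ge> R1" for R using R1(2)[OF that] k by (simp add: L_def field_simps)
    have L: "L \<ge> 0" using wL[of R1] weighted_int_nonneg[of R1 M] by linarith
    have growth: "A R \<le> A (2 * R1) + 25 / 2 * L * R" if "R \<ge> R1" for R
      unfolding A_def by (rule weighted_bound_linear_growth[OF lM R1(1) L wL that])
    define S where "S = 18 * (A (2 * R1) + 75 / 2 * L)"
    have "A R \<le> (S + \<bar>Re E\<bar>) / k\<^sup>2" for R
    proof -
      define T where "T = max (2 * \<bar>R\<bar>) (max 1 (max R1 (2 * R0)))"
      have T: "T \<ge> 2 * R" "T \<ge> 1" "T \<ge> R1" "T \<ge> 2 * R0" unfolding T_def by auto
      have T2: "T\<^sup>2 \<ge> T" "T\<^sup>2 \<ge> 1" using T(2) by (simp_all add: power2_eq_square mult_le_cancel_left1 one_le_power[of T 2, unfolded power2_eq_square])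
      have "A (3 * T) \<le> A (2 * R1) + 25 / 2 * L * (3 * T)" using T by (intro growth) auto
      also have "\<dots> \<le> A (2 * R1) * T\<^sup>2 + 75 / 2 * L * T\<^sup>2"
        using mult_left_mono[OF T2(2) A0[of "2 * R1"]] mult_left_mono[OF T2(1), of "75 / 2 * L"] L by simp
      finally have "18 / T\<^sup>2 * A (3 * T) \<le> 18 / T\<^sup>2 * (A (2 * R1) * T\<^sup>2 + 75 / 2 * L * T\<^sup>2)" by (intro mult_left_mono) auto
      also have "\<dots> = S" using T(2) by (simp add: S_def field_simps)
      finally have "k\<^sup>2 * A (T / 2) + Re E \<le> S" using cacc[OF T(4)] by linarith
      moreover have "k\<^sup>2 * A R \<le> k\<^sup>2 * A (T / 2)"
        using T(1) unfolding A_def by (intro mult_left_mono ball_int_mono_radius lM) auto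
      ultimately have "k\<^sup>2 * A R \<le> S + \<bar>Re E\<bar>" by linarith
      then show ?thesis using k by (simp add: field_simps)
    qed
    then show ?thesis by blast
  qed
  then obtain B0 where B0: "\<And>R. A R \<le> B0" by blast
  define B where "B = max B0 1"
  have B: "A R \<le> B" "B > 0" for R using B0[of R] by (auto simp: B_def)
  have "\<bar>Im E\<bar> \<le> 0"
  proof (rule field_le_epsilon)
    fix e :: real assume e: "e > 0"
    obtain R1 where R1: "R1 > 0" "\<And>R. R \<ge> R1 \<Longrightarrow> \<bar>Im E\<bar> \<le> 2 * k * weighted_int R M + e / 2" using flux[of "e / 2"] e by auto
    \<comment> \<open>Boundedness of \<open>A\<close> makes the weighted mean at most
      \<open>6 * B / R\<close>; the threshold reduces \<open>12 * k * B / R\<close> to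
      \<open>e / 2\<close>.\<close>
    define R where "R = max R1 (24 * k * B / e)"
    have R: "R \<ge> R1" "R > 0" "24 * k * B / e \<le> R" using R1 by (auto simp: R_def)
    have "weighted_int R M \<le> 6 / R * A (3 * R)" unfolding A_def by (rule weighted_int_le[OF lM R(2)])
    also have "\<dots> \<le> 6 / R * B" using R B by (intro mult_left_mono) auto
    finally have "2 * k * weighted_int R M \<le> 2 * k * (6 / R * B)" using k by (intro mult_left_mono) auto
    also have "\<dots> = 12 * k * B / R" by simp
    also have "\<dots> \<le> e / 2" using R e by (simp add: field_simps)
    finally show "\<bar>Im E\<bar> \<le> 0 + e" using R1(2)[OF R(1)] by simp
  qed
  then show "Im (LINT x|lebesgue. \<sigma> x * cnj (M x)) = 0" by (simp add: E_def)
  \<comment> \<open>With \<open>E = 0\<close> only the mass remains on the left of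
    \<open>cacc\<close>, and the right side is at most \<open>18 * B / R\<^sup>2\<close>.\<close>
  show "AE x in lebesgue. M x = 0" if "(LINT x|lebesgue. \<sigma> x * cnj (M x)) = 0"
  proof (rule ball_int_zero_AE[OF lM])
    have E: "E = 0" using that by (simp add: E_def)
    fix r
    show "ball_int r (\<lambda>x. (norm (M x))\<^sup>2) \<le> 0"
    proof (rule field_le_epsilon)
      fix e :: real assume e: "e > 0"
      define R where "R = max (max (2 * \<bar>r\<bar>) 1) (max (2 * R0) (18 * B / (k\<^sup>2 * e)))"
      have R: "R \<ge> 2 * r" "R \<ge> 1" "R \<ge> 2 * R0" "R \<ge> 18 * B / (k\<^sup>2 * e)" unfolding R_def by auto
      have "R * 1 \<le> R * R" using R(2) by (intro mult_left_mono) auto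
      then have R2: "18 * B / (k\<^sup>2 * e) \<le> R\<^sup>2" using R(4) by (simp add: power2_eq_square)
      have "k\<^sup>2 * A (R / 2) \<le> 18 / R\<^sup>2 * A (3 * R)" using cacc[OF R(3)] E by simp
      also have "\<dots> \<le> 18 / R\<^sup>2 * B" using B by (intro mult_left_mono) auto
      also have "\<dots> \<le> k\<^sup>2 * e"
      proof -
        have "R\<^sup>2 > 0" using R(2) by simp
        moreover have "18 * B \<le> R\<^sup>2 * (k\<^sup>2 * e)" using R2 k e by (simp add: pos_divide_le_eq)
        ultimately show ?thesis by (simp add: divide_le_eq mult_ac)
      qed
      finally have "A (R / 2) \<le> e" using k by simp
      moreover have "A r \<le> A (R / 2)" using R(1) unfolding A_def by (intro ball_int_mono_radius lM) auto
      ultimately show "ball_int r (\<lambda>x. (norm (M x))\<^sup>2) \<le> 0 + e" by (simp add: A_def)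
    qed
  qed
qed

text \<open>The flux is \<open>Im E\<close> up to an arbitrarily small error and dominates a
  nonnegative weighted mean. Without a source \<open>E = 0\<close>, so the weighted means tend to 0
  and doubling gives the o(R) growth that forces \<open>H\<close> to vanish.\<close>

lemma helmholtz_radiating:
  assumes k: "k > 0" and R0: "R0 > 0" and H: "weak_lap H (\<lambda>x. of_real (- k\<^sup>2) * H x + \<sigma> x)"
    and \<sigma>: "locL2 \<sigma>" "\<And>x. norm x \<ge> R0 \<Longrightarrow> \<sigma> x = 0"
    and v: "AE y in lebesgue. norm y > R0 \<longrightarrow> H y = v y" "C1_outside R0 v" and rad: "radiating k v"
  shows "Im (LINT x|lebesgue. \<sigma> x * cnj (H x)) \<ge> 0"
    and "AE x in lebesgue. \<sigma> x = 0 \<Longrightarrow> AE x in lebesgue. H x = 0"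
proof -
  have lH: "locL2 H" using H by (simp add: weak_lap_def)
  define E where "E = (LINT x|lebesgue. \<sigma> x * cnj (H x))"
  have flux: "\<exists>R1>0. \<forall>R\<ge>R1. k / 2 * weighted_int R H \<le> Im E + e" if e: "e > 0" for e
  proof -
    obtain R1 where R1: "R1 > 0" "\<forall>R\<ge>R1.
      k / 2 * weighted_int R H \<le> Im (LINT x|lebesgue. (of_real (- k\<^sup>2) * H x + \<sigma> x) * cnj (H x) * complex_of_real (cutoff R x)) + e \<and>
      \<bar>Im (LINT x|lebesgue. (of_real (- k\<^sup>2) * H x + \<sigma> x) * cnj (H x) * complex_of_real (cutoff R x))\<bar> \<le> 2 * k * weighted_int R H + e"
      using radiation_flux[OF k H v rad e R0] by (elim exE conjE)
    show ?thesis
    proof (intro exI[of _ "max R1 (2 * R0)"] conjI allI impI)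
      fix R assume "R \<ge> max R1 (2 * R0)"
      then have "R \<ge> R1" "R \<ge> 2 * R0" by auto
      then show "k / 2 * weighted_int R H \<le> Im E + e"
        using R1(2)[rule_format, of R] source_split(1)[OF lH \<sigma>, where R = R and a = "- k\<^sup>2"] R0 unfolding E_def by simp
    qed (use R1 in simp)
  qed
  show "Im (LINT x|lebesgue. \<sigma> x * cnj (H x)) \<ge> 0"
    unfolding E_def[symmetric]
  proof (rule field_le_epsilon)
    fix e :: real assume "e > 0"
    then obtain R1 where R1: "\<And>R. R \<ge> R1 \<Longrightarrow> k / 2 * weighted_int R H \<le> Im E + e" using flux by blast
    have "0 \<le> k / 2 * weighted_int R1 H" using k weighted_int_nonneg by simp
    then show "0 \<le> Im E + e" using R1[OF order_refl] by linarith
  qed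
  show "AE x in lebesgue. H x = 0" if z: "AE x in lebesgue. \<sigma> x = 0"
  proof (rule helmholtz_decay_zero[OF _ k])
    show "weak_lap H (\<lambda>x. - (of_real k)\<^sup>2 * H x)"
    proof (rule weak_lap_cong_AE[OF H])
      show "AE x in lebesgue. of_real (- k\<^sup>2) * H x + \<sigma> x = - (of_real k)\<^sup>2 * H x"
        using z by eventually_elim simp
      show "(\<lambda>x. - (of_real k)\<^sup>2 * H x) \<in> borel_measurable lebesgue"
        by (intro borel_measurable_times locL2_measurable[OF lH]) simp
    qed
    have "AE x in lebesgue. \<sigma> x * cnj (H x) = 0" using z by eventually_elim simp
    then have E: "E = 0" unfolding E_def by (rule integral_eq_zero_AE)
    fix e :: real assume e: "e > 0"
    \<comment> \<open>The constant yields a weighted mean of at most \<open>e / 25\<close>. The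
      doubling factor \<open>25 / 2\<close> turns this into \<open>e / 2 * R\<close>, and the other
      half of \<open>e * R\<close> absorbs the fixed term \<open>K\<close>.\<close>
    then obtain R1 where R1: "R1 > 0" "\<And>R. R \<ge> R1 \<Longrightarrow> k / 2 * weighted_int R H \<le> k * e / 50"
      using flux[of "k * e / 50"] k E by auto
    have w: "weighted_int R H \<le> e / 25" if "R \<ge> R1" for R using R1(2)[OF that] k by (simp add: field_simps)
    define K where "K = ball_int (2 * R1) (\<lambda>x. (norm (H x))\<^sup>2)"
    have "ball_int R (\<lambda>x. (norm (H x))\<^sup>2) \<le> e * R" if R: "R \<ge> max R1 (2 * K / e)" for R
    proof -
      have "ball_int R (\<lambda>x. (norm (H x))\<^sup>2) \<le> K + 25 / 2 * (e / 25) * R"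
        unfolding K_def by (rule weighted_bound_linear_growth[OF lH R1(1) _ w]) (use e R in auto)
      moreover have "K \<le> e / 2 * R" using R e by (simp add: field_simps)
      ultimately show ?thesis by simp
    qed
    then show "\<exists>R1. \<forall>R\<ge>R1. ball_int R (\<lambda>x. (norm (H x))\<^sup>2) \<le> e * R" by blast
  qed
qed

text \<open>As \<open>w = H + M\<close>, the integrals of \<rho> against \<open>cnj H\<close> and
  \<open>cnj M\<close> add up to the one against \<open>cnj w\<close>. The source of
  \<open>M\<close> is -\<rho>, a sign without effect because the imaginary part in question is 0.
  \<open>h\<close> and \<open>m\<close> are the classical exterior representatives of
  \<open>H\<close> and \<open>M\<close>.\<close>

lemma biharmonic_uniqueness:
  assumes k: "k > 0" and R0: "R0 > 0" and D: "D \<in> sets lebesgue" "\<And>x. x \<in> D \<Longrightarrow> norm x < R0"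
    and n: "n \<in> borel_measurable lebesgue" "AE x in lebesgue. x \<notin> D \<longrightarrow> n x = 1"
      "AE x in lebesgue. x \<in> D \<longrightarrow> norm (n x) \<le> B" "c > 0" "AE x in lebesgue. x \<in> D \<longrightarrow> Im (n x) \<ge> c"
    and w: "weak_lap w g" "weak_lap g (\<lambda>x. of_real k ^ 4 * n x * w x)"
    and h: "AE y in lebesgue. norm y > R0 \<longrightarrow> 1 / 2 * w y + (- 1 / (2 * (of_real k)\<^sup>2)) * g y = h y" "C1_outside R0 h" "radiating k h"
    and m: "AE y in lebesgue. norm y > R0 \<longrightarrow> 1 / 2 * w y + (1 / (2 * (of_real k)\<^sup>2)) * g y = m y" "C1_outside R0 m" "radiating k m"
  shows "AE x in lebesgue. w x = 0"
proof -
  have lw: "locL2 w" "locL2 g" using w by (auto simp: weak_lap_def)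
  define \<kappa> :: complex where "\<kappa> = (of_real k)\<^sup>2"
  have \<kappa>: "\<kappa> \<noteq> 0" "of_real k ^ 4 = \<kappa> * \<kappa>" using k by (auto simp: \<kappa>_def power2_eq_square eval_nat_numeral)
  define H where "H x = 1 / 2 * w x + (- 1 / (2 * \<kappa>)) * g x" for x
  define M where "M x = 1 / 2 * w x + (1 / (2 * \<kappa>)) * g x" for x
  have lH: "locL2 H" "locL2 M" unfolding H_def[abs_def] M_def[abs_def] by (intro locL2_add locL2_cmult lw)+
  note [measurable] = locL2_measurable[OF lw(1)] locL2_measurable[OF lw(2)] locL2_measurable[OF lH(1)]
    locL2_measurable[OF lH(2)] n(1) D(1)
  \<comment> \<open>The case distinction makes the source vanish at every point off
    \<open>D\<close>, as the radiating lemmas demand, whereas \<open>n = 1\<close> holds there only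
    almost everywhere.\<close>
  define b where "b x = (if x \<in> D then \<kappa> / 2 * (1 - n x) else 0)" for x
  have bm [measurable]: "b \<in> borel_measurable lebesgue" unfolding b_def[abs_def] by measurable
  define \<rho> where "\<rho> x = b x * w x" for x
  have l\<rho>: "locL2 \<rho>" unfolding \<rho>_def[abs_def]
  proof (rule locL2_mult[OF lw(1) bm])
    fix r :: real
    have "AE x in lebesgue. norm (b x) \<le> norm (\<kappa> / 2) * (1 + \<bar>B\<bar>)"
      using n(3)
    proof eventually_elim
      case (elim x)
      have "norm (1 - n x) \<le> 1 + \<bar>B\<bar>" if "x \<in> D"
        using norm_triangle_ineq4[of 1 "n x"] elim that by simp
      then show ?case unfolding b_def
        by (cases "x \<in> D") (auto simp: norm_mult intro!: mult_left_mono divide_right_mono simp del: norm_divide)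
    qed
    then show "\<exists>B. AE x in lebesgue. norm x \<le> r \<longrightarrow> norm (b x) \<le> B"
      by (intro exI[of _ "norm (\<kappa> / 2) * (1 + \<bar>B\<bar>)"]) (auto elim: eventually_mono)
  qed
  have \<rho>0: "\<rho> x = 0" if "norm x \<ge> R0" for x using D(2)[of x] that by (auto simp: \<rho>_def b_def)
  have lm\<rho>: "locL2 (\<lambda>x. - 1 * \<rho> x)" by (rule locL2_cmult[OF l\<rho>])
  have \<rho>m [measurable]: "\<rho> \<in> borel_measurable lebesgue" by (rule locL2_measurable[OF l\<rho>])
  have wH: "weak_lap H (\<lambda>x. of_real (- k\<^sup>2) * H x + \<rho> x)"
  proof (rule weak_lap_cong_AE[OF weak_lap_lincomb[OF w, of "1 / 2" "- 1 / (2 * \<kappa>)", folded H_def]])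
    show "AE x in lebesgue. 1 / 2 * g x + - 1 / (2 * \<kappa>) * (of_real k ^ 4 * n x * w x) = of_real (- k\<^sup>2) * H x + \<rho> x"
      using n(2)
    proof eventually_elim
      case (elim x)
      have "of_real (- k\<^sup>2) = - \<kappa>" by (simp add: \<kappa>_def)
      then show ?case using elim \<kappa> unfolding H_def \<rho>_def b_def \<kappa>(2)
        by (cases "x \<in> D") (auto simp: field_simps)
    qed
  qed measurable
  have wM: "weak_lap M (\<lambda>x. of_real (k\<^sup>2) * M x + - 1 * \<rho> x)"
  proof (rule weak_lap_cong_AE[OF weak_lap_lincomb[OF w, of "1 / 2" "1 / (2 * \<kappa>)", folded M_def]])
    show "AE x in lebesgue. 1 / 2 * g x + 1 / (2 * \<kappa>) * (of_real k ^ 4 * n x * w x) = of_real (k\<^sup>2) * M x + - 1 * \<rho> x"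
      using n(2)
    proof eventually_elim
      case (elim x)
      have "of_real (k\<^sup>2) = \<kappa>" by (simp add: \<kappa>_def)
      then show ?case using elim \<kappa> unfolding M_def \<rho>_def b_def \<kappa>(2)
        by (cases "x \<in> D") (auto simp: field_simps)
    qed
  qed measurable
  have aH: "AE y in lebesgue. norm y > R0 \<longrightarrow> H y = h y" using h(1) unfolding H_def \<kappa>_def .
  have aM: "AE y in lebesgue. norm y > R0 \<longrightarrow> M y = m y" using m(1) unfolding M_def \<kappa>_def .
  have m\<rho>0: "- 1 * \<rho> x = 0" if "norm x \<ge> R0" for x using \<rho>0[OF that] by simp
  note radM = modified_helmholtz_radiating[OF k R0 wM lm\<rho> m\<rho>0 aM m(2,3)]
  note radH = helmholtz_radiating[OF k R0 wH l\<rho> \<rho>0 aH h(2,3)]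
  have iH: "integrable lebesgue (\<lambda>x. \<rho> x * cnj (H x))" and iM: "integrable lebesgue (\<lambda>x. \<rho> x * cnj (M x))"
    using source_split(2)[OF lH(1) l\<rho> \<rho>0 order_refl R0] source_split(2)[OF lH(2) l\<rho> \<rho>0 order_refl R0] by auto
  have wHM: "w x = H x + M x" for x unfolding H_def M_def using \<kappa>(1) by (simp add: field_simps)
  have sum: "(LINT x|lebesgue. \<rho> x * cnj (w x)) = (LINT x|lebesgue. \<rho> x * cnj (H x)) + (LINT x|lebesgue. \<rho> x * cnj (M x))"
    unfolding wHM complex_cnj_add distrib_left by (rule Bochner_Integration.integral_add[OF iH iM])
  have iw: "integrable lebesgue (\<lambda>x. \<rho> x * cnj (w x))"
    unfolding wHM complex_cnj_add distrib_left by (rule Bochner_Integration.integrable_add[OF iH iM])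
  have "Im (LINT x|lebesgue. \<rho> x * cnj (M x)) = 0" using radM(1) by simp
  then have "0 \<le> Im (LINT x|lebesgue. \<rho> x * cnj (w x))" using radH(1) sum by simp
  also have "\<dots> = (LINT x|lebesgue. Im (\<rho> x * cnj (w x)))" by (rule integral_Im[OF iw, symmetric])
  finally have ge: "0 \<le> (LINT x|lebesgue. Im (\<rho> x * cnj (w x)))" .
  \<comment> \<open>In \<open>D\<close> the expression is \<open>- (k\<^sup>2 / 2)\<close> times
    \<open>Im n\<close> times the squared modulus of \<open>w\<close>, with \<open>Im n > 0\<close>.
    An integral that is both nonnegative and of a nonpositive function then forces
    \<open>w = 0\<close> there.\<close>
  have neg: "AE x in lebesgue. (x \<in> D \<longrightarrow> w x = 0) = (Im (\<rho> x * cnj (w x)) = 0) \<and> Im (\<rho> x * cnj (w x)) \<le> 0"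
    using n(5)
  proof eventually_elim
    case (elim x)
    show ?case
    proof (cases "x \<in> D")
      case True
      have "\<rho> x * cnj (w x) = \<kappa> / 2 * (1 - n x) * complex_of_real ((norm (w x))\<^sup>2)"
        using True unfolding \<rho>_def b_def complex_norm_square by simp
      moreover have "\<kappa> / 2 = complex_of_real (k\<^sup>2 / 2)" by (simp add: \<kappa>_def)
      ultimately have e: "Im (\<rho> x * cnj (w x)) = - (k\<^sup>2 / 2 * Im (n x) * (norm (w x))\<^sup>2)"
        by (simp add: Im_complex_of_real Re_complex_of_real del: of_real_power of_real_divide)
      have "Im (n x) > 0" using elim True n(4) by auto
      then show ?thesis unfolding e using k by (auto simp: True)
    next
      case False
      then show ?thesis by (simp add: \<rho>_def b_def)
    qed
  qed
  have iI: "integrable lebesgue (\<lambda>x. Im (\<rho> x * cnj (w x)))" by (rule integrable_Im[OF iw])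
  have "(LINT x|lebesgue. - Im (\<rho> x * cnj (w x))) = 0"
  proof -
    have "0 \<le> (LINT x|lebesgue. - Im (\<rho> x * cnj (w x)))"
      using neg by (intro integral_nonneg_AE) (auto elim: eventually_mono)
    then show ?thesis using ge by (simp only: Bochner_Integration.integral_minus)
  qed
  moreover have "AE x in lebesgue. 0 \<le> - Im (\<rho> x * cnj (w x))" using neg by eventually_elim simp
  ultimately have "AE x in lebesgue. - Im (\<rho> x * cnj (w x)) = 0"
    using integral_nonneg_eq_0_iff_AE[OF Bochner_Integration.integrable_minus[OF iI]] by blast
  then have "AE x in lebesgue. x \<in> D \<longrightarrow> w x = 0" using neg by eventually_elim auto
  then have \<rho>z: "AE x in lebesgue. \<rho> x = 0" by eventually_elim (auto simp: \<rho>_def b_def)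
  have "AE x in lebesgue. H x = 0" by (rule radH(2)[OF _ \<rho>z])
  moreover have "AE x in lebesgue. M x = 0"
  proof -
    have "(LINT x|lebesgue. - 1 * \<rho> x * cnj (M x)) = 0"
    proof (rule integral_eq_zero_AE)
      show "AE x in lebesgue. - 1 * \<rho> x * cnj (M x) = 0" using \<rho>z by eventually_elim simp
    qed
    then show ?thesis by (intro radM(2))
  qed
  ultimately show ?thesis by eventually_elim (simp add: wHM)
qed

subsection \<open>The scattering problem\<close>

lemma L2_loc_locL2:
  assumes "L2_loc UNIV f" shows "locL2 f"
proof -
  have K: "set_borel_measurable lebesgue (cball 0 r) f" "set_integrable lebesgue (cball 0 r) (\<lambda>x. (norm (f x))\<^sup>2)" for r
    using assms compact_cball[of "0::real^2" r] unfolding L2_loc_def L2_on_def by blast+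
  have "f \<in> borel_measurable lebesgue"
  proof (rule borel_measurable_LIMSEQ_metric)
    show "(\<lambda>x. indicator (cball 0 (real n)) x *\<^sub>R f x) \<in> borel_measurable lebesgue" for n
      using K(1) by (simp add: set_borel_measurable_def)
    fix x :: "real^2"
    obtain n0 where "norm x \<le> real n0" using real_arch_simple by blast
    then have "\<forall>n\<ge>n0. indicator (cball 0 (real n)) x *\<^sub>R f x = f x" by (auto simp: indicator_def)
    then show "(\<lambda>n. indicator (cball 0 (real n)) x *\<^sub>R f x) \<longlonglongrightarrow> f x"
      by (intro tendsto_eventually) (auto simp: eventually_sequentially)
  qed
  then show ?thesis using K(2) by (simp add: locL2_def set_integrable_def)
qed

lemma H2_loc_weak_lap:
  assumes "H2_loc f" obtains g where "weak_lap f g"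
proof -
  obtain g h where w: "\<And>i. weak_partial UNIV i f (g i)" "\<And>i. L2_loc UNIV (g i)"
    "\<And>i j. weak_partial UNIV j (g i) (h i j)" "\<And>i j. L2_loc UNIV (h i j)" and f: "L2_loc UNIV f"
    using assms unfolding H2_loc_def by blast
  have l: "locL2 f" "locL2 (h i j)" for i j using f w by (auto intro: L2_loc_locL2)
  have "(LINT x|lebesgue. f x * laplacian \<phi> x) = (LINT x|lebesgue. (h 1 1 x + h 2 2 x) * \<phi> x)"
    if \<phi>: "test_function UNIV \<phi>" for \<phi>
  proof -
    have *: "(LINT x|lebesgue. f x * partial_deriv i (partial_deriv i \<phi>) x) = (LINT x|lebesgue. h i i x * \<phi> x)" for i
    proof -
      have "(LINT x|lebesgue. f x * partial_deriv i (partial_deriv i \<phi>) x) = - (LINT x|lebesgue. g i x * partial_deriv i \<phi> x)"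
        using w(1)[of i] test_function_partial[OF \<phi>, of i] unfolding weak_partial_def set_lebesgue_integral_def by simp
      also have "\<dots> = (LINT x|lebesgue. h i i x * \<phi> x)"
        using w(3)[of i i] \<phi> unfolding weak_partial_def set_lebesgue_integral_def by simp
      finally show ?thesis .
    qed
    have i: "integrable lebesgue (\<lambda>x. f x * partial_deriv i (partial_deriv i \<phi>) x)" for i
      by (rule weak_lap_integrable(1)[OF l(1)]) (intro test_function_partial \<phi>)
    show ?thesis
      using i weak_lap_integrable(1)[OF l(2) \<phi>] *[of 1] *[of 2]
      by (simp add: laplacian_2 distrib_left distrib_right)
  qed
  then have "weak_lap f (\<lambda>x. h 1 1 x + h 2 2 x)" unfolding weak_lap_def by (intro conjI locL2_add l allI impI)
  then show ?thesis by (rule that)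
qed

text \<open>Testing the weak Laplacians with the Laplacian of \<phi> turns the bi-Laplacian into a
  weak Laplacian of \<open>g\<close>. The two right-hand sides are one and the same number and
  cancel.\<close>

lemma biharmonic_difference:
  assumes w: "weak_lap u1 g1" "weak_lap u2 g2"
    and b: "biharmonic_equation k n ui u1" "biharmonic_equation k n ui u2"
    and n: "n \<in> borel_measurable lebesgue" "AE x in lebesgue. norm (n x) \<le> B"
  shows "weak_lap (\<lambda>x. 1 * g1 x + (-1) * g2 x) (\<lambda>x. of_real k ^ 4 * n x * (1 * u1 x + (-1) * u2 x))"
proof -
  have l: "locL2 u1" "locL2 u2" "locL2 g1" "locL2 g2" using w by (auto simp: weak_lap_def)
  have ln: "locL2 (\<lambda>x. of_real k ^ 4 * n x * u x)" if u: "locL2 u" for u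
  proof (rule locL2_mult[OF u])
    show "(\<lambda>x. of_real k ^ 4 * n x) \<in> borel_measurable lebesgue" using n(1) by measurable
    show "\<exists>B. AE x in lebesgue. norm x \<le> r \<longrightarrow> norm (of_real k ^ 4 * n x) \<le> B" for r
    proof (intro exI[of _ "norm (complex_of_real k ^ 4) * B"])
      show "AE x in lebesgue. norm x \<le> r \<longrightarrow> norm (of_real k ^ 4 * n x) \<le> norm (complex_of_real k ^ 4) * B"
        using n(2) by eventually_elim (simp add: norm_mult mult_left_mono)
    qed
  qed
  have "(LINT x|lebesgue. (1 * g1 x + (-1) * g2 x) * laplacian \<phi> x) =
      (LINT x|lebesgue. of_real k ^ 4 * n x * (1 * u1 x + (-1) * u2 x) * \<phi> x)"
    if \<phi>: "test_function UNIV \<phi>" for \<phi>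
  proof -
    note \<phi>' = test_function_laplacian[OF \<phi>]
    have g: "(LINT x|lebesgue. g1 x * laplacian \<phi> x) = (LINT x|lebesgue. u1 x * laplacian (laplacian \<phi>) x)"
      "(LINT x|lebesgue. g2 x * laplacian \<phi> x) = (LINT x|lebesgue. u2 x * laplacian (laplacian \<phi>) x)"
      using w \<phi>' by (auto simp: weak_lap_def)
    have i1: "integrable lebesgue (\<lambda>x. u x * laplacian (laplacian \<phi>) x)" "integrable lebesgue (\<lambda>x. of_real k ^ 4 * n x * u x * \<phi> x)"
      if "locL2 u" for u
      using weak_lap_integrable(2)[OF that \<phi>'] weak_lap_integrable(1)[OF ln[OF that] \<phi>] by auto
    have e: "(LINT x|lebesgue. u1 x * laplacian (laplacian \<phi>) x - of_real k ^ 4 * n x * u1 x * \<phi> x) =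
       (LINT x|lebesgue. u2 x * laplacian (laplacian \<phi>) x - of_real k ^ 4 * n x * u2 x * \<phi> x)"
      using b \<phi> by (simp add: biharmonic_equation_def)
    have e': "(LINT x|lebesgue. u1 x * laplacian (laplacian \<phi>) x) - (LINT x|lebesgue. of_real k ^ 4 * n x * u1 x * \<phi> x) =
       (LINT x|lebesgue. u2 x * laplacian (laplacian \<phi>) x) - (LINT x|lebesgue. of_real k ^ 4 * n x * u2 x * \<phi> x)"
      using e i1[OF l(1)] i1[OF l(2)] by (simp only: Bochner_Integration.integral_diff)
    have "(LINT x|lebesgue. (1 * g1 x + (-1) * g2 x) * laplacian \<phi> x) = (LINT x|lebesgue. g1 x * laplacian \<phi> x - g2 x * laplacian \<phi> x)"
      by (simp add: left_diff_distrib)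
    also have "\<dots> = (LINT x|lebesgue. u1 x * laplacian (laplacian \<phi>) x) - (LINT x|lebesgue. u2 x * laplacian (laplacian \<phi>) x)"
      unfolding g[symmetric] by (intro Bochner_Integration.integral_diff weak_lap_integrable \<phi> l)
    also have "\<dots> = (LINT x|lebesgue. of_real k ^ 4 * n x * u1 x * \<phi> x) - (LINT x|lebesgue. of_real k ^ 4 * n x * u2 x * \<phi> x)"
      using e' by (simp add: algebra_simps)
    also have "\<dots> = (LINT x|lebesgue. of_real k ^ 4 * n x * u1 x * \<phi> x - of_real k ^ 4 * n x * u2 x * \<phi> x)"
      by (intro Bochner_Integration.integral_diff[symmetric] i1 l)
    also have "\<dots> = (LINT x|lebesgue. of_real k ^ 4 * n x * (1 * u1 x + (-1) * u2 x) * \<phi> x)"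
      by (intro Bochner_Integration.integral_cong) (auto simp: algebra_simps)
    finally show ?thesis .
  qed
  then show ?thesis unfolding weak_lap_def by (intro conjI ln locL2_add locL2_cmult l allI impI)
qed

lemma C1_outside_lincomb:
  assumes "C1_outside R u" "C1_outside R v"
  shows "C1_outside R (\<lambda>x. a * u x + b * v x)"
    and "norm x > R \<Longrightarrow> directional_deriv d (\<lambda>x. a * u x + b * v x) x = a * directional_deriv d u x + b * directional_deriv d v x"
proof -
  have d: "u differentiable (at x)" "v differentiable (at x)" if "norm x > R" for x
    using assms that by (auto simp: C1_outside_def)
  have D: "((\<lambda>x. a * u x + b * v x) has_derivative (\<lambda>h. a * frechet_derivative u (at x) h + b * frechet_derivative v (at x) h)) (at x)"
    if "norm x > R" for x
    using d[OF that] by (intro has_derivative_add has_derivative_mult_right) (auto simp: frechet_derivative_works)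
  have p: "partial_deriv i (\<lambda>x. a * u x + b * v x) x = a * partial_deriv i u x + b * partial_deriv i v x" if "norm x > R" for i x
    unfolding partial_deriv_eq[OF D[OF that]] by (simp add: partial_deriv_def)
  show "C1_outside R (\<lambda>x. a * u x + b * v x)"
    unfolding C1_outside_def
  proof (intro conjI allI impI)
    show "(\<lambda>x. a * u x + b * v x) differentiable (at x)" if "norm x > R" for x
      using D[OF that] by (auto simp: differentiable_def)
    show "continuous_on {x. norm x > R} (partial_deriv i (\<lambda>x. a * u x + b * v x))" for i
    proof (rule continuous_on_eq)
      show "continuous_on {x. norm x > R} (\<lambda>x. a * partial_deriv i u x + b * partial_deriv i v x)"
        using assms by (intro continuous_intros) (auto simp: C1_outside_def)
    qed (simp add: p)
  qed
  show "directional_deriv d (\<lambda>x. a * u x + b * v x) x = a * directional_deriv d u x + b * directional_deriv d v x" if "norm x > R"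
    unfolding directional_deriv_def frechet_derivative_at[OF D[OF that], symmetric] ..
qed

lemma radiating_lincomb:
  assumes "C1_outside R u" "C1_outside R v" "radiating k u" "radiating k v"
  shows "radiating k (\<lambda>x. a * u x + b * v x)"
  unfolding radiating_def
proof (intro allI impI)
  fix e :: real assume "e > 0"
  define N where "N = 2 * (norm a)\<^sup>2 + 2 * (norm b)\<^sup>2 + 1"
  have N: "N > 0" unfolding N_def by (intro add_nonneg_pos) auto
  let ?z = "\<lambda>u x. directional_deriv (sgn x) u x - \<i> * of_real k * u x"
  obtain R1 where R1: "\<And>x. norm x \<ge> R1 \<Longrightarrow> norm x * (norm (?z u x))\<^sup>2 \<le> e / N"
    using assms(3) \<open>e > 0\<close> N unfolding radiating_def by (meson divide_pos_pos)
  obtain R2 where R2: "\<And>x. norm x \<ge> R2 \<Longrightarrow> norm x * (norm (?z v x))\<^sup>2 \<le> e / N"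
    using assms(4) \<open>e > 0\<close> N unfolding radiating_def by (meson divide_pos_pos)
  have "norm x * (norm (?z (\<lambda>x. a * u x + b * v x) x))\<^sup>2 \<le> e" if x: "norm x \<ge> max (R + 1) (max R1 R2)" for x
  proof -
    have x': "norm x > R" "norm x \<ge> R1" "norm x \<ge> R2" using x by auto
    have "?z (\<lambda>x. a * u x + b * v x) x = a * ?z u x + b * ?z v x"
      by (simp add: C1_outside_lincomb(2)[OF assms(1,2) x'(1)] algebra_simps)
    then have "(norm (?z (\<lambda>x. a * u x + b * v x) x))\<^sup>2 \<le> (norm (a * ?z u x) + norm (b * ?z v x))\<^sup>2"
      by (intro power_mono) (auto intro: norm_triangle_ineq)
    also have "\<dots> \<le> 2 * (norm (a * ?z u x))\<^sup>2 + 2 * (norm (b * ?z v x))\<^sup>2"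
      using sum_squares_bound[of "norm (a * ?z u x)" "norm (b * ?z v x)"] by (simp add: power2_sum)
    finally have "norm x * (norm (?z (\<lambda>x. a * u x + b * v x) x))\<^sup>2 \<le> norm x * (2 * (norm (a * ?z u x))\<^sup>2 + 2 * (norm (b * ?z v x))\<^sup>2)"
      by (intro mult_left_mono) auto
    also have "\<dots> = 2 * (norm a)\<^sup>2 * (norm x * (norm (?z u x))\<^sup>2) + 2 * (norm b)\<^sup>2 * (norm x * (norm (?z v x))\<^sup>2)"
      by (simp only: norm_mult power_mult_distrib distrib_left mult_ac)
    also have "\<dots> \<le> 2 * (norm a)\<^sup>2 * (e / N) + 2 * (norm b)\<^sup>2 * (e / N)"
      using R1[OF x'(2)] R2[OF x'(3)] by (intro add_mono mult_left_mono) auto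
    also have "\<dots> = (2 * (norm a)\<^sup>2 + 2 * (norm b)\<^sup>2) * (e / N)" by (simp add: algebra_simps)
    also have "\<dots> \<le> N * (e / N)" using N \<open>e > 0\<close> by (intro mult_right_mono) (auto simp: N_def)
    finally show ?thesis using N by simp
  qed
  then show "\<exists>R. \<forall>x. norm x \<ge> R \<longrightarrow> norm x * (norm (?z (\<lambda>x. a * u x + b * v x) x))\<^sup>2 \<le> e" by blast
qed

lemma L2conv_restrict:
  assumes "L2conv F f" "S \<in> sets lebesgue"
  shows "L2conv (\<lambda>m x. indicator S x * F m x) (\<lambda>x. indicator S x * f x)"
proof -
  have l: "locL2 (F m)" "locL2 f" for m using assms by (auto simp: L2conv_def)
  have li: "locL2 (\<lambda>x. indicator S x * g x)" if "locL2 g" for g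
    by (rule locL2_mult[OF that]) (use assms(2) in \<open>auto intro!: exI[of _ 1] simp: indicator_def\<close>)
  have le: "ball_int r (\<lambda>x. (norm (indicator S x * F m x - indicator S x * f x))\<^sup>2) \<le> ball_int r (\<lambda>x. (norm (F m x - f x))\<^sup>2)" for r m
    unfolding ball_int_def
    by (intro integral_mono ball_int_norm2_integrable locL2_diff li l) (auto simp: indicator_def)
  have "(\<lambda>m. ball_int r (\<lambda>x. (norm (indicator S x * F m x - indicator S x * f x))\<^sup>2)) \<longlonglongrightarrow> 0" for r
  proof (rule tendsto_sandwich[OF _ _ tendsto_const])
    show "(\<lambda>m. ball_int r (\<lambda>x. (norm (F m x - f x))\<^sup>2)) \<longlonglongrightarrow> 0" using assms by (simp add: L2conv_def)
    show "\<forall>\<^sub>F m in sequentially. ball_int r (\<lambda>x. (norm (indicator S x * F m x - indicator S x * f x))\<^sup>2) \<le> ball_int r (\<lambda>x. (norm (F m x - f x))\<^sup>2)"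
      by (intro always_eventually allI le)
  qed (intro always_eventually allI ball_int_nonneg, simp)
  then show ?thesis unfolding L2conv_def by (intro conjI allI li l)
qed

text \<open>Far out the mollification of \<open>g\<close> equals that of the classical second
  derivatives, since both derivatives can be moved from the kernel onto \<open>v\<close>; L2 limits
  are unique. Of the loss 2 in the radius, one unit is the kernel and one keeps the cut away from
  the circle of radius \<open>R\<close>.\<close>

lemma weak_lap_outside:
  assumes w: "weak_lap u g" and v: "AE y in lebesgue. norm y > R \<longrightarrow> u y = v y" "C1_outside R v"
    and pv: "\<And>i. C1_outside R (partial_deriv i v)"
  shows "AE y in lebesgue. norm y > R + 2 \<longrightarrow> g y = laplacian v y"
proof -
  have l: "locL2 u" "locL2 g" using w by (auto simp: weak_lap_def)
  let ?q = "\<lambda>i. cut (R + 1) (partial_deriv i (partial_deriv i v))"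
  have lq: "locL2 (?q i)" for i by (rule locL2_cut[of R]) (use pv in \<open>auto simp: C1_outside_def\<close>)
  have eq: "mollify m g x = mollify m (\<lambda>x. 1 * ?q 1 x + 1 * ?q 2 x) x" if x: "norm x > R + 2" for x m
  proof -
    let ?\<eta> = "\<lambda>z. complex_of_real (mollifier m z)"
    have s: "smooth ?\<eta>" by (intro smooth_of_real mollifier_smooth)
    have z: "?\<eta> z = 0" if "norm z > 1" for z using mollifier_support1[OF that] by simp
    have z1: "partial_deriv i ?\<eta> z = 0" if "norm z > 1" for i z by (rule partial_deriv_support[OF z that])
    have z2: "partial_deriv i (partial_deriv i ?\<eta>) z = 0" if "norm z > 1" for i z by (rule partial_deriv_support[OF z1 that])
    have x': "norm x > R + 1" "norm x > (R + 1) + 1" using x by auto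
    have "partial_deriv i (partial_deriv i (mollify m u)) x = mollify m (?q i) x" for i
    proof -
      have "partial_deriv i (partial_deriv i (mollify m u)) x = conv u (partial_deriv i (partial_deriv i ?\<eta>)) x"
        unfolding mollify_def by (simp add: conv_partial[OF l(1)] test_function_mollifier test_function_partial)
      also have "\<dots> = conv v (partial_deriv i (partial_deriv i ?\<eta>)) x"
        by (rule conv_cut_AE[OF v(1) z2 x'(1) l(1) _ v(2)]) (auto intro: smooth_continuous smooth_partial s)
      also have "\<dots> = conv (partial_deriv i v) (partial_deriv i ?\<eta>) x"
        by (rule conv_partial_outside[OF v(2) smooth_partial[OF s] z1 x'(1)])
      also have "\<dots> = conv (partial_deriv i (partial_deriv i v)) ?\<eta> x"
        by (rule conv_partial_outside[OF pv s z x'(1)])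
      also have "\<dots> = mollify m (?q i) x"
        unfolding mollify_def by (rule conv_cut[OF z x'(2), symmetric])
      finally show ?thesis .
    qed
    then have "laplacian (mollify m u) x = mollify m (?q 1) x + mollify m (?q 2) x" by (simp add: laplacian_2)
    also have "\<dots> = mollify m (\<lambda>x. 1 * ?q 1 x + 1 * ?q 2 x) x"
      unfolding mollify_def conv_def
      using conv_integrable_test[OF lq test_function_mollifier]
      by (simp add: distrib_right Bochner_Integration.integral_add)
    finally show ?thesis by (simp add: weak_lap_mollify[OF w])
  qed
  let ?S = "{x::real^2. norm x > R + 2}"
  have S: "?S \<in> sets lebesgue" using borel_open[OF open_outside(1)] by simp
  have lqq: "locL2 (\<lambda>x. 1 * ?q 1 x + 1 * ?q 2 x)" by (intro locL2_add locL2_cmult lq)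
  have A: "L2conv (\<lambda>m x. indicator ?S x * mollify m g x) (\<lambda>x. indicator ?S x * g x)"
    by (rule L2conv_restrict[OF mollify_converges[OF l(2)] S])
  have E: "(\<lambda>m x. indicator ?S x * mollify m g x) = (\<lambda>m x. indicator ?S x * mollify m (\<lambda>x. 1 * ?q 1 x + 1 * ?q 2 x) x)"
    by (intro ext) (auto simp: indicator_def eq simp del: mult_1)
  have "L2conv (\<lambda>m x. indicator ?S x * mollify m (\<lambda>x. 1 * ?q 1 x + 1 * ?q 2 x) x) (\<lambda>x. indicator ?S x * (1 * ?q 1 x + 1 * ?q 2 x))"
    by (rule L2conv_restrict[OF mollify_converges[OF lqq] S])
  from L2conv_unique[OF A[unfolded E] this]
  have "AE x in lebesgue. indicator ?S x * g x = indicator ?S x * (1 * ?q 1 x + 1 * ?q 2 x)" .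
  then show ?thesis
    by eventually_elim (auto simp: cut_def laplacian_2)
qed

lemma C1_outside_mono: "C1_outside R v \<Longrightarrow> R \<le> R' \<Longrightarrow> C1_outside R' v"
  unfolding C1_outside_def by (auto intro: continuous_on_subset)

text \<open>Two derivatives are spent on the Laplacian, and the flux of the Laplacian takes the
  third.\<close>

lemma Ck3_outside:
  assumes "Ck_on 3 S v" "open S" "{x. norm x > R} \<subseteq> S"
  shows "C1_outside R v" "C1_outside R (partial_deriv i v)" "C1_outside R (laplacian v)"
proof -
  have c3: "Ck_on (Suc (Suc (Suc 0))) S v" using assms(1) by (simp only: numeral_3_eq_3)
  have *: "C1_outside R f" if f: "Ck_on (Suc 0) S f" for f :: "real^2 \<Rightarrow> complex"
  proof -
    have "f differentiable (at x)" if "norm x > R" for x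
    proof -
      have "x \<in> S" using assms(3) that by auto
      then show ?thesis using f assms(2) by (metis Ck_on.simps(2) at_within_open differentiable_on_def)
    qed
    then show ?thesis using f assms(3) unfolding C1_outside_def by (auto intro: continuous_on_subset)
  qed
  have 2: "Ck_on (Suc 0) S (partial_deriv i (partial_deriv j v))" for i j using c3 by simp
  have 1: "Ck_on (Suc (Suc 0)) S (partial_deriv i v)" for i using c3 by simp
  show "C1_outside R v" by (rule *[OF Ck_on_mono[OF c3]]) simp
  show "C1_outside R (partial_deriv i v)" by (rule *[OF Ck_on_mono[OF 1]]) simp
  have "laplacian v = (\<lambda>x. 1 * partial_deriv 1 (partial_deriv 1 v) x + 1 * partial_deriv 2 (partial_deriv 2 v) x)"
    by (rule ext) (simp add: laplacian_2)
  then show "C1_outside R (laplacian v)" using C1_outside_lincomb(1)[OF *[OF 2] *[OF 2], of 1 1 1 1 2 2] by simp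
qed

theorem theorem3p1:
  fixes k :: real and D :: "(real^2) set" and \<gamma> :: "real \<Rightarrow> real^2"
    and n ui us\<^sub>1 us\<^sub>2 :: "real^2 \<Rightarrow> complex"
  assumes "k > 0"
    and "scatterer D"
    and "path \<gamma>" and "pathfinish \<gamma> = pathstart \<gamma>"
    and "closure D \<subseteq> inside (path_image \<gamma>)"
    and "admissible_coefficient D n"
    and "incident_field k (path_image \<gamma>) ui"
    and "scattering_solution k D n ui us\<^sub>1"
    and "scattering_solution k D n ui us\<^sub>2"
  shows "AE x in lebesgue. us\<^sub>1 x = us\<^sub>2 x"
proof -
  have D: "bounded D" "open D" using assms(2) by (auto simp: scatterer_def)
  obtain B c where n: "n \<in> borel_measurable lebesgue" "AE x in lebesgue. x \<notin> D \<longrightarrow> n x = 1"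
      "AE x in lebesgue. x \<in> D \<longrightarrow> norm (n x) \<le> B" "c > 0" "AE x in lebesgue. x \<in> D \<longrightarrow> Im (n x) \<ge> c"
    using assms(6) unfolding admissible_coefficient_def by blast
  have nB: "AE x in lebesgue. norm (n x) \<le> max B 1"
    using n(2,3) by eventually_elim (auto simp: max_def)
  obtain R where R: "R > 0" "\<And>x. x \<in> closure D \<Longrightarrow> norm x \<le> R"
    using D(1) bounded_closure by (metis bounded_pos)
  have out: "{x. norm x > R} \<subseteq> - closure D" using R(2) by force
  define R0 where "R0 = R + 2"
  have R0: "R0 > 0" "R \<le> R0" using R by (auto simp: R0_def)
  \<comment> \<open>The weak Laplacian \<open>g\<close> is matched far out with the classical
    Laplacian of the representative, so that the second radiation condition becomes a statement
    about \<open>g\<close>.\<close>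
  have sol: "\<exists>g v. weak_lap us g \<and> (AE y in lebesgue. norm y > R0 \<longrightarrow> us y = v y) \<and>
      (AE y in lebesgue. norm y > R0 \<longrightarrow> g y = laplacian v y) \<and> C1_outside R0 v \<and> C1_outside R0 (laplacian v) \<and>
      radiating k v \<and> radiating k (laplacian v) \<and> biharmonic_equation k n ui us"
    if s: "scattering_solution k D n ui us" for us
  proof -
    obtain g where g: "weak_lap us g" using s H2_loc_weak_lap unfolding scattering_solution_def by blast
    obtain v where v: "Ck_on 3 (- closure D) v" "AE x in lebesgue. x \<notin> closure D \<longrightarrow> us x = v x"
      "sommerfeld k v" "sommerfeld k (laplacian v)"
      using s unfolding scattering_solution_def radiation_condition_def by blast
    have C: "C1_outside R v" "C1_outside R (partial_deriv i v)" "C1_outside R (laplacian v)" for i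
      using Ck3_outside[OF v(1) _ out] by auto
    have ae: "AE y in lebesgue. norm y > R \<longrightarrow> us y = v y"
      using v(2) by eventually_elim (use R(2) in force)
    have "AE y in lebesgue. norm y > R0 \<longrightarrow> g y = laplacian v y"
      unfolding R0_def by (rule weak_lap_outside[OF g ae C(1,2)])
    moreover have "AE y in lebesgue. norm y > R0 \<longrightarrow> us y = v y"
      using ae by eventually_elim (use R0 in auto)
    ultimately show ?thesis using g C1_outside_mono[OF C(1) R0(2)] C1_outside_mono[OF C(3) R0(2)]
        sommerfeld_radiating[OF v(3)] sommerfeld_radiating[OF v(4)] s
      unfolding scattering_solution_def by blast
  qed
  obtain g1 v1 where s1: "weak_lap us\<^sub>1 g1" "AE y in lebesgue. norm y > R0 \<longrightarrow> us\<^sub>1 y = v1 y"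
      "AE y in lebesgue. norm y > R0 \<longrightarrow> g1 y = laplacian v1 y" "C1_outside R0 v1" "C1_outside R0 (laplacian v1)"
      "radiating k v1" "radiating k (laplacian v1)" "biharmonic_equation k n ui us\<^sub>1"
    using sol[OF assms(8)] by blast
  obtain g2 v2 where s2: "weak_lap us\<^sub>2 g2" "AE y in lebesgue. norm y > R0 \<longrightarrow> us\<^sub>2 y = v2 y"
      "AE y in lebesgue. norm y > R0 \<longrightarrow> g2 y = laplacian v2 y" "C1_outside R0 v2" "C1_outside R0 (laplacian v2)"
      "radiating k v2" "radiating k (laplacian v2)" "biharmonic_equation k n ui us\<^sub>2"
    using sol[OF assms(9)] by blast
  \<comment> \<open>Differences are spelled as linear combinations with coefficients 1 and -1, the
    form in which the lemmas on weak Laplacians and radiation are stated.\<close>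
  let ?v = "\<lambda>x. 1 * v1 x + (-1) * v2 x" and ?l = "\<lambda>x. 1 * laplacian v1 x + (-1) * laplacian v2 x"
  have C: "C1_outside R0 ?v" "C1_outside R0 ?l" by (intro C1_outside_lincomb s1 s2)+
  have rad: "radiating k ?v" "radiating k ?l"
    by (rule radiating_lincomb[OF s1(4) s2(4) s1(6) s2(6)], rule radiating_lincomb[OF s1(5) s2(5) s1(7) s2(7)])
  have "AE x in lebesgue. 1 * us\<^sub>1 x + (-1) * us\<^sub>2 x = 0"
  proof (rule biharmonic_uniqueness[OF assms(1) R0(1) _ _ n])
    show "D \<in> sets lebesgue" using D(2) by (simp add: borel_open)
    show "norm x < R0" if "x \<in> D" for x using R(2)[of x] that closure_subset[of D] by (auto simp: R0_def)
    show "weak_lap (\<lambda>x. 1 * us\<^sub>1 x + (-1) * us\<^sub>2 x) (\<lambda>x. 1 * g1 x + (-1) * g2 x)"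
      by (rule weak_lap_lincomb[OF s1(1) s2(1)])
    show "weak_lap (\<lambda>x. 1 * g1 x + (-1) * g2 x) (\<lambda>x. of_real k ^ 4 * n x * (1 * us\<^sub>1 x + (-1) * us\<^sub>2 x))"
      by (rule biharmonic_difference[OF s1(1) s2(1) s1(8) s2(8) n(1) nB])
    show "C1_outside R0 (\<lambda>x. 1 / 2 * ?v x + (- 1 / (2 * (of_real k)\<^sup>2)) * ?l x)"
      "C1_outside R0 (\<lambda>x. 1 / 2 * ?v x + (1 / (2 * (of_real k)\<^sup>2)) * ?l x)"
      by (rule C1_outside_lincomb[OF C])+
    show "radiating k (\<lambda>x. 1 / 2 * ?v x + (- 1 / (2 * (of_real k)\<^sup>2)) * ?l x)"
      "radiating k (\<lambda>x. 1 / 2 * ?v x + (1 / (2 * (of_real k)\<^sup>2)) * ?l x)"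
      by (rule radiating_lincomb[OF C rad])+
    have ae: "AE y in lebesgue. norm y > R0 \<longrightarrow> us\<^sub>1 y = v1 y \<and> us\<^sub>2 y = v2 y \<and> g1 y = laplacian v1 y \<and> g2 y = laplacian v2 y"
      using s1(2,3) s2(2,3) by eventually_elim auto
    show "AE y in lebesgue. norm y > R0 \<longrightarrow>
        1 / 2 * (1 * us\<^sub>1 y + (-1) * us\<^sub>2 y) + (- 1 / (2 * (of_real k)\<^sup>2)) * (1 * g1 y + (-1) * g2 y)
        = 1 / 2 * ?v y + (- 1 / (2 * (of_real k)\<^sup>2)) * ?l y"
      using ae by eventually_elim simp
    show "AE y in lebesgue. norm y > R0 \<longrightarrow>
        1 / 2 * (1 * us\<^sub>1 y + (-1) * us\<^sub>2 y) + (1 / (2 * (of_real k)\<^sup>2)) * (1 * g1 y + (-1) * g2 y)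
        = 1 / 2 * ?v y + (1 / (2 * (of_real k)\<^sup>2)) * ?l y"
      using ae by eventually_elim simp
  qed
  then show ?thesis by eventually_elim simp
qed

end
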